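(* Let $R$ be a ring. The following statements are equivalent. 1. The ring $R$ has a left Artinian left quotient ring $Q$. 2. The following conditions (a)--(e) hold: (a) The ring $\overline{R}$ is a left Goldie ring. (b) $\mathfrak{n}$ is a nilpotent ideal. (c) $\mathcal{C}'\subseteq \mathcal{C}$. (d) The left $\overline{R}$-modules $\mathfrak{f}_i$, $1\leq i\leq \nu$, contain no infinite direct sums of nonzero submodules. (e) For every element $\overline{c}\in \overline{\mathcal{C}}$ and every $1\le i\le \nu$, the map $\cdot\overline{c}: \mathfrak{f}_i\to \mathfrak{f}_i$, $f\mapsto f\overline{c}$, is an injection; equivalently, if, for an element $a\in \mathfrak{n}^i/\mathfrak{n}^{i+1}$, there are elements $\overline{s},\overline{c}\in \overline{\mathcal{C}}$ such that $\overline{s}a\overline{c}=0$, then $\overline{t}a=0$ for some element $\overline{t}\in\overline{\mathcal{C}}$; equivalently, if, for an element $a\in \mathfrak{n}^i/\mathfrak{n}^{i+1}$, there is an element $\overline{c}\in\overline{\mathcal{C}}$ such that $a\overline{c}=0$, then $\overline{t}a=0$ for some element $\overline{t}\in\overline{\mathcal{C}}$. If one of the equivalent conditions holds then $\mathcal{C}=\mathcal{C}'$, $\mathcal{C}^{-1}\mathfrak{n}$ is the prime radical of the ring $Q$, which is a nilpotent ideal of nilpotency degree $\nu$, and the map $Q/\mathcal{C}^{-1}\mathfrak{n}\to \overline{Q}$, $c^{-1}r\mapsto \overline{c}^{-1}\overline{r}$, is a ring isomorphism with inverse $\overline{c}^{-1}\overline{r}\mapsto c^{-1}r$.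
   Context: Rings have $1$; module means left module. For a ring $R$: $\mathcal{C}=\mathcal{C}_R$ is the set of regular elements (non-zero-divisors) of $R$; the left quotient ring of $R$ is the left ring of fractions $Q=\mathcal{C}^{-1}R$ (it exists iff $\mathcal{C}$ is a left Ore set). $\mathfrak{n}$ is the prime radical of $R$, and, when $\mathfrak{n}$ is nilpotent, its nilpotency degree $\nu$ is defined by $\mathfrak{n}^{\nu}\neq 0$, $\mathfrak{n}^{\nu+1}=0$ (with $\mathfrak{n}^0=R$). $\overline{R}:=R/\mathfrak{n}$, $\overline{r}:=r+\mathfrak{n}$ for $r\in R$; $\overline{\mathcal{C}}$ is the set of regular elements of $\overline{R}$; $\overline{Q}:=\overline{\mathcal{C}}^{-1}\overline{R}$ is the left quotient ring of $\overline{R}$; $\mathcal{C}':=\{c\in R\mid c+\mathfrak{n}\in\overline{\mathcal{C}}\}$. A ring is a left Goldie ring if it satisfies the ascending chain condition on left annihilators and contains no infinite direct sums of nonzero left ideals. If $\overline{R}$ is a (semiprime) left Goldie ring then, by Goldie's Theorem, $\overline{\mathcal{C}}$ is a left Ore set in $\overline{R}$ and $\overline{Q}$ is semisimple Artinian; in this case, for $i\geq 1$, let $\tau_i:=\{u\in \mathfrak{n}^i/\mathfrak{n}^{i+1}\mid \overline{c}u=0 \text{ for some } \overline{c}\in\overline{\mathcal{C}}\}$, which is a sub-$\overline{R}$-bimodule of the $\overline{R}$-bimodule $\mathfrak{n}^i/\mathfrak{n}^{i+1}$, and let $\mathfrak{f}_i:=(\mathfrak{n}^i/\mathfrak{n}^{i+1})/\tau_i$,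 an $\overline{R}$-bimodule. Conditions (d) and (e) are understood in the presence of (a) and (b). *)

theory Defs
  imports "HOL-Algebra.Weak_Morphisms" "HOL-Algebra.Module" "HOL-Algebra.Ideal_Product"
begin

section \<open>Modules over noncommutative rings\<close>

text \<open>The library locale \<open>module\<close> requires a commutative ring of scalars, so only its record type is
  used here. Scalars act from the left by \<open>smult\<close>; bimodules add a right action \<open>rsmult\<close>.
  The fields \<open>mult\<close> and \<open>one\<close>, inherited from the ring record, play no role for (bi)modules.\<close>

record ('a, 'b) bimodule = "('a, 'b) module" +
  rsmult :: "['b, 'a] \<Rightarrow> 'b"

definition left_submodule ::
  "[('a, 'm) ring_scheme, ('a, 'b, 'n) module_scheme, 'b set] \<Rightarrow> bool" where
  "left_submodule R M N \<longleftrightarrow>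
     additive_subgroup N M \<and> (\<forall>r\<in>carrier R. \<forall>x\<in>N. r \<odot>\<^bsub>M\<^esub> x \<in> N)"

text \<open>The sum of the members of a set \<open>\<N>\<close> of submodules is direct. Indexing by a set loses nothing
  for direct sums of nonzero submodules, since their summands are pairwise distinct.\<close>

definition direct_sum_of :: "[('a, 'b, 'n) module_scheme, 'b set set] \<Rightarrow> bool" where
  "direct_sum_of M \<N> \<longleftrightarrow>
     (\<forall>F x. finite F \<and> F \<subseteq> \<N> \<and> (\<forall>N\<in>F. x N \<in> N) \<and> (\<Oplus>\<^bsub>M\<^esub>N\<in>F. x N) = \<zero>\<^bsub>M\<^esub>
        \<longrightarrow> (\<forall>N\<in>F. x N = \<zero>\<^bsub>M\<^esub>))"

definition no_infinite_direct_sums ::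
  "[('a, 'm) ring_scheme, ('a, 'b, 'n) module_scheme] \<Rightarrow> bool" where
  "no_infinite_direct_sums R M \<longleftrightarrow>
     \<not> (\<exists>\<N>. infinite \<N> \<and> (\<forall>N\<in>\<N>. left_submodule R M N \<and> N \<noteq> {\<zero>\<^bsub>M\<^esub>}) \<and> direct_sum_of M \<N>)"

text \<open>The ring as a left module over itself; its submodules are the left ideals.\<close>

definition left_regular_module :: "('a, 'm) ring_scheme \<Rightarrow> ('a, 'a) module" where
  "left_regular_module R =
     \<lparr>carrier = carrier R, mult = mult R, one = one R, zero = zero R, add = add R,
      smult = mult R\<rparr>"

definition left_ideal :: "['a set, ('a, 'm) ring_scheme] \<Rightarrow> bool" where
  "left_ideal I R \<longleftrightarrow> left_submodule R (left_regular_module R) I"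

section \<open>Left Artinian and left Goldie rings\<close>

definition left_artinian :: "('a, 'm) ring_scheme \<Rightarrow> bool" where
  "left_artinian R \<longleftrightarrow>
     (\<forall>I :: nat \<Rightarrow> 'a set. (\<forall>k. left_ideal (I k) R) \<and> (\<forall>k. I (Suc k) \<subseteq> I k)
        \<longrightarrow> (\<exists>n. \<forall>k\<ge>n. I k = I n))"

definition left_annihilator :: "[('a, 'm) ring_scheme, 'a set] \<Rightarrow> 'a set" where
  "left_annihilator R X = {r \<in> carrier R. \<forall>x\<in>X. r \<otimes>\<^bsub>R\<^esub> x = \<zero>\<^bsub>R\<^esub>}"

definition acc_left_annihilators :: "('a, 'm) ring_scheme \<Rightarrow> bool" where
  "acc_left_annihilators R \<longleftrightarrow>
     (\<forall>A :: nat \<Rightarrow> 'a set.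
        (\<forall>k. \<exists>X\<subseteq>carrier R. A k = left_annihilator R X) \<and> (\<forall>k. A k \<subseteq> A (Suc k))
        \<longrightarrow> (\<exists>n. \<forall>k\<ge>n. A k = A n))"

definition left_goldie :: "('a, 'm) ring_scheme \<Rightarrow> bool" where
  "left_goldie R \<longleftrightarrow>
     acc_left_annihilators R \<and> no_infinite_direct_sums R (left_regular_module R)"

section \<open>Prime radical and nilpotency\<close>

text \<open>The library's \<open>primeideal\<close> is for commutative rings. Following convention, the empty
  intersection, which arises for the zero ring only, is the whole ring.\<close>

definition prime_ideal :: "['a set, ('a, 'm) ring_scheme] \<Rightarrow> bool" where
  "prime_ideal P R \<longleftrightarrow>
     ideal P R \<and> P \<noteq> carrier R \<and>
     (\<forall>I J. ideal I R \<and> ideal J R \<and> I \<cdot>\<^bsub>R\<^esub> J \<subseteq> P \<longrightarrow> I \<subseteq> P \<or> J \<subseteq> P)"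

definition prime_radical :: "('a, 'm) ring_scheme \<Rightarrow> 'a set" where
  "prime_radical R = {x \<in> carrier R. \<forall>P. prime_ideal P R \<longrightarrow> x \<in> P}"

primrec ideal_power :: "[('a, 'm) ring_scheme, 'a set, nat] \<Rightarrow> 'a set" where
  "ideal_power R I 0 = carrier R"
| "ideal_power R I (Suc k) = ideal_power R I k \<cdot>\<^bsub>R\<^esub> I"

definition nilpotent_ideal :: "['a set, ('a, 'm) ring_scheme] \<Rightarrow> bool" where
  "nilpotent_ideal I R \<longleftrightarrow> ideal I R \<and> (\<exists>k. ideal_power R I k = {\<zero>\<^bsub>R\<^esub>})"

text \<open>Meaningful for a nilpotent ideal of a nonzero ring. In the zero ring no \<open>k\<close> qualifies and the
  value is an arbitrary number.\<close>

definition nilpotency_degree :: "['a set, ('a, 'm) ring_scheme] \<Rightarrow> nat" where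
  "nilpotency_degree I R =
     (THE k. ideal_power R I k \<noteq> {\<zero>\<^bsub>R\<^esub>} \<and> ideal_power R I (Suc k) = {\<zero>\<^bsub>R\<^esub>})"

section \<open>Regular elements and left quotient rings\<close>

definition regular_elements :: "('a, 'm) ring_scheme \<Rightarrow> 'a set" where
  "regular_elements R =
     {c \<in> carrier R. \<forall>r\<in>carrier R.
        (c \<otimes>\<^bsub>R\<^esub> r = \<zero>\<^bsub>R\<^esub> \<longrightarrow> r = \<zero>\<^bsub>R\<^esub>) \<and> (r \<otimes>\<^bsub>R\<^esub> c = \<zero>\<^bsub>R\<^esub> \<longrightarrow> r = \<zero>\<^bsub>R\<^esub>)}"

definition left_fraction ::
  "[('q, 'n) ring_scheme, 'a \<Rightarrow> 'q, 'a, 'a] \<Rightarrow> 'q" where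
  "left_fraction Q \<sigma> c r = inv\<^bsub>Q\<^esub> (\<sigma> c) \<otimes>\<^bsub>Q\<^esub> \<sigma> r"

text \<open>\<open>Q\<close> together with \<open>\<sigma> : R \<rightarrow> Q\<close> is a left ring of fractions \<open>S\<^sup>-\<^sup>1R\<close>. This determines
  \<open>(Q, \<sigma>)\<close> up to unique isomorphism under \<open>R\<close>, and forces \<open>S\<close> to be a left Ore set when \<open>S\<close> is a
  multiplicative set of regular elements.\<close>

definition left_ring_of_fractions ::
  "[('a, 'm) ring_scheme, 'a set, ('q, 'n) ring_scheme, 'a \<Rightarrow> 'q] \<Rightarrow> bool" where
  "left_ring_of_fractions R S Q \<sigma> \<longleftrightarrow>
     ring Q \<and> \<sigma> \<in> ring_hom R Q \<and>
     (\<forall>s\<in>S. \<sigma> s \<in> Units Q) \<and>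
     (\<forall>q\<in>carrier Q. \<exists>s\<in>S. \<exists>r\<in>carrier R. q = left_fraction Q \<sigma> s r) \<and>
     a_kernel R Q \<sigma> = {r \<in> carrier R. \<exists>s\<in>S. s \<otimes>\<^bsub>R\<^esub> r = \<zero>\<^bsub>R\<^esub>}"

definition left_quotient_ring ::
  "[('a, 'm) ring_scheme, ('q, 'n) ring_scheme, 'a \<Rightarrow> 'q] \<Rightarrow> bool" where
  "left_quotient_ring R Q \<sigma> \<longleftrightarrow> left_ring_of_fractions R (regular_elements R) Q \<sigma>"

text \<open>Every left ring of fractions is isomorphic to one whose elements are sets of pairs (denominator,
  numerator), so existence may be stated on that type without loss of generality.\<close>

lemma left_ring_of_fractions_on_pair_sets:
  fixes Q :: "('q, 'n) ring_scheme" and R :: "('a, 'm) ring_scheme"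
  assumes Q: "left_ring_of_fractions R S Q \<sigma>"
  shows "\<exists>(Q' :: ('a \<times> 'a) set ring) h. h \<in> ring_iso Q Q' \<and> left_ring_of_fractions R S Q' (h \<circ> \<sigma>)"
proof -
  define f where "f q = {(c, r). c \<in> S \<and> r \<in> carrier R \<and> q = left_fraction Q \<sigma> c r}" for q
  interpret Q: ring Q using Q by (simp add: left_ring_of_fractions_def)
  have inj: "inj_on f (carrier Q)"
  proof (rule inj_onI)
    fix x y assume xy: "x \<in> carrier Q" "y \<in> carrier Q" "f x = f y"
    obtain s r where "(s, r) \<in> f x"
      using Q xy(1) unfolding left_ring_of_fractions_def f_def by blast
    with xy(3) show "x = y" by (auto simp: f_def set_eq_iff)
  qed
  let ?Q = "image_ring f Q"
  have iso: "f \<in> ring_iso Q ?Q" by (rule inj_imp_image_ring_iso[OF inj])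
  interpret Q': ring ?Q by (rule Q.inj_imp_image_ring_is_ring[OF inj])
  have h: "f \<in> ring_hom Q ?Q" using iso by (simp add: ring_iso_def)
  have sc: "\<sigma> r \<in> carrier Q" if "r \<in> carrier R" for r
    using Q that by (auto simp: left_ring_of_fractions_def ring_hom_def)
  have u: "f u \<in> Units ?Q \<and> inv\<^bsub>?Q\<^esub> f u = f (inv\<^bsub>Q\<^esub> u)" if "u \<in> Units Q" for u
  proof -
    have a: "f u \<otimes>\<^bsub>?Q\<^esub> f (inv\<^bsub>Q\<^esub> u) = \<one>\<^bsub>?Q\<^esub>" "f (inv\<^bsub>Q\<^esub> u) \<otimes>\<^bsub>?Q\<^esub> f u = \<one>\<^bsub>?Q\<^esub>"
      using ring_hom_mult[OF h, symmetric] ring_hom_one[OF h] that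
      by (simp_all add: Q.Units_closed Q.Units_inv_closed)
    have b: "f u \<in> carrier ?Q" "f (inv\<^bsub>Q\<^esub> u) \<in> carrier ?Q"
      using h that by (auto simp: ring_hom_def)
    show ?thesis using a b Q'.inv_unique'[OF b] by (auto simp: Units_def)
  qed
  have lf: "left_fraction ?Q (f \<circ> \<sigma>) s r = f (left_fraction Q \<sigma> s r)" if "s \<in> S" "r \<in> carrier R" for s r
  proof -
    have us: "\<sigma> s \<in> Units Q" using Q that by (auto simp: left_ring_of_fractions_def)
    show ?thesis using u[OF us] us sc[OF that(2)] ring_hom_mult[OF h] by (simp add: left_fraction_def)
  qed
  have z: "f x = \<zero>\<^bsub>?Q\<^esub> \<longleftrightarrow> x = \<zero>\<^bsub>Q\<^esub>" if "x \<in> carrier Q" for x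
    using inj that ring_hom_zero[OF h Q.ring_axioms Q'.ring_axioms] by (metis Q.zero_closed inj_onD)
  have "left_ring_of_fractions R S ?Q (f \<circ> \<sigma>)"
    unfolding left_ring_of_fractions_def
  proof (intro conjI ballI)
    show "ring ?Q" by (rule Q'.ring_axioms)
    show "f \<circ> \<sigma> \<in> ring_hom R ?Q"
      using Q h ring_hom_trans by (auto simp: left_ring_of_fractions_def)
    show "(f \<circ> \<sigma>) s \<in> Units ?Q" if "s \<in> S" for s
      using u Q that by (auto simp: left_ring_of_fractions_def)
    show "\<exists>s\<in>S. \<exists>r\<in>carrier R. q = left_fraction ?Q (f \<circ> \<sigma>) s r" if q: "q \<in> carrier ?Q" for q
    proof -
      obtain p where p: "p \<in> carrier Q" "q = f p" using q by (auto simp: image_ring_carrier)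
      then obtain s r where "s \<in> S" "r \<in> carrier R" "p = left_fraction Q \<sigma> s r"
        using Q by (auto simp: left_ring_of_fractions_def)
      with p lf show ?thesis by metis
    qed
    have "a_kernel R ?Q (f \<circ> \<sigma>) = a_kernel R Q \<sigma>"
      using z sc by (auto simp: a_kernel_def kernel_def)
    then show "a_kernel R ?Q (f \<circ> \<sigma>) = {r \<in> carrier R. \<exists>s\<in>S. s \<otimes>\<^bsub>R\<^esub> r = \<zero>\<^bsub>R\<^esub>}"
      using Q by (auto simp: left_ring_of_fractions_def)
  qed
  with iso show ?thesis by blast
qed

definition has_left_quotient_ring :: "('a, 'm) ring_scheme \<Rightarrow> bool" where
  "has_left_quotient_ring R \<longleftrightarrow>
     (\<exists>(Q :: ('a \<times> 'a) set ring) \<sigma>. left_quotient_ring R Q \<sigma>)"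

definition has_left_artinian_left_quotient_ring :: "('a, 'm) ring_scheme \<Rightarrow> bool" where
  "has_left_artinian_left_quotient_ring R \<longleftrightarrow>
     (\<exists>(Q :: ('a \<times> 'a) set ring) \<sigma>. left_quotient_ring R Q \<sigma> \<and> left_artinian Q)"

definition localized_ideal ::
  "[('a, 'm) ring_scheme, ('q, 'n) ring_scheme, 'a \<Rightarrow> 'q, 'a set] \<Rightarrow> 'q set" where
  "localized_ideal R Q \<sigma> I = {left_fraction Q \<sigma> c x | c x. c \<in> regular_elements R \<and> x \<in> I}"

section \<open>The reduction modulo the prime radical\<close>

definition reduced_ring :: "('a, 'm) ring_scheme \<Rightarrow> 'a set ring" where
  "reduced_ring R = R Quot prime_radical R"

definition residue_class :: "('a, 'm) ring_scheme \<Rightarrow> 'a \<Rightarrow> 'a set" where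
  "residue_class R r = prime_radical R +>\<^bsub>R\<^esub> r"

definition regular_mod_radical :: "('a, 'm) ring_scheme \<Rightarrow> 'a set" where
  "regular_mod_radical R = {c \<in> carrier R. residue_class R c \<in> regular_elements (reduced_ring R)}"

text \<open>The bimodule \<open>\<nn>\<^sup>i/\<nn>\<^sup>i\<^sup>+\<^sup>1\<close> over \<open>R/\<nn>\<close>. As in the library's quotient rings,
  \<open>rcoset_mult\<close> sends a coset of \<open>a\<close> and a coset of \<open>x\<close> to the coset of \<open>a x\<close>, here modulo
  \<open>\<nn>\<^sup>i\<^sup>+\<^sup>1\<close>.\<close>

definition radical_layer :: "('a, 'm) ring_scheme \<Rightarrow> nat \<Rightarrow> ('a set, 'a set) bimodule" where
  "radical_layer R i =
     (let I = ideal_power R (prime_radical R) i;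
          J = ideal_power R (prime_radical R) (Suc i)
      in \<lparr>carrier = (\<lambda>x. J +>\<^bsub>R\<^esub> x) ` I, mult = undefined, one = undefined,
          zero = J, add = set_add R,
          smult = rcoset_mult R J, rsmult = rcoset_mult R J\<rparr>)"

definition quotient_bimodule ::
  "[('a, 'b, 'n) bimodule_scheme, 'b set] \<Rightarrow> ('a, 'b set) bimodule" where
  "quotient_bimodule M T =
     \<lparr>carrier = a_rcosets\<^bsub>M\<^esub> T, mult = undefined, one = undefined,
      zero = T, add = set_add M,
      smult = (\<lambda>r X. \<Union>x\<in>X. T +>\<^bsub>M\<^esub> (r \<odot>\<^bsub>M\<^esub> x)),
      rsmult = (\<lambda>X r. \<Union>x\<in>X. T +>\<^bsub>M\<^esub> (rsmult M x r))\<rparr>"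

definition layer_torsion :: "('a, 'm) ring_scheme \<Rightarrow> nat \<Rightarrow> 'a set set" where
  "layer_torsion R i =
     {u \<in> carrier (radical_layer R i).
        \<exists>c\<in>regular_elements (reduced_ring R).
          c \<odot>\<^bsub>radical_layer R i\<^esub> u = \<zero>\<^bsub>radical_layer R i\<^esub>}"

definition torsion_free_layer ::
  "('a, 'm) ring_scheme \<Rightarrow> nat \<Rightarrow> ('a set, 'a set set) bimodule" where
  "torsion_free_layer R i = quotient_bimodule (radical_layer R i) (layer_torsion R i)"

definition right_mult_injective :: "('a, 'm) ring_scheme \<Rightarrow> nat \<Rightarrow> bool" where
  "right_mult_injective R i \<longleftrightarrow>
     (\<forall>c\<in>regular_elements (reduced_ring R).
        inj_on (\<lambda>f. rsmult (torsion_free_layer R i) f c) (carrier (torsion_free_layer R i)))"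

definition two_sided_torsion_condition :: "('a, 'm) ring_scheme \<Rightarrow> nat \<Rightarrow> bool" where
  "two_sided_torsion_condition R i \<longleftrightarrow>
     (let M = radical_layer R i; C = regular_elements (reduced_ring R) in
      \<forall>a\<in>carrier M. (\<exists>s\<in>C. \<exists>c\<in>C. rsmult M (s \<odot>\<^bsub>M\<^esub> a) c = \<zero>\<^bsub>M\<^esub>)
        \<longrightarrow> (\<exists>t\<in>C. t \<odot>\<^bsub>M\<^esub> a = \<zero>\<^bsub>M\<^esub>))"

definition right_torsion_condition :: "('a, 'm) ring_scheme \<Rightarrow> nat \<Rightarrow> bool" where
  "right_torsion_condition R i \<longleftrightarrow>
     (let M = radical_layer R i; C = regular_elements (reduced_ring R) in
      \<forall>a\<in>carrier M. (\<exists>c\<in>C. rsmult M a c = \<zero>\<^bsub>M\<^esub>)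
        \<longrightarrow> (\<exists>t\<in>C. t \<odot>\<^bsub>M\<^esub> a = \<zero>\<^bsub>M\<^esub>))"

end

theory Submission
  imports Defs
begin

text \<open>An infinite direct sum in a module is encoded by a descending flag: left ideals \<open>D\<^sub>0 \<supseteq> D\<^sub>1 \<supseteq> \<dots>\<close> with
  elements \<open>x\<^sub>k \<in> D\<^sub>k\<close> such that \<open>R x\<^sub>k\<close> meets \<open>D\<^sub>k\<^sub>+\<^sub>1\<close> trivially. Goldie's argument and its variants
  produce such flags directly.

  Sufficiency of (a)--(e): if \<open>w \<in> \<nn>\<^sup>i\<close> and \<open>c\<close> is regular modulo \<open>\<nn>\<close>, then \<open>\<ff>\<^sub>i c\<close> is essential in \<open>\<ff>\<^sub>i\<close>, since
  otherwise \<open>b w, b w c, b w c\<^sup>2, \<dots>\<close> would span an infinite direct sum for some \<open>b\<close>. By Goldie's theorem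
  \<open>s w \<in> \<ff>\<^sub>i c\<close> for some \<open>s \<in> \<C>'\<close>, and induction on \<open>i\<close> gives the left Ore condition for \<open>\<C>'\<close>. A descending
  chain of \<open>\<C>'\<close>-saturated left ideals stabilises in every layer \<open>\<ff>\<^sub>i\<close>, hence stabilises. Applied to the
  saturations of \<open>R c\<^sup>k\<close> with \<open>c\<close> regular, this gives \<open>\<C> = \<C>'\<close>, so \<open>\<C>\<^sup>-\<^sup>1 R\<close> exists and is left Artinian.

  Necessity: for a left Artinian \<open>Q = \<C>\<^sup>-\<^sup>1 R\<close> with prime radical \<open>K\<close>, extension of a two-sided ideal of \<open>R\<close>
  is a two-sided ideal of \<open>Q\<close>. Hence \<open>K \<inter> R\<close> is a semiprime ideal as well as nilpotent, so it is \<open>\<nn>\<close>, and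
  \<open>K\<^sup>i = \<C>\<^sup>-\<^sup>1 \<nn>\<^sup>i\<close>. Then \<open>Q/K\<close> is a left quotient ring of \<open>R/\<nn>\<close>, and (a)--(e) are read off.\<close>

section \<open>Left ideals and infinite direct sums\<close>

text \<open>Statements about \<open>R/\<nn>\<close> and about the layers are pulled back to left
  ideals of \<open>R\<close>, with membership in \<open>rad\<close> or \<open>tors i\<close> in the
  role of being zero. Index 0 is included: that layer is \<open>R/\<nn>\<close>, and its torsion is
  zero. Apart from the chain condition on annihilators, finiteness enters only through flags and
  stabilising chains, not through uniform dimension or composition length. The obstacle in the
  sufficiency proof is that Goldie's theorem gives the Ore condition only up to an error in \<nn>.
  On a single layer this error is harmless, since \<nn> maps each power of \<nn> into the next one,
  but the exact relation has to be recovered by successive approximation, and (d) and (e) make each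
  correction possible. Moreover (c) is only one of the two inclusions between the regular elements
  and \<open>reg_mod\<close>, so saturation refers to \<open>reg_mod\<close> until the other
  inclusion has been derived from a chain condition. The left Artinian property of a left quotient
  ring is rewritten as a chain condition inside \<open>R\<close>. This form does not mention the
  quotient ring and is therefore shared by all of them, whatever their types.\<close>

lemma strict_subchain:
  fixes I :: "nat \<Rightarrow> 'a set"
  assumes dec: "\<And>k. I (Suc k) \<subseteq> I k" and ns: "\<not> (\<exists>n. \<forall>k\<ge>n. I k = I n)"
  obtains g :: "nat \<Rightarrow> nat" where "strict_mono g" "\<And>k. I (g (Suc k)) \<subset> I (g k)"
proof -
  have anti: "I m \<subseteq> I n" if "n \<le> m" for n m
    using that by (induction m rule: dec_induct) (use dec in auto)
  have "\<exists>m>n. I m \<subset> I n" for n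
    using ns anti by (metis le_neq_implies_less psubsetI)
  then have "\<exists>g. \<forall>n. g n < g (Suc n) \<and> I (g (Suc n)) \<subset> I (g n)"
    using dependent_nat_choice[of "\<lambda>_ _. True" "\<lambda>_ n m. n < m \<and> I m \<subset> I n"] by simp
  then obtain g where "\<forall>n. g n < g (Suc n) \<and> I (g (Suc n)) \<subset> I (g n)" by blast
  then show thesis using that[of g] by (simp add: strict_mono_Suc_iff)
qed

text \<open>Negatives come from multiplication by \<open>\<ominus> \<one>\<close>, so closure under
  sums and left multiples already gives an additive subgroup.\<close>

lemma (in ring) left_ideal_iff:
  "left_ideal I R \<longleftrightarrow> I \<subseteq> carrier R \<and> \<zero> \<in> I \<and> (\<forall>x\<in>I. \<forall>y\<in>I. x \<oplus> y \<in> I) \<and>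
     (\<forall>r\<in>carrier R. \<forall>x\<in>I. r \<otimes> x \<in> I)"
proof
  assume "left_ideal I R"
  then have a: "additive_subgroup I R" and b: "\<forall>r\<in>carrier R. \<forall>x\<in>I. r \<otimes> x \<in> I"
    by (simp_all add: left_ideal_def left_submodule_def additive_subgroup_def
        left_regular_module_def subgroup_def m_inv_def)
  interpret additive_subgroup I R by fact
  show "I \<subseteq> carrier R \<and> \<zero> \<in> I \<and> (\<forall>x\<in>I. \<forall>y\<in>I. x \<oplus> y \<in> I) \<and>
     (\<forall>r\<in>carrier R. \<forall>x\<in>I. r \<otimes> x \<in> I)" using b a_subset by simp
next
  assume h: "I \<subseteq> carrier R \<and> \<zero> \<in> I \<and> (\<forall>x\<in>I. \<forall>y\<in>I. x \<oplus> y \<in> I) \<and>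
     (\<forall>r\<in>carrier R. \<forall>x\<in>I. r \<otimes> x \<in> I)"
  have inv: "\<ominus> x \<in> I" if "x \<in> I" for x
  proof -
    have "x \<in> carrier R" using h that by blast
    then have "(\<ominus> \<one>) \<otimes> x = \<ominus> x" by (simp add: l_minus)
    moreover have "(\<ominus> \<one>) \<otimes> x \<in> I" using h that by simp
    ultimately show ?thesis by simp
  qed
  have "additive_subgroup I R"
    by (rule additive_subgroupI, rule add.subgroupI) (use h inv in \<open>auto simp: a_inv_def\<close>)
  then show "left_ideal I R" using h
    by (simp add: left_ideal_def left_submodule_def additive_subgroup_def
        left_regular_module_def subgroup_def m_inv_def)
qed

context ring
begin

lemma left_idealI:
  assumes "I \<subseteq> carrier R" "\<zero> \<in> I" "\<And>x y. x \<in> I \<Longrightarrow> y \<in> I \<Longrightarrow> x \<oplus> y \<in> I"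
    "\<And>r x. r \<in> carrier R \<Longrightarrow> x \<in> I \<Longrightarrow> r \<otimes> x \<in> I"
  shows "left_ideal I R"
  using assms unfolding left_ideal_iff by blast

lemma
  assumes "left_ideal I R"
  shows left_ideal_sub: "x \<in> I \<Longrightarrow> x \<in> carrier R"
    and left_ideal_zero: "\<zero> \<in> I"
    and left_ideal_add: "x \<in> I \<Longrightarrow> y \<in> I \<Longrightarrow> x \<oplus> y \<in> I"
    and left_ideal_mult: "r \<in> carrier R \<Longrightarrow> x \<in> I \<Longrightarrow> r \<otimes> x \<in> I"
  using assms unfolding left_ideal_iff by blast+

lemma left_ideal_minus:
  assumes "left_ideal I R" "x \<in> I" shows "\<ominus> x \<in> I"
proof -
  have "(\<ominus> \<one>) \<otimes> x \<in> I" using assms left_ideal_mult by blast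
  moreover have "(\<ominus> \<one>) \<otimes> x = \<ominus> x" using assms by (simp add: l_minus left_ideal_sub)
  ultimately show ?thesis by simp
qed

lemma left_ideal_diff:
  assumes "left_ideal I R" "x \<in> I" "y \<in> I" shows "x \<ominus> y \<in> I"
  using assms left_ideal_minus left_ideal_add by (simp add: minus_eq)

lemma left_ideal_add_cancel:
  assumes I: "left_ideal I R" "x \<oplus> y \<in> I" "x \<in> carrier R" "y \<in> carrier R"
  shows "x \<in> I \<longleftrightarrow> y \<in> I"
proof -
  have "(x \<oplus> y) \<ominus> y = x" "(x \<oplus> y) \<ominus> x = y" using I(3,4)
    by (simp_all add: minus_eq a_assoc r_neg) (metis a_comm a_assoc a_inv_closed r_neg r_zero)
  then show ?thesis using left_ideal_diff[OF I(1)] I(2) by metis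
qed

lemma diff_zero_iff:
  assumes "x \<in> carrier R" "y \<in> carrier R"
  shows "x \<ominus> y = \<zero> \<longleftrightarrow> x = y"
proof
  assume "x \<ominus> y = \<zero>"
  then have "(x \<ominus> y) \<oplus> y = y" using assms by simp
  then show "x = y" using assms by (simp add: minus_eq a_assoc l_neg)
qed (use assms in \<open>simp add: minus_eq r_neg\<close>)

lemma
  assumes "x \<in> carrier R" "y \<in> carrier R"
  shows add_diff_eq: "y \<oplus> (x \<ominus> y) = x" and diff_add_eq: "(y \<oplus> x) \<ominus> y = x"
proof -
  have "(x \<ominus> y) \<oplus> y = x" using assms by (simp add: minus_eq a_assoc l_neg)
  then show "y \<oplus> (x \<ominus> y) = x" using assms a_comm[of y "x \<ominus> y"] by simp
  have "(x \<oplus> y) \<ominus> y = x" using assms by (simp add: minus_eq a_assoc r_neg)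
  then show "(y \<oplus> x) \<ominus> y = x" using assms a_comm[of y x] by simp
qed

lemma ideal_left_ideal: "ideal I R \<Longrightarrow> left_ideal I R"
  by (rule left_idealI)
    (auto simp: ideal.Icarr ideal.I_l_closed additive_subgroup.zero_closed additive_subgroup.a_closed
      ideal.axioms(1))

lemma left_ideal_right_multiples:
  assumes "left_ideal L R" "c \<in> carrier R"
  shows "left_ideal ((\<lambda>r. r \<otimes> c) ` L) R"
proof (rule left_idealI)
  show "(\<lambda>r. r \<otimes> c) ` L \<subseteq> carrier R" using assms left_ideal_sub by auto
  show "\<zero> \<in> (\<lambda>r. r \<otimes> c) ` L" using assms left_ideal_zero by (force simp: image_iff)
  show "x \<oplus> y \<in> (\<lambda>r. r \<otimes> c) ` L" if "x \<in> (\<lambda>r. r \<otimes> c) ` L" "y \<in> (\<lambda>r. r \<otimes> c) ` L" for x y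
    using that assms left_ideal_add left_ideal_sub by (auto simp: image_iff) (metis l_distr)
  show "r \<otimes> x \<in> (\<lambda>r. r \<otimes> c) ` L" if "r \<in> carrier R" "x \<in> (\<lambda>r. r \<otimes> c) ` L" for r x
    using that assms left_ideal_mult left_ideal_sub by (auto simp: image_iff) (metis m_assoc)
qed

lemma left_ideal_carrier: "left_ideal (carrier R) R" by (rule left_idealI) auto

lemma left_ideal_zeroset: "left_ideal {\<zero>} R" by (rule left_idealI) auto

lemma left_ideal_inter: "left_ideal I R \<Longrightarrow> left_ideal J R \<Longrightarrow> left_ideal (I \<inter> J) R"
  by (simp add: left_ideal_iff) blast

lemma left_ideal_plus:
  assumes I: "left_ideal I R" and J: "left_ideal J R"
  shows "left_ideal {x \<oplus> y | x y. x \<in> I \<and> y \<in> J} R"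
proof (rule left_idealI)
  note s = left_ideal_sub[OF I] left_ideal_sub[OF J]
  show "{x \<oplus> y | x y. x \<in> I \<and> y \<in> J} \<subseteq> carrier R" using s by auto
  show "\<zero> \<in> {x \<oplus> y | x y. x \<in> I \<and> y \<in> J}" using left_ideal_zero I J by force
  show "a \<oplus> b \<in> {x \<oplus> y | x y. x \<in> I \<and> y \<in> J}"
    if a: "a \<in> {x \<oplus> y | x y. x \<in> I \<and> y \<in> J}" and b: "b \<in> {x \<oplus> y | x y. x \<in> I \<and> y \<in> J}" for a b
  proof -
    obtain x y where 1: "x \<in> I" "y \<in> J" "a = x \<oplus> y" using a by blast
    obtain x' y' where 2: "x' \<in> I" "y' \<in> J" "b = x' \<oplus> y'" using b by blast
    have "a \<oplus> b = (x \<oplus> x') \<oplus> (y \<oplus> y')" using 1 2 s by (simp add: a_ac)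
    then show ?thesis using 1 2 left_ideal_add I J by blast
  qed
  show "r \<otimes> a \<in> {x \<oplus> y | x y. x \<in> I \<and> y \<in> J}"
    if r: "r \<in> carrier R" and a: "a \<in> {x \<oplus> y | x y. x \<in> I \<and> y \<in> J}" for r a
  proof -
    obtain x y where 1: "x \<in> I" "y \<in> J" "a = x \<oplus> y" using a by blast
    then have "r \<otimes> a = r \<otimes> x \<oplus> r \<otimes> y" using r s by (simp add: r_distr)
    then show ?thesis using 1 r left_ideal_mult I J by blast
  qed
qed

lemma left_ideal_colon:
  assumes I: "left_ideal I R" and x: "x \<in> carrier R"
  shows "left_ideal {r \<in> carrier R. r \<otimes> x \<in> I} R"
  by (rule left_idealI)
    (use x left_ideal_zero[OF I] left_ideal_add[OF I] left_ideal_mult[OF I] in \<open>auto simp: l_distr m_assoc\<close>)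

lemma left_ideal_annihilator_elt:
  "x \<in> carrier R \<Longrightarrow> left_ideal {r \<in> carrier R. r \<otimes> x = \<zero>} R"
  using left_ideal_colon[OF left_ideal_zeroset, of x] by simp

end

text \<open>The module meant is \<open>I/T\<close>: zero is read as membership in \<open>T\<close>,
  and the last clause says that the multiples of \<open>x k\<close> meet \<open>D (Suc k)\<close>
  only in zero. With \<open>T = {\<zero>}\<close>, \<open>T = rad\<close> and
  \<open>T = tors i\<close> the same notion covers a ring, \<open>R/rad\<close> and the torsion-free
  layers.\<close>

definition descending_flag ::
  "('a, 'm) ring_scheme \<Rightarrow> 'a set \<Rightarrow> 'a set \<Rightarrow> (nat \<Rightarrow> 'a set) \<Rightarrow> (nat \<Rightarrow> 'a) \<Rightarrow> bool" where
  "descending_flag R I T D x \<longleftrightarrow>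
     (\<forall>k. left_ideal (D k) R \<and> D k \<subseteq> I \<and> T \<subseteq> D k \<and> D (Suc k) \<subseteq> D k \<and> x k \<in> D k - T \<and>
        (\<forall>r\<in>carrier R. r \<otimes>\<^bsub>R\<^esub> x k \<in> D (Suc k) \<longrightarrow> r \<otimes>\<^bsub>R\<^esub> x k \<in> T))"

lemma descending_flagI:
  assumes "\<And>k. left_ideal (D k) R" "\<And>k. D k \<subseteq> I" "\<And>k. T \<subseteq> D k" "\<And>k. D (Suc k) \<subseteq> D k"
    "\<And>k. x k \<in> D k" "\<And>k. x k \<notin> T"
    "\<And>k r. r \<in> carrier R \<Longrightarrow> r \<otimes>\<^bsub>R\<^esub> x k \<in> D (Suc k) \<Longrightarrow> r \<otimes>\<^bsub>R\<^esub> x k \<in> T"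
  shows "descending_flag R I T D x"
  using assms unfolding descending_flag_def by blast

text \<open>A module \<open>M\<close> over a quotient \<open>S\<close> of \<open>R\<close> is given as the image of a left ideal \<open>I\<close> of \<open>R\<close> under \<open>\<pi>\<close> with
  kernel \<open>T\<close>, so that statements about \<open>M\<close> become statements about left ideals between \<open>T\<close> and \<open>I\<close>.\<close>

locale presented_module = ring R for R :: "('a, 'm) ring_scheme" (structure) +
  fixes S :: "('s, 'k) ring_scheme" and M :: "('s, 'c, 'n) module_scheme"
    and \<rho> :: "'a \<Rightarrow> 's" and \<pi> :: "'a \<Rightarrow> 'c" and I T :: "'a set"
  assumes scalars: "\<rho> ` carrier R = carrier S"
    and I: "left_ideal I R"
    and onto: "\<pi> ` I = carrier M"
    and add: "\<And>x y. x \<in> I \<Longrightarrow> y \<in> I \<Longrightarrow> \<pi> x \<oplus>\<^bsub>M\<^esub> \<pi> y = \<pi> (x \<oplus> y)"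
    and zero: "\<pi> \<zero> = \<zero>\<^bsub>M\<^esub>"
    and smult: "\<And>r x. r \<in> carrier R \<Longrightarrow> x \<in> I \<Longrightarrow> \<rho> r \<odot>\<^bsub>M\<^esub> \<pi> x = \<pi> (r \<otimes> x)"
    and ker: "\<And>x. x \<in> I \<Longrightarrow> \<pi> x = \<zero>\<^bsub>M\<^esub> \<longleftrightarrow> x \<in> T"
    and TI: "T \<subseteq> I"
begin

lemma Isub: "x \<in> I \<Longrightarrow> x \<in> carrier R" using I left_ideal_sub by blast

lemma abelian_group_M: "abelian_group M"
proof (rule abelian_groupI)
  fix x y z assume "x \<in> carrier M" "y \<in> carrier M" "z \<in> carrier M"
  then obtain a b c where *: "x = \<pi> a" "a \<in> I" "y = \<pi> b" "b \<in> I" "z = \<pi> c" "c \<in> I"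
    by (auto simp: onto[symmetric])
  show "x \<oplus>\<^bsub>M\<^esub> y \<in> carrier M" using * add left_ideal_add[OF I] by (simp add: onto[symmetric])
  show "x \<oplus>\<^bsub>M\<^esub> y \<oplus>\<^bsub>M\<^esub> z = x \<oplus>\<^bsub>M\<^esub> (y \<oplus>\<^bsub>M\<^esub> z)"
    using * add left_ideal_add[OF I] Isub by (simp add: a_assoc)
  show "x \<oplus>\<^bsub>M\<^esub> y = y \<oplus>\<^bsub>M\<^esub> x" using * add Isub by (simp add: a_comm)
  show "\<zero>\<^bsub>M\<^esub> \<oplus>\<^bsub>M\<^esub> x = x" using * add[OF left_ideal_zero[OF I]] Isub by (simp add: zero[symmetric])
  show "\<exists>y\<in>carrier M. y \<oplus>\<^bsub>M\<^esub> x = \<zero>\<^bsub>M\<^esub>"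
    by (rule bexI[of _ "\<pi> (\<ominus> a)"])
      (use * add left_ideal_minus[OF I] Isub onto zero in \<open>auto simp: l_neg\<close>)
next
  show "\<zero>\<^bsub>M\<^esub> \<in> carrier M" using zero left_ideal_zero[OF I] onto by force
qed

sublocale M: abelian_group M by (rule abelian_group_M)

lemma pi_closed: "x \<in> I \<Longrightarrow> \<pi> x \<in> carrier M" using onto by blast

lemma pi_minus: "x \<in> I \<Longrightarrow> \<ominus>\<^bsub>M\<^esub> \<pi> x = \<pi> (\<ominus> x)"
  by (rule M.minus_equality)
    (use add left_ideal_minus[OF I] Isub pi_closed zero in \<open>auto simp: l_neg\<close>)

lemma pi_eq_iff: "x \<in> I \<Longrightarrow> y \<in> I \<Longrightarrow> \<pi> x = \<pi> y \<longleftrightarrow> x \<ominus> y \<in> T"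
  using ker[of "x \<ominus> y"] left_ideal_diff[OF I] pi_minus add left_ideal_minus[OF I] pi_closed
  by (metis M.r_neg M.minus_equality M.minus_minus a_minus_def M.a_inv_closed)

lemma T: "left_ideal T R"
proof (rule left_idealI)
  show "T \<subseteq> carrier R" using TI Isub by blast
  show "\<zero> \<in> T" using ker zero left_ideal_zero[OF I] by blast
  show "x \<oplus> y \<in> T" if "x \<in> T" "y \<in> T" for x y
    using that TI ker[of x] ker[of y] add[of x y] ker[of "x \<oplus> y"] left_ideal_add[OF I] by (metis M.l_zero M.zero_closed subsetD)
  show "r \<otimes> x \<in> T" if "r \<in> carrier R" "x \<in> T" for r x
  proof -
    have "x \<in> I" using that TI by blast
    then have "\<pi> (r \<otimes> x) = \<rho> r \<odot>\<^bsub>M\<^esub> \<pi> \<zero>" using smult[OF that(1) \<open>x \<in> I\<close>] that(2) ker[OF \<open>x \<in> I\<close>] zero by simp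
    also have "\<dots> = \<zero>\<^bsub>M\<^esub>" using smult[OF that(1) left_ideal_zero[OF I]] that zero by simp
    finally show ?thesis using ker left_ideal_mult[OF I] that \<open>x \<in> I\<close> by blast
  qed
qed

lemma image_submodule:
  assumes L: "left_ideal L R" "L \<subseteq> I"
  shows "left_submodule S M (\<pi> ` L)"
  unfolding left_submodule_def
proof
  show "additive_subgroup (\<pi> ` L) M"
  proof -
    have "\<pi> ` L \<subseteq> carrier M" "\<pi> ` L \<noteq> {}" using L pi_closed left_ideal_zero[OF L(1)] by auto
    moreover have "\<ominus>\<^bsub>M\<^esub> a \<in> \<pi> ` L" if "a \<in> \<pi> ` L" for a
      using that pi_minus L left_ideal_minus[OF L(1)] by auto
    moreover have "a \<oplus>\<^bsub>M\<^esub> b \<in> \<pi> ` L" if "a \<in> \<pi> ` L" "b \<in> \<pi> ` L" for a b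
      using that add L left_ideal_add[OF L(1)] by (auto simp: subset_iff)
    ultimately show ?thesis
      by (intro additive_subgroupI M.add.subgroupI) (auto simp: a_inv_def)
  qed
  show "\<forall>r\<in>carrier S. \<forall>x\<in>\<pi> ` L. r \<odot>\<^bsub>M\<^esub> x \<in> \<pi> ` L"
    using smult L left_ideal_mult[OF L(1)] by (auto simp: scalars[symmetric] subset_iff)
qed

lemma finsum_pi:
  assumes "finite A" "\<And>k. k \<in> A \<Longrightarrow> v k \<in> I"
  shows "(\<Oplus>k\<in>A. v k) \<in> I \<and> (\<Oplus>\<^bsub>M\<^esub>k\<in>A. \<pi> (v k)) = \<pi> (\<Oplus>k\<in>A. v k)"
  using assms
proof (induction A rule: finite_induct)
  case empty then show ?case by (simp add: zero left_ideal_zero[OF I])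
next
  case (insert a A)
  then show ?case using add left_ideal_add[OF I]
    by (subst finsum_insert M.finsum_insert, auto simp: Isub pi_closed)+
qed

lemma independent_imp_direct_sum:
  fixes x :: "nat \<Rightarrow> 'a"
  assumes x: "\<And>k. x k \<in> I - T"
    and ind: "\<And>A r k. finite A \<Longrightarrow> r \<in> A \<rightarrow> carrier R \<Longrightarrow> (\<Oplus>k\<in>A. r k \<otimes> x k) \<in> T \<Longrightarrow> k \<in> A \<Longrightarrow> r k \<otimes> x k \<in> T"
  shows "\<not> no_infinite_direct_sums S M"
proof -
  define L where "L k = (\<lambda>r. r \<otimes> x k) ` carrier R" for k
  define N where "N k = \<pi> ` L k" for k
  have xI: "x k \<in> I" "x k \<in> carrier R" "x k \<notin> T" for k using x Isub by blast+
  have L: "left_ideal (L k) R" "L k \<subseteq> I" "x k \<in> L k" for k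
  proof -
    show "left_ideal (L k) R" unfolding L_def by (rule left_ideal_right_multiples[OF left_ideal_carrier xI(2)])
    show "L k \<subseteq> I" using left_ideal_mult[OF I] xI by (auto simp: L_def)
    show "x k \<in> L k" unfolding L_def by (rule image_eqI[of _ _ \<one>]) (use xI in auto)
  qed
  \<comment> \<open>Direct sums are indexed by a set of submodules, so the family is infinite only
    if its members are pairwise distinct. Equal members would give a relation modulo
    \<open>T\<close> with coefficient \<open>\<one>\<close> at \<open>x j\<close>, against
    independence.\<close>
  have dist: False if "j \<noteq> k" "N j = N k" for j k
  proof -
    have "\<pi> (x j) \<in> N k" using that L by (auto simp: N_def)
    then obtain r where r: "r \<in> carrier R" "\<pi> (x j) = \<pi> (r \<otimes> x k)" by (auto simp: N_def L_def)
    have rI: "r \<otimes> x k \<in> I" using r left_ideal_mult[OF I] xI by blast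
    have "x j \<ominus> r \<otimes> x k \<in> T" using r pi_eq_iff[OF xI(1) rI] by simp
    define s where "s i = (if i = j then \<one> else \<ominus> r)" for i
    have "(\<Oplus>i\<in>{j, k}. s i \<otimes> x i) = x j \<ominus> r \<otimes> x k"
      using that r xI by (subst finsum_insert) (auto simp: s_def l_minus minus_eq)
    then have "s j \<otimes> x j \<in> T"
      using ind[of "{j, k}" s j] \<open>x j \<ominus> r \<otimes> x k \<in> T\<close> r by (auto simp: s_def)
    then show False using xI by (simp add: s_def)
  qed
  then have inj: "inj N" by (meson injI)
  have "direct_sum_of M (range N)"
    unfolding direct_sum_of_def
  proof (intro allI impI, elim conjE)
    fix F y assume F: "finite F" "F \<subseteq> range N" "\<forall>X\<in>F. y X \<in> X" "(\<Oplus>\<^bsub>M\<^esub>X\<in>F. y X) = \<zero>\<^bsub>M\<^esub>"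
    obtain A where A: "finite A" "F = N ` A" using finite_subset_image F by metis
    have "\<forall>k\<in>A. \<exists>r\<in>carrier R. y (N k) = \<pi> (r \<otimes> x k)" using F A by (auto simp: N_def L_def)
    then obtain r where r: "\<forall>k\<in>A. r k \<in> carrier R \<and> y (N k) = \<pi> (r k \<otimes> x k)" by metis
    have rI: "r k \<otimes> x k \<in> I" if "k \<in> A" for k using r that left_ideal_mult[OF I] xI by blast
    have "(\<Oplus>\<^bsub>M\<^esub>X\<in>F. y X) = (\<Oplus>\<^bsub>M\<^esub>k\<in>A. y (N k))"
      unfolding A(2) by (rule M.add.finprod_reindex)
        (use r rI pi_closed inj in \<open>auto simp: inj_on_def inj_def\<close>)
    also have "\<dots> = (\<Oplus>\<^bsub>M\<^esub>k\<in>A. \<pi> (r k \<otimes> x k))"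
      by (rule M.add.finprod_cong') (use r rI pi_closed in auto)
    also have "\<dots> = \<pi> (\<Oplus>k\<in>A. r k \<otimes> x k)" using finsum_pi[OF A(1), of "\<lambda>k. r k \<otimes> x k"] rI by blast
    finally have "(\<Oplus>k\<in>A. r k \<otimes> x k) \<in> T"
      using F(4) ker[of "\<Oplus>k\<in>A. r k \<otimes> x k"] finsum_pi[OF A(1), of "\<lambda>k. r k \<otimes> x k"] rI by metis
    then have "r k \<otimes> x k \<in> T" if "k \<in> A" for k using ind[OF A(1) _ _ that] r by blast
    then show "\<forall>X\<in>F. y X = \<zero>\<^bsub>M\<^esub>" using A r ker rI by auto
  qed
  moreover have "infinite (range N)" using inj finite_imageD infinite_UNIV_nat by blast
  moreover have "\<forall>X\<in>range N. left_submodule S M X \<and> X \<noteq> {\<zero>\<^bsub>M\<^esub>}"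
    using image_submodule[OF L(1,2)] L(3) ker xI unfolding N_def
    by (auto simp: set_eq_iff) (metis imageI)
  ultimately show ?thesis unfolding no_infinite_direct_sums_def by blast
qed

text \<open>In a relation among the \<open>r k \<otimes> x k\<close> modulo \<open>T\<close>, all
  terms but the one of smallest index \<open>b\<close> lie in \<open>D (Suc b)\<close>. Hence so
  does that term, so it lies in \<open>T\<close> and can be removed. The induction therefore adds
  new indices below the old ones.\<close>

lemma flag_imp_direct_sum:
  assumes f: "descending_flag R I T D x"
  shows "\<not> no_infinite_direct_sums S M"
proof (rule independent_imp_direct_sum[of x])
  have D: "left_ideal (D k) R" "T \<subseteq> D k" "D k \<subseteq> I" "D (Suc k) \<subseteq> D k" "x k \<in> D k" "x k \<notin> T" for k
    using f by (auto simp: descending_flag_def)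
  have xT: "r \<otimes> x k \<in> T" if "r \<in> carrier R" "r \<otimes> x k \<in> D (Suc k)" for r k
    using f that by (auto simp: descending_flag_def)
  show "x k \<in> I - T" for k using D by blast
  have anti: "D m \<subseteq> D n" if "n \<le> m" for n m
    using that by (induction m rule: dec_induct) (use D(4) in blast)+
  show "r k \<otimes> x k \<in> T"
    if "finite A" "r \<in> A \<rightarrow> carrier R" "(\<Oplus>k\<in>A. r k \<otimes> x k) \<in> T" "k \<in> A" for A r k
    using that
  proof (induction A arbitrary: k rule: finite_linorder_min_induct)
    case (insert b A)
    have c: "r k \<otimes> x k \<in> carrier R" if "k \<in> insert b A" for k using insert(4) Isub[OF subsetD[OF D(3) D(5)]] that
      by (auto simp: Pi_iff)
    have "(\<Oplus>k\<in>A. r k \<otimes> x k) \<in> D (Suc b)"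
      using insert(1,2,4)
    proof (induction A rule: finite_induct)
      case empty then show ?case using D left_ideal_zero by simp
    next
      case (insert a A)
      have *: "r k \<otimes> x k \<in> D (Suc b)" if "k \<in> insert a A" for k
      proof -
        have "x k \<in> D (Suc b)" using anti[of "Suc b" k] insert that D(5)[of k] by (auto simp: Suc_le_eq)
        then show ?thesis using insert that left_ideal_mult[OF D(1)] by (auto simp: Pi_iff)
      qed
      have "(\<Oplus>k\<in>A. r k \<otimes> x k) \<in> D (Suc b)" using insert by (auto simp: Pi_iff)
      moreover have "(\<Oplus>k\<in>insert a A. r k \<otimes> x k) = r a \<otimes> x a \<oplus> (\<Oplus>k\<in>A. r k \<otimes> x k)"
        using insert * left_ideal_sub[OF D(1)] by (subst finsum_insert) auto
      ultimately show ?case using left_ideal_add[OF D(1)] * by simp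
    qed
    moreover have e: "(\<Oplus>k\<in>insert b A. r k \<otimes> x k) = r b \<otimes> x b \<oplus> (\<Oplus>k\<in>A. r k \<otimes> x k)"
      using insert c by (subst finsum_insert) auto
    moreover have cA: "(\<Oplus>k\<in>A. r k \<otimes> x k) \<in> carrier R" using c by (auto intro!: finsum_closed)
    ultimately have "r b \<otimes> x b \<in> D (Suc b)"
      using left_ideal_add_cancel[OF D(1), of "r b \<otimes> x b" "\<Oplus>k\<in>A. r k \<otimes> x k"] insert(5) subsetD[OF D(2)] c[of b] by auto
    then have b: "r b \<otimes> x b \<in> T" using xT insert by auto
    then have "(\<Oplus>k\<in>A. r k \<otimes> x k) \<in> T"
      using left_ideal_add_cancel[OF T, of "r b \<otimes> x b" "\<Oplus>k\<in>A. r k \<otimes> x k"] insert(5) e c[of b] cA by auto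
    then show ?case using insert b by auto
  qed simp
qed

text \<open>Mirror image of \<open>flag_imp_direct_sum\<close>: here the term of largest index is
  peeled off first. It serves ascending chains of annihilators.\<close>

lemma ascending_flag_imp_direct_sum:
  assumes S: "\<And>k. left_ideal (U k) R" "\<And>k. T \<subseteq> U k" "\<And>k. U k \<subseteq> U (Suc k)" "\<And>k. x k \<in> U (Suc k)"
    and x: "\<And>k. x k \<in> I" "\<And>k. x k \<notin> T"
    and xT: "\<And>r k. r \<in> carrier R \<Longrightarrow> r \<otimes> x k \<in> U k \<Longrightarrow> r \<otimes> x k \<in> T"
  shows "\<not> no_infinite_direct_sums S M"
proof (rule independent_imp_direct_sum[of x])
  show "x k \<in> I - T" for k using x by blast
  have mono: "U n \<subseteq> U m" if "n \<le> m" for n m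
    using that by (induction m rule: dec_induct) (use S(3) in blast)+
  show "r k \<otimes> x k \<in> T"
    if "finite A" "r \<in> A \<rightarrow> carrier R" "(\<Oplus>k\<in>A. r k \<otimes> x k) \<in> T" "k \<in> A" for A r k
    using that
  proof (induction A arbitrary: k rule: finite_linorder_max_induct)
    case (insert b A)
    have c: "r k \<otimes> x k \<in> carrier R" if "k \<in> insert b A" for k using insert(4) Isub[OF x(1)] that
      by (auto simp: Pi_iff)
    have "(\<Oplus>k\<in>A. r k \<otimes> x k) \<in> U b"
      using insert(1,2,4)
    proof (induction A rule: finite_induct)
      case empty then show ?case using S left_ideal_zero by simp
    next
      case (insert a A)
      have *: "r k \<otimes> x k \<in> U b" if "k \<in> insert a A" for k
      proof -
        have "x k \<in> U b" using mono[of "Suc k" b] insert that S(4)[of k] by (auto simp: Suc_le_eq)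
        then show ?thesis using insert that left_ideal_mult[OF S(1)] by (auto simp: Pi_iff)
      qed
      have "(\<Oplus>k\<in>A. r k \<otimes> x k) \<in> U b" using insert by (auto simp: Pi_iff)
      moreover have "(\<Oplus>k\<in>insert a A. r k \<otimes> x k) = r a \<otimes> x a \<oplus> (\<Oplus>k\<in>A. r k \<otimes> x k)"
        using insert * left_ideal_sub[OF S(1)] by (subst finsum_insert) auto
      ultimately show ?case using left_ideal_add[OF S(1)] * by simp
    qed
    moreover have e: "(\<Oplus>k\<in>insert b A. r k \<otimes> x k) = r b \<otimes> x b \<oplus> (\<Oplus>k\<in>A. r k \<otimes> x k)"
      using insert c by (subst finsum_insert) auto
    moreover have cA: "(\<Oplus>k\<in>A. r k \<otimes> x k) \<in> carrier R" using c by (auto intro!: finsum_closed)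
    ultimately have "r b \<otimes> x b \<in> U b"
      using left_ideal_add_cancel[OF S(1), of "r b \<otimes> x b" "\<Oplus>k\<in>A. r k \<otimes> x k"] insert(5) subsetD[OF S(2)] c[of b] by auto
    then have b: "r b \<otimes> x b \<in> T" using xT insert by auto
    then have "(\<Oplus>k\<in>A. r k \<otimes> x k) \<in> T"
      using left_ideal_add_cancel[OF T, of "r b \<otimes> x b" "\<Oplus>k\<in>A. r k \<otimes> x k"] insert(5) e c[of b] cA by auto
    then show ?case using insert b by auto
  qed simp
qed

text \<open>\<open>D n\<close> is the preimage of the sum of a countable subfamily from its
  \<open>n\<close>-th member on, and \<open>x n\<close> lifts a nonzero element of that member.
  Directness makes each member meet the tail after it trivially.\<close>

lemma direct_sum_imp_flag:
  assumes "\<not> no_infinite_direct_sums S M"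
  shows "\<exists>D x. descending_flag R I T D x"
proof -
  obtain \<N> where \<N>: "infinite \<N>" "\<And>N. N \<in> \<N> \<Longrightarrow> left_submodule S M N" "\<And>N. N \<in> \<N> \<Longrightarrow> N \<noteq> {\<zero>\<^bsub>M\<^esub>}"
    "direct_sum_of M \<N>"
    using assms unfolding no_infinite_direct_sums_def by blast
  obtain f :: "nat \<Rightarrow> 'c set" where f: "inj f" "range f \<subseteq> \<N>" using \<N>(1) infinite_countable_subset by blast
  have sub: "additive_subgroup (f k) M" and sm: "r \<in> carrier S \<Longrightarrow> x \<in> f k \<Longrightarrow> r \<odot>\<^bsub>M\<^esub> x \<in> f k"
    and nz: "f k \<noteq> {\<zero>\<^bsub>M\<^esub>}" for k r x
    using \<N>(2,3)[of "f k"] subsetD[OF f(2) rangeI[of f k]] by (auto simp: left_submodule_def simp del: rangeI)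
  have f0: "\<zero>\<^bsub>M\<^esub> \<in> f k" and fc: "u \<in> f k \<Longrightarrow> u \<in> carrier M"
    and fa: "u \<in> f k \<Longrightarrow> v \<in> f k \<Longrightarrow> u \<oplus>\<^bsub>M\<^esub> v \<in> f k"
    and fm: "u \<in> f k \<Longrightarrow> \<ominus>\<^bsub>M\<^esub> u \<in> f k" for k u v
    using sub[of k] by (auto simp: additive_subgroup.zero_closed additive_subgroup.a_closed
        M.a_inv_closed additive_subgroup.a_Hcarr additive_subgroup.a_inv_closed abelian_group_M)
  have "\<exists>x. x \<in> I \<and> \<pi> x \<in> f k \<and> x \<notin> T" for k
  proof -
    obtain u where "u \<in> f k" "u \<noteq> \<zero>\<^bsub>M\<^esub>" using nz f0 by blast
    then show ?thesis using fc onto ker by (metis imageE)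
  qed
  then obtain x where x: "\<And>k. x k \<in> I" "\<And>k. \<pi> (x k) \<in> f k" "\<And>k. x k \<notin> T" by metis
  \<comment> \<open>\<open>y\<close> is a decomposition of \<open>\<pi> v\<close> with support in
    \<open>{n..<m}\<close>. The bound \<open>m\<close> is explicit so that \<open>Pup\<close> can
    stretch two decompositions to a common length before they are added.\<close>
  define P where "P n v m y \<longleftrightarrow> (\<forall>k. y k \<in> f k) \<and> (\<forall>k<n. y k = \<zero>\<^bsub>M\<^esub>) \<and> (\<forall>k\<ge>m. y k = \<zero>\<^bsub>M\<^esub>) \<and>
      \<pi> v = (\<Oplus>\<^bsub>M\<^esub>k\<in>{..<m}. y k)" for n v m y
  have Pup: "P n v m' y" if "P n v m y" "m \<le> m'" for n v m m' y
  proof -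
    have "(\<Oplus>\<^bsub>M\<^esub>k\<in>{..<m}. y k) = (\<Oplus>\<^bsub>M\<^esub>k\<in>{..<m'}. y k)"
      by (rule M.add.finprod_mono_neutral_cong_left) (use that fc in \<open>auto simp: P_def\<close>)
    then show ?thesis using that by (auto simp: P_def)
  qed
  define D where "D n = {v \<in> I. \<exists>m y. P n v m y}" for n
  have D: "left_ideal (D n) R" for n
  proof (rule left_idealI)
    show "D n \<subseteq> carrier R" using Isub by (auto simp: D_def)
    have "P n \<zero> 0 (\<lambda>_. \<zero>\<^bsub>M\<^esub>)" by (simp add: P_def f0 zero)
    then show "\<zero> \<in> D n" using left_ideal_zero[OF I] by (auto simp: D_def)
    fix u v assume u: "u \<in> D n" and v: "v \<in> D n"
    then obtain m y m' y' where y: "P n u m y" "P n v m' y'" "u \<in> I" "v \<in> I" by (auto simp: D_def)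
    define l where "l = max m m'"
    have l: "P n u l y" "P n v l y'" using Pup y by (auto simp: l_def)
    have "(\<Oplus>\<^bsub>M\<^esub>k\<in>{..<l}. y k \<oplus>\<^bsub>M\<^esub> y' k) = (\<Oplus>\<^bsub>M\<^esub>k\<in>{..<l}. y k) \<oplus>\<^bsub>M\<^esub> (\<Oplus>\<^bsub>M\<^esub>k\<in>{..<l}. y' k)"
      using l fc by (intro M.finsum_addf) (auto simp: P_def)
    then have "P n (u \<oplus> v) l (\<lambda>k. y k \<oplus>\<^bsub>M\<^esub> y' k)"
      using l fa add[OF y(3,4)] by (auto simp: P_def)
    then show "u \<oplus> v \<in> D n" using y left_ideal_add[OF I] by (auto simp: D_def)
  next
    fix r v assume r: "r \<in> carrier R" and v: "v \<in> D n"
    then obtain m y where y: "P n v m y" "v \<in> I" by (auto simp: D_def)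
    have s0: "\<rho> r \<odot>\<^bsub>M\<^esub> \<zero>\<^bsub>M\<^esub> = \<zero>\<^bsub>M\<^esub>" using smult[OF r left_ideal_zero[OF I]] r zero by simp
    have sa: "\<rho> r \<odot>\<^bsub>M\<^esub> (u \<oplus>\<^bsub>M\<^esub> w) = \<rho> r \<odot>\<^bsub>M\<^esub> u \<oplus>\<^bsub>M\<^esub> \<rho> r \<odot>\<^bsub>M\<^esub> w"
      if uw: "u \<in> carrier M" "w \<in> carrier M" for u w
    proof -
      obtain a b where ab: "u = \<pi> a" "a \<in> I" "w = \<pi> b" "b \<in> I" using uw by (auto simp: onto[symmetric])
      then show ?thesis using add smult r left_ideal_add[OF I] left_ideal_mult[OF I] Isub by (simp add: r_distr)
    qed
    have rS: "\<rho> r \<in> carrier S" using r scalars by blast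
    have "(\<Oplus>\<^bsub>M\<^esub>k\<in>{..<j}. y k) \<in> carrier M \<and>
      \<rho> r \<odot>\<^bsub>M\<^esub> (\<Oplus>\<^bsub>M\<^esub>k\<in>{..<j}. y k) = (\<Oplus>\<^bsub>M\<^esub>k\<in>{..<j}. \<rho> r \<odot>\<^bsub>M\<^esub> y k)" for j
    proof (induction j)
      case (Suc j)
      have yk: "y k \<in> carrier M" "\<rho> r \<odot>\<^bsub>M\<^esub> y k \<in> carrier M" for k
        using y(1) fc[of "y k" k] fc[OF sm[OF rS, of "y k" k]] by (auto simp: P_def)
      then show ?case using Suc sa by (simp add: lessThan_Suc M.finsum_insert)
    qed (simp add: s0)
    then have "P n (r \<otimes> v) m (\<lambda>k. \<rho> r \<odot>\<^bsub>M\<^esub> y k)"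
      using y smult[OF r y(2)] sm rS s0 by (auto simp: P_def)
    then show "r \<otimes> v \<in> D n" using y r left_ideal_mult[OF I] by (auto simp: D_def)
  qed
  have "descending_flag R I T D x"
  proof (rule descending_flagI)
    show "left_ideal (D k) R" for k by (rule D)
    show "D k \<subseteq> I" for k by (auto simp: D_def)
    show "T \<subseteq> D k" for k
    proof
      fix v assume v: "v \<in> T"
      then have "P k v 0 (\<lambda>_. \<zero>\<^bsub>M\<^esub>)" using TI ker by (auto simp: P_def f0)
      then show "v \<in> D k" using v TI by (auto simp: D_def)
    qed
    have "P k v m y" if "P (Suc k) v m y" for k v m y using that by (simp add: P_def)
    then show "D (Suc k) \<subseteq> D k" for k unfolding D_def by blast
    show "x k \<in> D k" for k
    proof -
      have "(\<Oplus>\<^bsub>M\<^esub>j\<in>{..<Suc k}. if k = j then \<pi> (x k) else \<zero>\<^bsub>M\<^esub>) = \<pi> (x k)"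
        using M.add.finprod_singleton[of k "{..<Suc k}" "\<lambda>_. \<pi> (x k)"] fc[OF x(2)] by simp
      then have "P k (x k) (Suc k) (\<lambda>j. if k = j then \<pi> (x k) else \<zero>\<^bsub>M\<^esub>)" 
        using x f0 by (auto simp: P_def)
      then show ?thesis using x unfolding D_def by blast
    qed
    show "x k \<notin> T" for k by (rule x)
    fix k r assume r: "r \<in> carrier R" "r \<otimes> x k \<in> D (Suc k)"
    define w where "w = \<pi> (r \<otimes> x k)"
    have wf: "w \<in> f k" unfolding w_def using smult[OF r(1) x(1)[of k]] sm[OF _ x(2)] r scalars by (metis imageI)
    obtain m' y where "P (Suc k) (r \<otimes> x k) m' y" using r by (auto simp: D_def)
    then have "P (Suc k) (r \<otimes> x k) (max m' (Suc k)) y" by (rule Pup) simp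
    then obtain m where m: "P (Suc k) (r \<otimes> x k) m y" "k < m" by (metis max.cobounded2 Suc_le_eq)
    \<comment> \<open>\<open>y k\<close> is zero because \<open>y\<close> has support from
      \<open>Suc k\<close> on. Putting the negative of \<open>w\<close> in its place turns the
      decomposition of \<open>w\<close> into a zero sum whose \<open>k\<close>-th component is that
      negative.\<close>
    define z where "z = y(k := \<ominus>\<^bsub>M\<^esub> w)"
    have yf: "y j \<in> f j" and zf: "z j \<in> f j" for j using m wf fm by (auto simp: z_def P_def)
    have yc: "y j \<in> carrier M" and zc: "z j \<in> carrier M" for j using fc[OF yf] fc[OF zf] by auto
    have ins: "{..<m} = insert k ({..<m} - {k})" using m by auto
    have zk: "z k = \<ominus>\<^bsub>M\<^esub> w" by (simp add: z_def)
    have "(\<Oplus>\<^bsub>M\<^esub>j\<in>{..<m}. z j) = z k \<oplus>\<^bsub>M\<^esub> (\<Oplus>\<^bsub>M\<^esub>j\<in>{..<m} - {k}. z j)"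
      by (subst ins, subst M.finsum_insert) (auto simp: zc)
    moreover have "(\<Oplus>\<^bsub>M\<^esub>j\<in>{..<m} - {k}. z j) = (\<Oplus>\<^bsub>M\<^esub>j\<in>{..<m} - {k}. y j)"
      by (rule M.add.finprod_cong') (use yc in \<open>auto simp: z_def\<close>)
    moreover have "(\<Oplus>\<^bsub>M\<^esub>j\<in>{..<m} - {k}. y j) = (\<Oplus>\<^bsub>M\<^esub>j\<in>{..<m}. y j)"
      by (rule M.add.finprod_mono_neutral_cong_left) (use m yc in \<open>auto simp: P_def\<close>)
    moreover have "(\<Oplus>\<^bsub>M\<^esub>j\<in>{..<m}. y j) = w" using m by (simp add: P_def w_def)
    ultimately have s: "(\<Oplus>\<^bsub>M\<^esub>j\<in>{..<m}. z j) = \<zero>\<^bsub>M\<^esub>" using wf fc by (simp add: zk M.l_neg)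
    \<comment> \<open>\<open>direct_sum_of\<close> speaks of functions on submodules rather than on
      indices, so \<open>z\<close> is reindexed along the injection \<open>f\<close>.\<close>
    define y' where "y' N = z (inv_into UNIV f N)" for N
    have y'f: "y' (f j) = z j" for j using f by (simp add: y'_def)
    have "(\<Oplus>\<^bsub>M\<^esub>N\<in>f ` {..<m}. y' N) = (\<Oplus>\<^bsub>M\<^esub>j\<in>{..<m}. y' (f j))"
      by (rule M.add.finprod_reindex) (use zc y'f f in \<open>auto simp: inj_on_def inj_def\<close>)
    then have "(\<Oplus>\<^bsub>M\<^esub>N\<in>f ` {..<m}. y' N) = \<zero>\<^bsub>M\<^esub>" using s y'f by simp
    then have "finite (f ` {..<m}) \<and> f ` {..<m} \<subseteq> \<N> \<and> (\<forall>N\<in>f ` {..<m}. y' N \<in> N) \<and> (\<Oplus>\<^bsub>M\<^esub>N\<in>f ` {..<m}. y' N) = \<zero>\<^bsub>M\<^esub>"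
    proof (intro conjI)
      show "f ` {..<m} \<subseteq> \<N>" using f(2) by blast
      show "\<forall>N\<in>f ` {..<m}. y' N \<in> N"
      proof
        fix N assume "N \<in> f ` {..<m}"
        then obtain j where "N = f j" by blast
        then show "y' N \<in> N" using zf[of j] y'f[of j] by simp
      qed
    qed simp_all
    then have "\<forall>N\<in>f ` {..<m}. y' N = \<zero>\<^bsub>M\<^esub>"
      by (rule \<N>(4)[unfolded direct_sum_of_def, THEN spec, THEN spec, THEN mp])
    then have "y' (f k) = \<zero>\<^bsub>M\<^esub>" using m(2) by blast
    then have "\<ominus>\<^bsub>M\<^esub> w = \<zero>\<^bsub>M\<^esub>" by (simp only: y'f zk)
    then have "w = \<zero>\<^bsub>M\<^esub>" using M.r_neg[OF fc[OF wf]] fc[OF wf] by simp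
    then show "r \<otimes> x k \<in> T" using ker r x left_ideal_mult[OF I] unfolding w_def by blast
  qed
  then show ?thesis by blast
qed

lemma no_infinite_direct_sums_iff:
  "no_infinite_direct_sums S M \<longleftrightarrow> (\<nexists>D x. descending_flag R I T D x)"
  using flag_imp_direct_sum direct_sum_imp_flag by blast

end

section \<open>Goldie's theorem\<close>

definition semiprime_ring :: "('a, 'm) ring_scheme \<Rightarrow> bool" where
  "semiprime_ring R \<longleftrightarrow>
     (\<forall>a\<in>carrier R. (\<forall>r\<in>carrier R. a \<otimes>\<^bsub>R\<^esub> r \<otimes>\<^bsub>R\<^esub> a = \<zero>\<^bsub>R\<^esub>) \<longrightarrow> a = \<zero>\<^bsub>R\<^esub>)"

lemma left_annihilator_sing [simp]:
  "left_annihilator R {x} = {r \<in> carrier R. r \<otimes>\<^bsub>R\<^esub> x = \<zero>\<^bsub>R\<^esub>}"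
  by (simp add: left_annihilator_def)

context ring
begin

lemma regular_elementsI:
  assumes "c \<in> carrier R" "\<And>r. r \<in> carrier R \<Longrightarrow> c \<otimes> r = \<zero> \<Longrightarrow> r = \<zero>"
    "\<And>r. r \<in> carrier R \<Longrightarrow> r \<otimes> c = \<zero> \<Longrightarrow> r = \<zero>"
  shows "c \<in> regular_elements R"
  using assms unfolding regular_elements_def by blast

lemma
  assumes "c \<in> regular_elements R"
  shows regular_closed: "c \<in> carrier R"
    and regular_left: "r \<in> carrier R \<Longrightarrow> c \<otimes> r = \<zero> \<Longrightarrow> r = \<zero>"
    and regular_right: "r \<in> carrier R \<Longrightarrow> r \<otimes> c = \<zero> \<Longrightarrow> r = \<zero>"
  using assms unfolding regular_elements_def by blast+

lemma regular_one: "\<one> \<in> regular_elements R"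
  by (rule regular_elementsI) auto

lemma regular_mult:
  assumes "c \<in> regular_elements R" "d \<in> regular_elements R"
  shows "c \<otimes> d \<in> regular_elements R"
proof (rule regular_elementsI)
  note cd = regular_closed[OF assms(1)] regular_closed[OF assms(2)]
  show "c \<otimes> d \<in> carrier R" using cd by simp
  show "r = \<zero>" if "r \<in> carrier R" "c \<otimes> d \<otimes> r = \<zero>" for r
    using that cd regular_left[OF assms(1), of "d \<otimes> r"] regular_left[OF assms(2), of r] by (simp add: m_assoc)
  show "r = \<zero>" if "r \<in> carrier R" "r \<otimes> (c \<otimes> d) = \<zero>" for r
    using that cd regular_right[OF assms(2), of "r \<otimes> c"] regular_right[OF assms(1), of r] by (simp add: m_assoc)
qed

text \<open>Transfers nilpotence from \<open>y \<otimes> x\<close> to \<open>x \<otimes> y\<close>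
  at the cost of one more power.\<close>

lemma pow_mult_shift:
  assumes "x \<in> carrier R" "y \<in> carrier R"
  shows "(x \<otimes> y) [^] Suc n = x \<otimes> (y \<otimes> x) [^] n \<otimes> y"
proof (induction n)
  case (Suc n)
  have "(x \<otimes> y) [^] Suc (Suc n) = (x \<otimes> (y \<otimes> x) [^] n \<otimes> y) \<otimes> (x \<otimes> y)"
    unfolding nat_pow_Suc[of _ "Suc n"] Suc ..
  also have "\<dots> = x \<otimes> (y \<otimes> x) [^] Suc n \<otimes> y" using assms by (simp add: m_assoc)
  finally show ?case .
qed (use assms in simp)

lemma right_cancel_zero:
  assumes "\<And>r. r \<in> carrier R \<Longrightarrow> r \<otimes> c = \<zero> \<Longrightarrow> r = \<zero>" "x \<in> carrier R" "y \<in> carrier R" "c \<in> carrier R"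
    "x \<otimes> c = y \<otimes> c"
  shows "x = y"
proof -
  have "(x \<ominus> y) \<otimes> c = \<zero>" using assms(2-) by (simp add: minus_eq l_distr l_minus r_neg)
  then have "x \<ominus> y = \<zero>" using assms by blast
  then show ?thesis using assms(2,3) diff_zero_iff by simp
qed

text \<open>If all left multiples of \<open>a\<close> were nilpotent, choose \<open>u\<close> with
  \<open>a \<otimes> u \<otimes> a \<noteq> \<zero>\<close>. The last nonzero power of
  \<open>a \<otimes> u\<close> has a strictly larger left annihilator than \<open>a\<close> and
  again only nilpotent left multiples, so the annihilators would ascend forever.\<close>

lemma non_nilpotent_multiple:
  assumes sp: "semiprime_ring R" and acc: "acc_left_annihilators R"
    and a: "a \<in> carrier R" "a \<noteq> \<zero>"
  shows "\<exists>u\<in>carrier R. \<forall>n::nat. (u \<otimes> a) [^] n \<noteq> \<zero>"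
proof (rule ccontr)
  assume neg: "\<not> ?thesis"
  define P where "P a \<longleftrightarrow> a \<in> carrier R \<and> a \<noteq> \<zero> \<and> (\<forall>u\<in>carrier R. \<exists>n::nat. (u \<otimes> a) [^] n = \<zero>)" for a
  have step: "\<exists>a'. P a' \<and> left_annihilator R {a} \<subset> left_annihilator R {a'}" if "P a" for a
  proof -
    have a: "a \<in> carrier R" "a \<noteq> \<zero>" using that by (auto simp: P_def)
    then obtain u where u: "u \<in> carrier R" "a \<otimes> u \<otimes> a \<noteq> \<zero>" using sp by (auto simp: semiprime_ring_def)
    obtain n :: nat where "(u \<otimes> a) [^] n = \<zero>" using \<open>P a\<close> u by (auto simp: P_def)
    then have n: "(a \<otimes> u) [^] Suc n = \<zero>" unfolding pow_mult_shift[OF a(1) u(1)] using a u by simp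
    \<comment> \<open>\<open>k\<close> is at least 2 because \<open>a \<otimes> u\<close> is
      nonzero. So the last nonzero power \<open>a'\<close> has exponent \<open>Suc m\<close> and
      begins with the factor \<open>a\<close>, while \<open>a \<otimes> u\<close> annihilates
      \<open>a'\<close> but not \<open>a\<close>.\<close>
    define k where "k = (LEAST k::nat. (a \<otimes> u) [^] k = \<zero>)"
    have k: "(a \<otimes> u) [^] k = \<zero>" unfolding k_def by (rule LeastI) (rule n)
    have kl: "(a \<otimes> u) [^] j \<noteq> \<zero>" if "j < k" for j using that not_less_Least unfolding k_def by blast
    have "k \<noteq> 0"
    proof
      assume "k = 0"
      then have "\<one> = \<zero>" using k by simp
      then show False using a by (metis r_one r_null)
    qed
    moreover have "k \<noteq> 1"
    proof
      assume "k = 1"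
      then have "a \<otimes> u = \<zero>" using k a u by simp
      then show False using a u by simp
    qed
    ultimately obtain m where m: "k = Suc (Suc m)" by (metis One_nat_def not0_implies_Suc)
    define w where "w = u \<otimes> (a \<otimes> u) [^] m"
    define a' where "a' = a \<otimes> w"
    have w: "w \<in> carrier R" using a u by (simp add: w_def)
    have a'e: "a' = (a \<otimes> u) [^] Suc m"
      using a u nat_pow_Suc2[of "a \<otimes> u" m] by (simp add: a'_def w_def m_assoc)
    have a': "a' \<in> carrier R" "a' \<noteq> \<zero>" using a w kl[of "Suc m"] m unfolding a'e by (auto simp: a u)
    have "a \<otimes> u \<otimes> a' = \<zero>" unfolding a'e using k m a u nat_pow_Suc2[of "a \<otimes> u" "Suc m"] by simp
    then have "a \<otimes> u \<in> left_annihilator R {a'} - left_annihilator R {a}" using a u by simp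
    moreover have "left_annihilator R {a} \<subseteq> left_annihilator R {a'}"
    proof
      fix r assume "r \<in> left_annihilator R {a}"
      then have "r \<in> carrier R" "r \<otimes> a \<otimes> w = \<zero>" using w by auto
      then show "r \<in> left_annihilator R {a'}" using a w by (simp add: a'_def m_assoc)
    qed
    moreover have "P a'"
      unfolding P_def
    proof (intro conjI ballI a')
      fix v assume v: "v \<in> carrier R"
      \<comment> \<open>\<open>v \<otimes> a'\<close> is the product of \<open>v \<otimes> a\<close>
        and \<open>w\<close>. Swapping these two factors gives a left multiple of \<open>a\<close>,
        whose nilpotence is known.\<close>
      obtain n :: nat where n: "((w \<otimes> v) \<otimes> a) [^] n = \<zero>" using \<open>P a\<close> w v by (auto simp: P_def)
      have "((v \<otimes> a) \<otimes> w) [^] Suc n = \<zero>"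
        using pow_mult_shift[of "v \<otimes> a" w n] n v a w by (simp add: m_assoc)
      then show "\<exists>n::nat. (v \<otimes> a') [^] n = \<zero>" using v a w unfolding a'_def by (metis m_assoc)
    qed
    ultimately show ?thesis by blast
  qed
  have "P a" using a neg by (auto simp: P_def)
  then obtain f where f: "\<And>n. P (f n)" "\<And>n. left_annihilator R {f n} \<subset> left_annihilator R {f (Suc n)}"
    using dependent_nat_choice[of "\<lambda>_. P" "\<lambda>_ a a'. left_annihilator R {a} \<subset> left_annihilator R {a'}"] step by metis
  have "\<exists>n. \<forall>k\<ge>n. left_annihilator R {f k} = left_annihilator R {f n}"
  proof (rule acc[unfolded acc_left_annihilators_def, rule_format], intro conjI allI)
    show "\<exists>X\<subseteq>carrier R. left_annihilator R {f k} = left_annihilator R X" for k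
      by (rule exI[of _ "{f k}"]) (use f(1)[of k] in \<open>simp add: P_def\<close>)
    show "left_annihilator R {f k} \<subseteq> left_annihilator R {f (Suc k)}" for k using f(2) by blast
  qed
  then show False using f(2) by (metis le_Suc_eq less_irrefl order_refl)
qed

lemma annihilator_of_powers_stable:
  assumes acc: "acc_left_annihilators R" and b: "b \<in> carrier R"
  shows "\<exists>n. \<forall>k\<ge>n. \<forall>r\<in>carrier R. r \<otimes> b [^] Suc k = \<zero> \<longrightarrow> r \<otimes> b [^] Suc n = \<zero>"
proof -
  have "\<exists>n. \<forall>k\<ge>n. left_annihilator R {b [^] Suc k} = left_annihilator R {b [^] Suc n}"
  proof (rule acc[unfolded acc_left_annihilators_def, rule_format], intro conjI allI)
    show "\<exists>X\<subseteq>carrier R. left_annihilator R {b [^] Suc k} = left_annihilator R X" for k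
      by (rule exI[of _ "{b [^] Suc k}"]) (use b in simp)
    show "left_annihilator R {b [^] Suc k} \<subseteq> left_annihilator R {b [^] Suc (Suc k)}" for k
    proof
      fix r assume "r \<in> left_annihilator R {b [^] Suc k}"
      then have r: "r \<in> carrier R" "r \<otimes> b [^] Suc k \<otimes> b = \<zero>" using b by auto
      have "r \<otimes> b [^] Suc (Suc k) = r \<otimes> b [^] Suc k \<otimes> b"
        unfolding nat_pow_Suc[of _ "Suc k"] using r b by (simp del: nat_pow_Suc add: m_assoc)
      then show "r \<in> left_annihilator R {b [^] Suc (Suc k)}" using r by simp
    qed
  qed
  then show ?thesis unfolding left_annihilator_sing by blast
qed

text \<open>Take a non-nilpotent \<open>b\<close> in \<open>L\<close> and a power of it beyond the
  point where the left annihilators of the powers of \<open>b\<close> become constant. That power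
  and its square have the same left annihilator.\<close>

lemma exists_square_stable:
  assumes sp: "semiprime_ring R" and acc: "acc_left_annihilators R"
    and L: "left_ideal L R" and x: "x \<in> L" "x \<noteq> \<zero>"
  shows "\<exists>a\<in>L. a \<noteq> \<zero> \<and> (\<forall>r\<in>carrier R. r \<otimes> a \<otimes> a = \<zero> \<longrightarrow> r \<otimes> a = \<zero>)"
proof -
  have xc: "x \<in> carrier R" using x L left_ideal_sub by blast
  obtain u where u: "u \<in> carrier R" "\<And>n::nat. (u \<otimes> x) [^] n \<noteq> \<zero>"
    using non_nilpotent_multiple[OF sp acc xc x(2)] by blast
  define b where "b = u \<otimes> x"
  have b: "b \<in> carrier R" "b \<in> L" using u x xc L left_ideal_mult by (auto simp: b_def)
  obtain n where n: "\<And>k r. n \<le> k \<Longrightarrow> r \<in> carrier R \<Longrightarrow> r \<otimes> b [^] Suc k = \<zero> \<Longrightarrow> r \<otimes> b [^] Suc n = \<zero>"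
    using annihilator_of_powers_stable[OF acc b(1)] by blast
  define a where "a = b [^] Suc n"
  have ac: "a \<in> carrier R" using b by (simp add: a_def)
  have "a \<in> L" using left_ideal_mult[OF L _ b(2)] b by (simp add: a_def)
  moreover have "a \<noteq> \<zero>" using u(2)[of "Suc n"] by (simp add: a_def b_def)
  moreover have "r \<otimes> a = \<zero>" if "r \<in> carrier R" "r \<otimes> a \<otimes> a = \<zero>" for r
  proof -
    \<comment> \<open>The exponent \<open>Suc n + Suc n\<close> is written as a successor because
      the stability statement is indexed by \<open>Suc k\<close>.\<close>
    have "a \<otimes> a = b [^] Suc (n + n + 1)" unfolding a_def using b nat_pow_mult[of b "Suc n" "Suc n"]
      by (simp del: nat_pow_Suc)
    then have "r \<otimes> b [^] Suc (n + n + 1) = \<zero>" using that ac by (simp only: m_assoc)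
    then show ?thesis using n[of "n + n + 1" r] that unfolding a_def by simp
  qed
  ultimately show ?thesis by blast
qed

text \<open>Starting from \<open>c = 0\<close>, replace \<open>c\<close> by \<open>c + a\<close> with \<open>0 \<noteq> a \<in> L\<close>, \<open>a c = 0\<close> as long as the left annihilator
  \<open>l(c)\<close> is nonzero. This keeps \<open>l(c) = l(c\<^sup>2)\<close>, and the left ideals \<open>L \<inter> l(c)\<close> form a flag.\<close>

lemma essential_contains_left_cancellable:
  assumes sp: "semiprime_ring R" and acc: "acc_left_annihilators R"
    and nf: "\<nexists>D x. descending_flag R (carrier R) {\<zero>} D x"
    and L: "left_ideal L R"
    and ess: "\<And>b. b \<in> carrier R \<Longrightarrow> b \<noteq> \<zero> \<Longrightarrow> \<exists>r\<in>carrier R. r \<otimes> b \<in> L \<and> r \<otimes> b \<noteq> \<zero>"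
  shows "\<exists>c\<in>L. \<forall>r\<in>carrier R. r \<otimes> c = \<zero> \<longrightarrow> r = \<zero>"
proof (rule ccontr)
  assume neg: "\<not> ?thesis"
  define P where "P c \<longleftrightarrow> c \<in> L \<and> (\<forall>r\<in>carrier R. r \<otimes> c \<otimes> c = \<zero> \<longrightarrow> r \<otimes> c = \<zero>)" for c
  have Lc: "c \<in> L \<Longrightarrow> c \<in> carrier R" for c using L left_ideal_sub by blast
  have ex: "\<exists>a. P a \<and> a \<noteq> \<zero> \<and> a \<otimes> c = \<zero>" if "P c" for c
  proof -
    have c: "c \<in> L" "c \<in> carrier R" using that Lc by (auto simp: P_def)
    then obtain b where b: "b \<in> carrier R" "b \<otimes> c = \<zero>" "b \<noteq> \<zero>" using neg by blast
    then obtain r where r: "r \<in> carrier R" "r \<otimes> b \<in> L" "r \<otimes> b \<noteq> \<zero>" using ess by blast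
    have "left_ideal (L \<inter> {r \<in> carrier R. r \<otimes> c = \<zero>}) R"
      by (rule left_ideal_inter[OF L left_ideal_annihilator_elt]) (rule c)
    moreover have "r \<otimes> b \<in> L \<inter> {r \<in> carrier R. r \<otimes> c = \<zero>}" using r b c by (simp add: m_assoc)
    ultimately obtain a where "a \<in> L \<inter> {r \<in> carrier R. r \<otimes> c = \<zero>}" "a \<noteq> \<zero>"
      "\<forall>r\<in>carrier R. r \<otimes> a \<otimes> a = \<zero> \<longrightarrow> r \<otimes> a = \<zero>"
      using exists_square_stable[OF sp acc _ _ r(3)] by blast
    then show ?thesis unfolding P_def by blast
  qed
  \<comment> \<open>Right multiplication by \<open>c\<close> kills the \<open>a\<close>-part since
    \<open>a \<otimes> c = \<zero>\<close>, and \<open>P c\<close> removes the extra factor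
    \<open>c\<close>. So the left annihilator of \<open>c \<oplus> a\<close> is the intersection of
    those of \<open>c\<close> and \<open>a\<close>.\<close>
  have split: "r \<otimes> c = \<zero> \<and> r \<otimes> a = \<zero>"
    if "P c" "P a" "a \<otimes> c = \<zero>" "r \<in> carrier R" "r \<otimes> (c \<oplus> a) = \<zero>" for c a r
  proof -
    have ca: "c \<in> carrier R" "a \<in> carrier R" using that Lc by (auto simp: P_def)
    have "r \<otimes> (c \<oplus> a) \<otimes> c = r \<otimes> c \<otimes> c" using ca that(3,4) by (simp add: r_distr l_distr m_assoc)
    then have "r \<otimes> c = \<zero>" using that ca by (simp add: P_def)
    then show ?thesis using that ca by (simp add: r_distr)
  qed
  have sum: "P (c \<oplus> a)" if "P c" "P a" "a \<otimes> c = \<zero>" for c a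
    unfolding P_def
  proof (intro conjI ballI impI)
    have ca: "c \<in> carrier R" "a \<in> carrier R" using that Lc by (auto simp: P_def)
    show "c \<oplus> a \<in> L" using that left_ideal_add[OF L] by (simp add: P_def)
    fix r assume r: "r \<in> carrier R" "r \<otimes> (c \<oplus> a) \<otimes> (c \<oplus> a) = \<zero>"
    have rca: "r \<otimes> (c \<oplus> a) \<in> carrier R" using r ca by simp
    from split[OF that rca r(2)] have 1: "r \<otimes> (c \<oplus> a) \<otimes> c = \<zero>" "r \<otimes> (c \<oplus> a) \<otimes> a = \<zero>" by auto
    have "r \<otimes> (c \<oplus> a) \<otimes> c = r \<otimes> c \<otimes> c" using ca that(3) r(1) by (simp add: r_distr l_distr m_assoc)
    then have rc: "r \<otimes> c = \<zero>" using that 1 r by (simp add: P_def)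
    then have "r \<otimes> a \<otimes> a = \<zero>" using 1 ca r by (simp add: r_distr)
    then have "r \<otimes> a = \<zero>" using that r by (simp add: P_def)
    then show "r \<otimes> (c \<oplus> a) = \<zero>" using rc ca r by (simp add: r_distr)
  qed
  \<comment> \<open>A state carries the current sum together with the summand to be added next, so
    one dependent choice yields both sequences.\<close>
  define Q where "Q p \<longleftrightarrow> P (fst p) \<and> P (snd p) \<and> snd p \<noteq> \<zero> \<and> snd p \<otimes> fst p = \<zero>" for p
  have "P \<zero>" using left_ideal_zero[OF L] by (simp add: P_def)
  then have "\<exists>p. Q p" using ex by (auto simp: Q_def)
  moreover have "\<exists>q. Q q \<and> fst q = fst p \<oplus> snd p" if "Q p" for p
    using sum[of "fst p" "snd p"] ex[of "fst p \<oplus> snd p"] that by (auto simp: Q_def)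
  ultimately have "\<exists>f. (\<forall>n. Q (f n)) \<and> (\<forall>n. fst (f (Suc n)) = fst (f n) \<oplus> snd (f n))"
    using dependent_nat_choice[of "\<lambda>_. Q" "\<lambda>_ p q. fst q = fst p \<oplus> snd p"] by blast
  then obtain f where f: "\<And>n. Q (f n)" "\<And>n. fst (f (Suc n)) = fst (f n) \<oplus> snd (f n)" by blast
  define c a where "c n = fst (f n)" and "a n = snd (f n)" for n
  have ca: "P (c n)" "P (a n)" "a n \<noteq> \<zero>" "a n \<otimes> c n = \<zero>" "c (Suc n) = c n \<oplus> a n" for n
    using f unfolding Q_def c_def a_def by auto
  have cl: "c n \<in> carrier R" "a n \<in> carrier R" "a n \<in> L" for n using ca(1,2)[of n] Lc by (auto simp: P_def)
  have "descending_flag R (carrier R) {\<zero>} (\<lambda>n. L \<inter> {r \<in> carrier R. r \<otimes> c n = \<zero>}) a"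
  proof (rule descending_flagI)
    show "left_ideal (L \<inter> {r \<in> carrier R. r \<otimes> c k = \<zero>}) R" for k
      by (rule left_ideal_inter[OF L left_ideal_annihilator_elt]) (rule cl)
    then show "{\<zero>} \<subseteq> L \<inter> {r \<in> carrier R. r \<otimes> c k = \<zero>}" for k using left_ideal_zero by blast
    show "L \<inter> {r \<in> carrier R. r \<otimes> c (Suc k) = \<zero>} \<subseteq> L \<inter> {r \<in> carrier R. r \<otimes> c k = \<zero>}" for k
      using split[OF ca(1,2,4)] by (auto simp: ca(5))
    show "a k \<in> L \<inter> {r \<in> carrier R. r \<otimes> c k = \<zero>}" for k using ca cl by blast
    show "a k \<notin> {\<zero>}" for k using ca by simp
    fix k r assume r: "r \<in> carrier R" "r \<otimes> a k \<in> L \<inter> {r \<in> carrier R. r \<otimes> c (Suc k) = \<zero>}"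
    then have "r \<otimes> a k \<otimes> a k = \<zero>" using split[OF ca(1,2,4), of "r \<otimes> a k" k] cl by (auto simp: ca(5))
    then show "r \<otimes> a k \<in> {\<zero>}" using ca(2)[of k] r by (simp add: P_def)
  qed auto
  then show False using nf by blast
qed

text \<open>If \<open>R b\<close> and \<open>R c\<close> met trivially, the elements
  \<open>b \<otimes> c [^] k\<close> would form a flag in the left ideals
  \<open>R (c [^] k)\<close>, because powers of \<open>c\<close> can be cancelled on the
  right.\<close>

lemma left_cancellable_multiples_essential:
  assumes nf: "\<nexists>D x. descending_flag R (carrier R) {\<zero>} D x"
    and c: "c \<in> carrier R" "\<And>r. r \<in> carrier R \<Longrightarrow> r \<otimes> c = \<zero> \<Longrightarrow> r = \<zero>"
    and b: "b \<in> carrier R" "b \<noteq> \<zero>"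
  shows "\<exists>r\<in>carrier R. \<exists>s\<in>carrier R. r \<otimes> b = s \<otimes> c \<and> r \<otimes> b \<noteq> \<zero>"
proof (rule ccontr)
  assume neg: "\<not> ?thesis"
  have ck: "r = \<zero>" if "r \<in> carrier R" "r \<otimes> c [^] k = \<zero>" for r and k :: nat
    using that
  proof (induction k)
    case (Suc k)
    then have "r \<otimes> c [^] k \<otimes> c = \<zero>" using c(1) by (simp add: m_assoc)
    then show ?case using c(1) c(2)[of "r \<otimes> c [^] k"] Suc by blast
  qed simp
  have "descending_flag R (carrier R) {\<zero>} (\<lambda>k. (\<lambda>r. r \<otimes> c [^] k) ` carrier R) (\<lambda>k. b \<otimes> c [^] k)"
  proof (rule descending_flagI)
    show l: "left_ideal ((\<lambda>r. r \<otimes> c [^] k) ` carrier R) R" for k :: nat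
      by (rule left_ideal_right_multiples[OF left_ideal_carrier]) (use c(1) in simp)
    show "{\<zero>} \<subseteq> (\<lambda>r. r \<otimes> c [^] k) ` carrier R" for k :: nat using left_ideal_zero[OF l] by simp
    show "(\<lambda>r. r \<otimes> c [^] Suc k) ` carrier R \<subseteq> (\<lambda>r. r \<otimes> c [^] k) ` carrier R" for k :: nat
    proof
      fix y assume "y \<in> (\<lambda>r. r \<otimes> c [^] Suc k) ` carrier R"
      then obtain r where r: "r \<in> carrier R" "y = r \<otimes> c [^] Suc k" by blast
      then have "y = (r \<otimes> c) \<otimes> c [^] k" using c nat_pow_Suc2[of c k] by (simp add: m_assoc)
      then show "y \<in> (\<lambda>r. r \<otimes> c [^] k) ` carrier R" using r c by blast
    qed
    show "b \<otimes> c [^] k \<in> (\<lambda>r. r \<otimes> c [^] k) ` carrier R" for k :: nat using b by blast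
    show "b \<otimes> c [^] k \<notin> {\<zero>}" for k :: nat using ck b by blast
    fix k :: nat and r assume r: "r \<in> carrier R" "r \<otimes> (b \<otimes> c [^] k) \<in> (\<lambda>r. r \<otimes> c [^] Suc k) ` carrier R"
    then obtain s where s: "s \<in> carrier R" "r \<otimes> (b \<otimes> c [^] k) = s \<otimes> c [^] Suc k" by blast
    have "(r \<otimes> b) \<otimes> c [^] k = r \<otimes> (b \<otimes> c [^] k)" using c(1) b(1) r(1) by (simp add: m_assoc)
    also have "\<dots> = s \<otimes> (c \<otimes> c [^] k)" unfolding s(2) nat_pow_Suc2[OF c(1)] ..
    also have "\<dots> = (s \<otimes> c) \<otimes> c [^] k" using c(1) s(1) by (simp add: m_assoc)
    finally have e: "(r \<otimes> b) \<otimes> c [^] k = (s \<otimes> c) \<otimes> c [^] k" .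
    have "r \<otimes> b = s \<otimes> c"
      by (rule right_cancel_zero[OF _ _ _ _ e], erule (1) ck) (use r s b c(1) in auto)
    then have "r \<otimes> b = \<zero>" using neg r s by blast
    then show "r \<otimes> (b \<otimes> c [^] k) \<in> {\<zero>}" using r b c by (simp add: m_assoc[symmetric])
  qed (use c(1) in auto)
  then show False using nf by blast
qed

text \<open>If \<open>c \<otimes> x = \<zero>\<close> with \<open>x \<noteq> \<zero>\<close>, a
  non-nilpotent multiple \<open>y = u \<otimes> x\<close> has an essential left annihilator, because
  \<open>R c\<close> is essential. Right multiplication by \<open>y\<close> then kills a nonzero
  left multiple of every power of \<open>y\<close>, so the annihilators of these powers never
  stabilise.\<close>

lemma left_cancellable_imp_regular:
  assumes sp: "semiprime_ring R" and acc: "acc_left_annihilators R"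
    and nf: "\<nexists>D x. descending_flag R (carrier R) {\<zero>} D x"
    and c: "c \<in> carrier R" "\<And>r. r \<in> carrier R \<Longrightarrow> r \<otimes> c = \<zero> \<Longrightarrow> r = \<zero>"
  shows "c \<in> regular_elements R"
proof (rule regular_elementsI)
  fix x assume x: "x \<in> carrier R" "c \<otimes> x = \<zero>"
  show "x = \<zero>"
  proof (rule ccontr)
    assume "x \<noteq> \<zero>"
    then obtain u where u: "u \<in> carrier R" "\<And>n::nat. (u \<otimes> x) [^] n \<noteq> \<zero>"
      using non_nilpotent_multiple[OF sp acc x(1)] by blast
    define y where "y = u \<otimes> x"
    have y: "y \<in> carrier R" using u x by (simp add: y_def)
    have ess: "\<exists>r\<in>carrier R. r \<otimes> b \<noteq> \<zero> \<and> r \<otimes> b \<otimes> y = \<zero>" if b: "b \<in> carrier R" "b \<noteq> \<zero>" for b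
    proof (cases "b \<otimes> u = \<zero>")
      case True
      then have "b \<otimes> y = \<zero>" using b u x by (simp add: y_def m_assoc[symmetric])
      then show ?thesis using b by (intro bexI[of _ \<one>]) auto
    next
      case False
      then obtain r s where r: "r \<in> carrier R" "s \<in> carrier R" "r \<otimes> (b \<otimes> u) = s \<otimes> c" "r \<otimes> (b \<otimes> u) \<noteq> \<zero>"
        using left_cancellable_multiples_essential[OF nf c, of "b \<otimes> u"] b u by auto
      have "r \<otimes> b \<otimes> y = r \<otimes> (b \<otimes> u) \<otimes> x" using r(1) b u(1) x(1) by (simp add: y_def m_assoc)
      also have "\<dots> = \<zero>" using r c x by (simp add: m_assoc)
      finally show ?thesis using r b u by (intro bexI[of _ r]) (auto simp: m_assoc[symmetric])
    qed
    obtain n where n: "\<And>k r. n \<le> k \<Longrightarrow> r \<in> carrier R \<Longrightarrow> r \<otimes> y [^] Suc k = \<zero> \<Longrightarrow> r \<otimes> y [^] Suc n = \<zero>"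
      using annihilator_of_powers_stable[OF acc y] by blast
    have "y [^] Suc n \<noteq> \<zero>" using u(2)[of "Suc n"] unfolding y_def .
    then obtain r where r: "r \<in> carrier R" "r \<otimes> y [^] Suc n \<noteq> \<zero>" "r \<otimes> y [^] Suc n \<otimes> y = \<zero>"
      using ess[of "y [^] Suc n"] y by auto
    have "r \<otimes> y [^] Suc (Suc n) = \<zero>" using r y by (simp add: m_assoc)
    then show False using n[of "Suc n" r] r by simp
  qed
qed (use c in auto)

theorem goldie_essential_regular:
  assumes sp: "semiprime_ring R" and acc: "acc_left_annihilators R"
    and nf: "\<nexists>D x. descending_flag R (carrier R) {\<zero>} D x"
    and L: "left_ideal L R"
    and ess: "\<And>b. b \<in> carrier R \<Longrightarrow> b \<noteq> \<zero> \<Longrightarrow> \<exists>r\<in>carrier R. r \<otimes> b \<in> L \<and> r \<otimes> b \<noteq> \<zero>"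
  shows "\<exists>c\<in>L. c \<in> regular_elements R"
proof -
  obtain c where c: "c \<in> L" "\<forall>r\<in>carrier R. r \<otimes> c = \<zero> \<longrightarrow> r = \<zero>"
    using essential_contains_left_cancellable[OF assms] by blast
  have "c \<in> regular_elements R"
    by (rule left_cancellable_imp_regular[OF sp acc nf left_ideal_sub[OF L c(1)]]) (use c in auto)
  then show ?thesis using c by blast
qed

text \<open>The left ideal of all \<open>s\<close> with \<open>s \<otimes> r \<in> R c\<close> is
  essential because \<open>R c\<close> is, so it contains a regular element.\<close>

theorem goldie_ore:
  assumes sp: "semiprime_ring R" and acc: "acc_left_annihilators R"
    and nf: "\<nexists>D x. descending_flag R (carrier R) {\<zero>} D x"
    and c: "c \<in> regular_elements R" and r: "r \<in> carrier R"
  shows "\<exists>c'\<in>regular_elements R. \<exists>r'\<in>carrier R. c' \<otimes> r = r' \<otimes> c"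
proof -
  have cc: "c \<in> carrier R" and c0: "\<And>r. r \<in> carrier R \<Longrightarrow> r \<otimes> c = \<zero> \<Longrightarrow> r = \<zero>"
    using regular_closed[OF c] regular_right[OF c] by auto
  define J where "J = {s \<in> carrier R. s \<otimes> r \<in> (\<lambda>s. s \<otimes> c) ` carrier R}"
  have "left_ideal J R" unfolding J_def
    by (rule left_ideal_colon[OF left_ideal_right_multiples[OF left_ideal_carrier cc] r])
  moreover have "\<exists>s\<in>carrier R. s \<otimes> b \<in> J \<and> s \<otimes> b \<noteq> \<zero>" if b: "b \<in> carrier R" "b \<noteq> \<zero>" for b
  proof (cases "b \<otimes> r = \<zero>")
    case True
    then have "b \<in> J" using b cc by (auto simp: J_def intro!: image_eqI[of _ _ \<zero>])
    then show ?thesis using b by (intro bexI[of _ \<one>]) auto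
  next
    case False
    then obtain s t where s: "s \<in> carrier R" "t \<in> carrier R" "s \<otimes> (b \<otimes> r) = t \<otimes> c" "s \<otimes> (b \<otimes> r) \<noteq> \<zero>"
      using left_cancellable_multiples_essential[OF nf cc c0, of "b \<otimes> r"] b r by auto
    then have "s \<otimes> b \<in> J" using b r by (auto simp: J_def m_assoc)
    moreover have "s \<otimes> b \<noteq> \<zero>" using s b r by (auto simp: m_assoc[symmetric])
    ultimately show ?thesis using s by blast
  qed
  ultimately obtain c' where "c' \<in> J" "c' \<in> regular_elements R"
    using goldie_essential_regular[OF sp acc nf] by blast
  then show ?thesis unfolding J_def by blast
qed

end

section \<open>The prime radical\<close>

context ring
begin

lemma ideal_iff:
  "ideal J R \<longleftrightarrow> left_ideal J R \<and> (\<forall>x\<in>J. \<forall>r\<in>carrier R. x \<otimes> r \<in> J)"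
proof
  assume "ideal J R"
  then show "left_ideal J R \<and> (\<forall>x\<in>J. \<forall>r\<in>carrier R. x \<otimes> r \<in> J)"
    using ideal_left_ideal[of J] ideal.I_r_closed[of J R] by simp
next
  assume h: "left_ideal J R \<and> (\<forall>x\<in>J. \<forall>r\<in>carrier R. x \<otimes> r \<in> J)"
  then have "additive_subgroup J R"
    by (simp add: left_ideal_def left_submodule_def additive_subgroup_def left_regular_module_def
        subgroup_def m_inv_def)
  then show "ideal J R"
    using h by (intro idealI) (auto simp: additive_subgroup_def left_ideal_mult ring_axioms)
qed

lemma ideal_mult_closed:
  assumes "ideal J R" "x \<in> J" "r \<in> carrier R"
  shows "r \<otimes> x \<in> J" "x \<otimes> r \<in> J"
  using ideal.I_l_closed[OF assms] ideal.I_r_closed[OF assms] by auto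

lemma ideal_closed: "ideal J R \<Longrightarrow> x \<in> J \<Longrightarrow> x \<in> carrier R"
  using ideal.Icarr by fast

lemma ideal_prod_subset_iff:
  assumes P: "ideal P R"
  shows "I \<cdot> J \<subseteq> P \<longleftrightarrow> (\<forall>i\<in>I. \<forall>j\<in>J. i \<otimes> j \<in> P)"
proof
  assume "\<forall>i\<in>I. \<forall>j\<in>J. i \<otimes> j \<in> P"
  have "x \<in> P" if "x \<in> I \<cdot> J" for x
    using that(1) left_ideal_add[OF ideal_left_ideal[OF P]]
    by (induction rule: ideal_prod.induct) (use \<open>\<forall>i\<in>I. \<forall>j\<in>J. i \<otimes> j \<in> P\<close> in auto)
  then show "I \<cdot> J \<subseteq> P" by blast
qed (auto intro: ideal_prod.prod)

text \<open>By Zorn's lemma some ideal \<open>P\<close> is maximal among those above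
  \<open>I\<close> that avoid the sequence. If \<open>A\<close> and \<open>B\<close> are not
  contained in \<open>P\<close>, some term has both the form \<open>p \<oplus> a\<close> and the
  form \<open>q \<oplus> b\<close>; the next term then lies in \<open>P + A B\<close>, so
  \<open>A B\<close> is not inside \<open>P\<close>.\<close>

lemma prime_ideal_avoiding_sequence:
  fixes s r :: "nat \<Rightarrow> 'a"
  assumes I: "ideal I R" and s: "\<And>n. s n \<in> carrier R" "\<And>n. s n \<notin> I"
    and r: "\<And>n. r n \<in> carrier R" and srs: "\<And>n. s (Suc n) = s n \<otimes> r n \<otimes> s n"
  shows "\<exists>P. prime_ideal P R \<and> (\<forall>n. s n \<notin> P)"
proof -
  define \<A> where "\<A> = {J. ideal J R \<and> I \<subseteq> J \<and> (\<forall>n. s n \<notin> J)}"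
  have "\<exists>P\<in>\<A>. \<forall>X\<in>\<A>. P \<subseteq> X \<longrightarrow> X = P"
  proof (rule subset_Zorn_nonempty)
    show "\<A> \<noteq> {}" using I s by (auto simp: \<A>_def)
    fix \<C> assume C: "\<C> \<noteq> {}" "subset.chain \<A> \<C>"
    then have CA: "\<And>J. J \<in> \<C> \<Longrightarrow> J \<in> \<A>" and ch: "\<And>J K. J \<in> \<C> \<Longrightarrow> K \<in> \<C> \<Longrightarrow> J \<subseteq> K \<or> K \<subseteq> J"
      by (auto simp: subset.chain_def)
    have CI: "ideal J R" if "J \<in> \<C>" for J using CA that by (simp add: \<A>_def)
    have "left_ideal (\<Union>\<C>) R"
    proof (rule left_idealI)
      show "\<Union>\<C> \<subseteq> carrier R" using CI ideal_closed by blast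
      show "\<zero> \<in> \<Union>\<C>" using C(1) CI left_ideal_zero ideal_left_ideal by blast
      show "x \<oplus> y \<in> \<Union>\<C>" if xy: "x \<in> \<Union>\<C>" "y \<in> \<Union>\<C>" for x y
      proof -
        obtain J K where "x \<in> J" "y \<in> K" "J \<in> \<C>" "K \<in> \<C>" using xy by blast
        then obtain L where "L \<in> \<C>" "x \<in> L" "y \<in> L" using ch by blast
        then show ?thesis using left_ideal_add[OF ideal_left_ideal[OF CI]] by blast
      qed
      show "t \<otimes> x \<in> \<Union>\<C>" if "t \<in> carrier R" "x \<in> \<Union>\<C>" for t x
        using that CI ideal_mult_closed by blast
    qed
    then have "ideal (\<Union>\<C>) R" unfolding ideal_iff using CI ideal_mult_closed by blast
    moreover have "I \<subseteq> \<Union>\<C>" using C(1) CA by (fastforce simp: \<A>_def)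
    ultimately show "\<Union>\<C> \<in> \<A>" using CA by (auto simp: \<A>_def)
  qed
  then obtain P where P: "ideal P R" "I \<subseteq> P" "\<And>n. s n \<notin> P"
    and max: "\<And>X. ideal X R \<Longrightarrow> P \<subseteq> X \<Longrightarrow> (\<And>n. s n \<notin> X) \<Longrightarrow> X = P"
    unfolding \<A>_def by fastforce
  \<comment> \<open>Each term is a multiple of the one before, so an ideal containing one term
    contains all later ones. This lets the indices found for two ideals be replaced by their
    maximum.\<close>
  have tail: "s m \<in> J" if J: "ideal J R" "s n \<in> J" "n \<le> m" for J n m
    using J(3)
  proof (induction m rule: dec_induct)
    case (step m)
    then show ?case using srs[of m] ideal_mult_closed[OF J(1)] s r by (simp add: m_assoc)
  qed (use J in auto)
  have meets: "\<exists>n p i. s n = p \<oplus> i \<and> p \<in> P \<and> i \<in> J \<and> (\<forall>m\<ge>n. \<exists>p\<in>P. \<exists>i\<in>J. s m = p \<oplus> i)"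
    if J: "ideal J R" "\<not> J \<subseteq> P" for J
  proof -
    define X where "X = {x \<oplus> y | x y. x \<in> P \<and> y \<in> J}"
    have X: "ideal X R"
      unfolding ideal_iff
    proof (intro conjI ballI)
      show "left_ideal X R" unfolding X_def using left_ideal_plus P J ideal_left_ideal by blast
      fix x t assume x: "x \<in> X" and t: "t \<in> carrier R"
      then obtain p j where pj: "x = p \<oplus> j" "p \<in> P" "j \<in> J" by (auto simp: X_def)
      then have "x \<otimes> t = p \<otimes> t \<oplus> j \<otimes> t" using t P J ideal_closed by (simp add: l_distr)
      moreover have "p \<otimes> t \<in> P" "j \<otimes> t \<in> J" using pj t ideal_mult_closed P J by auto
      ultimately show "x \<otimes> t \<in> X" unfolding X_def by blast
    qed
    have z: "\<zero> \<in> P" "\<zero> \<in> J" using left_ideal_zero ideal_left_ideal P J by blast+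
    have PX: "P \<subseteq> X"
    proof
      fix p assume "p \<in> P"
      then have "p = p \<oplus> \<zero>" using ideal_closed[OF P(1)] by simp
      then show "p \<in> X" using z \<open>p \<in> P\<close> by (auto simp: X_def)
    qed
    have JX: "J \<subseteq> X"
    proof
      fix p assume "p \<in> J"
      then have "p = \<zero> \<oplus> p" using ideal_closed[OF J(1)] by simp
      then show "p \<in> X" using z \<open>p \<in> J\<close> by (auto simp: X_def)
    qed
    obtain n where n: "s n \<in> X" using max[OF X PX] JX J(2) by blast
    have "\<exists>p\<in>P. \<exists>i\<in>J. s m = p \<oplus> i" if "n \<le> m" for m
      using tail[OF X n that] by (auto simp: X_def)
    then show ?thesis by blast
  qed
  have "prime_ideal P R"
    unfolding prime_ideal_def
  proof (intro conjI allI impI P(1))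
    show "P \<noteq> carrier R" using P s by blast
    fix A B assume AB: "ideal A R \<and> ideal B R \<and> A \<cdot> B \<subseteq> P"
    show "A \<subseteq> P \<or> B \<subseteq> P"
    proof (rule ccontr)
      assume neg: "\<not> (A \<subseteq> P \<or> B \<subseteq> P)"
      obtain n where n: "\<And>m. m \<ge> n \<Longrightarrow> \<exists>p\<in>P. \<exists>i\<in>A. s m = p \<oplus> i" using meets[of A] AB neg by blast
      obtain n' where n': "\<And>m. m \<ge> n' \<Longrightarrow> \<exists>p\<in>P. \<exists>i\<in>B. s m = p \<oplus> i" using meets[of B] AB neg by blast
      define k where "k = max n n'"
      obtain p a where pa: "p \<in> P" "a \<in> A" "s k = p \<oplus> a" using n[of k] by (auto simp: k_def)
      obtain q b where qb: "q \<in> P" "b \<in> B" "s k = q \<oplus> b" using n'[of k] by (auto simp: k_def)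
      have car: "p \<in> carrier R" "q \<in> carrier R" "a \<in> carrier R" "b \<in> carrier R"
        using pa qb P AB ideal_closed by blast+
      have "s (Suc k) = p \<otimes> r k \<otimes> s k \<oplus> a \<otimes> r k \<otimes> s k"
        unfolding srs using pa(3) car r s by (simp add: l_distr)
      also have "a \<otimes> r k \<otimes> s k = a \<otimes> r k \<otimes> q \<oplus> a \<otimes> r k \<otimes> b"
        unfolding qb(3) using car r by (simp add: r_distr)
      also have "p \<otimes> r k \<otimes> s k \<oplus> (a \<otimes> r k \<otimes> q \<oplus> a \<otimes> r k \<otimes> b) \<in> P"
      proof (intro left_ideal_add[OF ideal_left_ideal[OF P(1)]])
        show "p \<otimes> r k \<otimes> s k \<in> P" "a \<otimes> r k \<otimes> q \<in> P"
          using ideal_mult_closed[OF P(1)] pa qb car r s by auto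
        have "a \<otimes> r k \<in> A" using AB ideal_mult_closed pa r by blast
        then show "a \<otimes> r k \<otimes> b \<in> P" using AB qb ideal_prod_subset_iff[OF P(1)] by blast
      qed
      finally show False using P by blast
    qed
  qed
  then show ?thesis using P by blast
qed

lemma prime_radical_ideal: "ideal (prime_radical R) R"
proof -
  have "left_ideal (prime_radical R) R"
    by (rule left_idealI)
      (auto simp: prime_radical_def prime_ideal_def left_ideal_zero left_ideal_add ideal_left_ideal ideal_mult_closed)
  then show ?thesis unfolding ideal_iff by (auto simp: prime_radical_def prime_ideal_def ideal_mult_closed)
qed

text \<open>Instead of the ideal generated by \<open>a\<close>, whose elements are sums, two
  annihilators modulo \<open>P\<close> are intersected: \<open>A\<close> consists of the
  \<open>x\<close> with \<open>a R x \<subseteq> P\<close>, and \<open>B\<close> of the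
  \<open>y\<close> with \<open>y R A \<subseteq> P\<close>. Both contain \<open>a\<close>, and
  \<open>B A \<subseteq> P\<close>.\<close>

lemma ideal_square_subset:
  assumes Pi: "ideal P R" and a: "a \<in> carrier R" and h: "\<And>r. r \<in> carrier R \<Longrightarrow> a \<otimes> r \<otimes> a \<in> P"
  shows "\<exists>I. ideal I R \<and> a \<in> I \<and> (\<forall>x\<in>I. \<forall>y\<in>I. x \<otimes> y \<in> P)"
proof -
  note Pl = ideal_left_ideal[OF Pi]
  define A where "A = {x \<in> carrier R. \<forall>r\<in>carrier R. a \<otimes> r \<otimes> x \<in> P}"
  define B where "B = {y \<in> carrier R. \<forall>x\<in>A. \<forall>r\<in>carrier R. y \<otimes> r \<otimes> x \<in> P}"
  have Ac: "x \<in> carrier R" if "x \<in> A" for x using that by (simp add: A_def)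
  have A: "ideal A R"
    unfolding ideal_iff
  proof (intro conjI ballI left_idealI)
    show "A \<subseteq> carrier R" "\<zero> \<in> A" using left_ideal_zero[OF Pl] a by (auto simp: A_def)
    show "x \<oplus> y \<in> A" if "x \<in> A" "y \<in> A" for x y
      using that left_ideal_add[OF Pl] a by (auto simp: A_def r_distr)
    show "t \<otimes> x \<in> A" if "t \<in> carrier R" "x \<in> A" for t x
    proof -
      have "a \<otimes> r \<otimes> (t \<otimes> x) = a \<otimes> (r \<otimes> t) \<otimes> x" if "r \<in> carrier R" for r
        using that \<open>t \<in> carrier R\<close> Ac[OF \<open>x \<in> A\<close>] a by (simp add: m_assoc)
      then show ?thesis using that by (simp add: A_def)
    qed
    show "x \<otimes> t \<in> A" if "x \<in> A" "t \<in> carrier R" for t x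
    proof -
      have "a \<otimes> r \<otimes> (x \<otimes> t) = a \<otimes> r \<otimes> x \<otimes> t" if "r \<in> carrier R" for r
        using that \<open>t \<in> carrier R\<close> Ac[OF \<open>x \<in> A\<close>] a by (simp add: m_assoc)
      then show ?thesis using that ideal_mult_closed[OF Pi] by (simp add: A_def)
    qed
  qed
  have Bc: "x \<in> carrier R" if "x \<in> B" for x using that by (simp add: B_def)
  have B: "ideal B R"
    unfolding ideal_iff
  proof (intro conjI ballI left_idealI)
    show "B \<subseteq> carrier R" "\<zero> \<in> B" using left_ideal_zero[OF Pl] Ac by (auto simp: B_def)
    show "x \<oplus> y \<in> B" if "x \<in> B" "y \<in> B" for x y
      using that left_ideal_add[OF Pl] Ac by (auto simp: B_def l_distr)
    show "t \<otimes> y \<in> B" if "t \<in> carrier R" "y \<in> B" for t y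
    proof -
      have "t \<otimes> y \<otimes> r \<otimes> x = t \<otimes> (y \<otimes> r \<otimes> x)" if "r \<in> carrier R" "x \<in> A" for r x
        using that \<open>t \<in> carrier R\<close> Bc[OF \<open>y \<in> B\<close>] Ac by (simp add: m_assoc)
      then show ?thesis using that ideal_mult_closed[OF Pi] by (simp add: B_def)
    qed
    show "y \<otimes> t \<in> B" if "y \<in> B" "t \<in> carrier R" for t y
    proof -
      have "y \<otimes> t \<otimes> r \<otimes> x = y \<otimes> (t \<otimes> r) \<otimes> x" if "r \<in> carrier R" "x \<in> A" for r x
        using that \<open>t \<in> carrier R\<close> Bc[OF \<open>y \<in> B\<close>] Ac by (simp add: m_assoc)
      then show ?thesis using that by (simp add: B_def)
    qed
  qed
  have "a \<in> A" using a h by (simp add: A_def)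
  have "a \<in> B" using a by (simp add: B_def A_def)
  have "y \<otimes> x \<in> P" if "y \<in> B" "x \<in> A" for y x
  proof -
    have "y \<otimes> \<one> \<otimes> x \<in> P" using that unfolding B_def by blast
    then show ?thesis using Bc that by simp
  qed
  moreover have "ideal (A \<inter> B) R"
    using A B left_ideal_inter[OF ideal_left_ideal[OF A] ideal_left_ideal[OF B]] unfolding ideal_iff by blast
  ultimately show ?thesis using \<open>a \<in> A\<close> \<open>a \<in> B\<close> by blast
qed

lemma prime_ideal_elt:
  assumes P: "prime_ideal P R" and a: "a \<in> carrier R" and h: "\<And>r. r \<in> carrier R \<Longrightarrow> a \<otimes> r \<otimes> a \<in> P"
  shows "a \<in> P"
proof -
  have Pi: "ideal P R" using P by (simp add: prime_ideal_def)
  obtain I where I: "ideal I R" "a \<in> I" "\<forall>x\<in>I. \<forall>y\<in>I. x \<otimes> y \<in> P"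
    using ideal_square_subset[OF Pi a h] by blast
  then have "I \<cdot> I \<subseteq> P" using ideal_prod_subset_iff[OF Pi] by blast
  then show ?thesis using P I(1,2) unfolding prime_ideal_def by blast
qed

lemma prime_radical_semiprime:
  assumes "a \<in> carrier R" "\<And>r. r \<in> carrier R \<Longrightarrow> a \<otimes> r \<otimes> a \<in> prime_radical R"
  shows "a \<in> prime_radical R"
proof -
  have "a \<in> P" if "prime_ideal P R" for P
    by (rule prime_ideal_elt[OF that assms(1)]) (use assms(2) that in \<open>auto simp: prime_radical_def\<close>)
  then show ?thesis using assms(1) by (simp add: prime_radical_def)
qed

text \<open>For every \<open>a\<close> outside a semiprime ideal \<open>I\<close> some
  \<open>a \<otimes> r \<otimes> a\<close> is again outside \<open>I\<close>. Iterating from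
  \<open>x\<close> gives a sequence that a prime ideal avoids, so \<open>x\<close> cannot lie in the
  prime radical.\<close>

lemma prime_radical_least:
  assumes I: "ideal I R" and sp: "\<And>a. a \<in> carrier R \<Longrightarrow> (\<And>r. r \<in> carrier R \<Longrightarrow> a \<otimes> r \<otimes> a \<in> I) \<Longrightarrow> a \<in> I"
  shows "prime_radical R \<subseteq> I"
proof
  fix x assume x: "x \<in> prime_radical R"
  show "x \<in> I"
  proof (rule ccontr)
    assume "x \<notin> I"
    \<comment> \<open>The clause for \<open>n = 0\<close> pins the start of the chosen sequence to
      \<open>x\<close>.\<close>
    have "\<exists>f. \<forall>n. (f n \<in> carrier R \<and> f n \<notin> I \<and> (n = 0 \<longrightarrow> f n = x)) \<and> (\<exists>r\<in>carrier R. f (Suc n) = f n \<otimes> r \<otimes> f n)"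
    proof -
      have 1: "\<exists>y. y \<in> carrier R \<and> y \<notin> I \<and> ((0::nat) = 0 \<longrightarrow> y = x)"
        using x \<open>x \<notin> I\<close> by (auto simp: prime_radical_def)
      have 2: "\<exists>b. (b \<in> carrier R \<and> b \<notin> I \<and> (Suc n = 0 \<longrightarrow> b = x)) \<and> (\<exists>r\<in>carrier R. b = a \<otimes> r \<otimes> a)"
        if a: "a \<in> carrier R \<and> a \<notin> I \<and> (n = 0 \<longrightarrow> a = x)" for a n
      proof -
        obtain r where "r \<in> carrier R" "a \<otimes> r \<otimes> a \<notin> I" using sp[of a] a by blast
        then show ?thesis using a by (intro exI[of _ "a \<otimes> r \<otimes> a"]) auto
      qed
      show ?thesis
        using dependent_nat_choice[of "\<lambda>n a. a \<in> carrier R \<and> a \<notin> I \<and> (n = 0 \<longrightarrow> a = x)"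
            "\<lambda>_ a b. \<exists>r\<in>carrier R. b = a \<otimes> r \<otimes> a"] 1 2 by blast
    qed
    then obtain s where s: "\<And>n. s n \<in> carrier R" "\<And>n. s n \<notin> I" "s 0 = x"
      "\<And>n. \<exists>r\<in>carrier R. s (Suc n) = s n \<otimes> r \<otimes> s n" by blast
    then obtain r where "\<And>n. r n \<in> carrier R" "\<And>n. s (Suc n) = s n \<otimes> r n \<otimes> s n" by metis
    then have "\<exists>P. prime_ideal P R \<and> (\<forall>n. s n \<notin> P)"
      by (rule prime_ideal_avoiding_sequence[OF I s(1,2)])
    then obtain P where "prime_ideal P R" "x \<notin> P" using s(3) by metis
    then show False using x by (simp add: prime_radical_def)
  qed
qed

lemma ideal_zeroset: "ideal {\<zero>} R"
  unfolding ideal_iff using left_ideal_zeroset by simp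

text \<open>In the powers of \<open>x\<close> with exponents \<open>2 ^ n\<close> each term is the
  square of the one before. If none is zero, a prime ideal avoids them all, and the first of them is
  \<open>x\<close>.\<close>

lemma prime_radical_nil:
  assumes x: "x \<in> prime_radical R"
  shows "\<exists>n::nat. x [^] n = \<zero>"
proof (rule ccontr)
  assume neg: "\<not> ?thesis"
  have xc: "x \<in> carrier R" using x by (simp add: prime_radical_def)
  have "x [^] ((2::nat) ^ Suc n) = x [^] ((2::nat) ^ n) \<otimes> \<one> \<otimes> x [^] ((2::nat) ^ n)" for n
    using xc nat_pow_mult[of x "2 ^ n" "2 ^ n"] by (simp add: mult_2)
  then obtain P where P: "prime_ideal P R" "\<And>n::nat. x [^] ((2::nat) ^ n) \<notin> P"
    using prime_ideal_avoiding_sequence[OF ideal_zeroset, of "\<lambda>n. x [^] ((2::nat) ^ n)" "\<lambda>_. \<one>"] xc neg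
    by auto
  then have "prime_ideal P R" "x \<notin> P" using xc P(1) P(2)[of 0] by auto
  then show False using x by (simp add: prime_radical_def)
qed

section \<open>Powers of ideals and nilpotence\<close>

lemma ideal_power_ideal: "ideal I R \<Longrightarrow> ideal (ideal_power R I k) R"
  by (induction k) (auto simp: oneideal ideal_prod_is_ideal)

lemma nilpotent_ideal_le_prime_radical:
  assumes "nilpotent_ideal I R"
  shows "I \<subseteq> prime_radical R"
proof -
  have I: "ideal I R" using assms by (simp add: nilpotent_ideal_def)
  obtain k where k: "ideal_power R I k = {\<zero>}" using assms by (auto simp: nilpotent_ideal_def)
  have "I \<subseteq> P" if P: "prime_ideal P R" for P
  proof -
    have "ideal_power R I k \<subseteq> P"
      using k P left_ideal_zero ideal_left_ideal by (auto simp: prime_ideal_def)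
    then show ?thesis
    proof (induction k)
      case 0
      then show ?case using P ideal_closed I by (auto simp: prime_ideal_def)
    next
      case (Suc k)
      then show ?case using P I ideal_power_ideal[OF I, of k] unfolding prime_ideal_def ideal_power.simps by blast
    qed
  qed
  then show ?thesis using ideal_closed[OF I] by (auto simp: prime_radical_def)
qed

lemma ideal_power_mult_right:
  "x \<in> ideal_power R I k \<Longrightarrow> y \<in> I \<Longrightarrow> x \<otimes> y \<in> ideal_power R I (Suc k)"
  by (simp add: ideal_prod.prod)

text \<open>\<open>ideal_power\<close> appends new factors on the right, so a factor on the left has
  to be pushed in by induction.\<close>

lemma ideal_power_mult_left:
  assumes I: "ideal I R" and y: "y \<in> I"
  shows "x \<in> ideal_power R I k \<Longrightarrow> y \<otimes> x \<in> ideal_power R I (Suc k)"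
proof (induction k arbitrary: x)
  case 0
  then have "y \<otimes> x \<in> I" using ideal_mult_closed[OF I y] by simp
  then have "\<one> \<otimes> (y \<otimes> x) \<in> carrier R \<cdot> I" by (intro ideal_prod.prod) auto
  then show ?case using ideal_closed[OF I y] 0 by simp
next
  case (Suc k)
  have yc: "y \<in> carrier R" using ideal_closed[OF I y] .
  from Suc.prems show ?case
    unfolding ideal_power.simps(2)[of R I "Suc k"] ideal_power.simps(2)[of R I k]
  proof (induction rule: ideal_prod.induct)
    case (prod i j)
    then have "y \<otimes> i \<in> ideal_power R I k \<cdot> I" using Suc.IH by simp
    then have "(y \<otimes> i) \<otimes> j \<in> ideal_power R I k \<cdot> I \<cdot> I" using prod by (auto intro: ideal_prod.prod simp del: ideal_power.simps)
    moreover have "i \<in> carrier R" "j \<in> carrier R"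
      using prod ideal_closed[OF I] ideal_closed[OF ideal_power_ideal[OF I]] by blast+
    ultimately show ?case using yc by (simp add: m_assoc)
  next
    case (sum a b)
    have "a \<in> carrier R" "b \<in> carrier R"
      using sum.hyps ideal_prod_in_carrier[OF ideal_power_ideal[OF I] I] by blast+
    then show ?case using sum yc by (simp add: r_distr ideal_prod.sum)
  qed
qed

lemma ideal_power_decreasing:
  assumes I: "ideal I R" and "i \<le> j"
  shows "ideal_power R I j \<subseteq> ideal_power R I i"
  using assms(2)
proof (induction j rule: dec_induct)
  case (step n)
  have "ideal_power R I (Suc n) \<subseteq> ideal_power R I n"
    using ideal_prod_inter[OF ideal_power_ideal[OF I] I] by simp
  then show ?case using step by blast
qed simp

lemma ideal_power_one: "ideal I R \<Longrightarrow> ideal_power R I (Suc 0) = I"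
proof
  assume I: "ideal I R"
  show "ideal_power R I (Suc 0) \<subseteq> I" using ideal_prod_inter[OF oneideal I] by simp
  show "I \<subseteq> ideal_power R I (Suc 0)"
  proof
    fix x assume x: "x \<in> I"
    have "\<one> \<otimes> x \<in> carrier R \<cdot> I" by (intro ideal_prod.prod) (use x in auto)
    then show "x \<in> ideal_power R I (Suc 0)" using ideal_closed[OF I x] by simp
  qed
qed

lemma ideal_power_zero:
  assumes I: "ideal I R" and "ideal_power R I k = {\<zero>}" "k \<le> j"
  shows "ideal_power R I j = {\<zero>}"
  using ideal_power_decreasing[OF I assms(3)] assms(2)
    left_ideal_zero[OF ideal_left_ideal[OF ideal_power_ideal[OF I]]] by blast

end

section \<open>Left rings of fractions\<close>

definition left_ore :: "('a, 'm) ring_scheme \<Rightarrow> bool" where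
  "left_ore R \<longleftrightarrow> (\<forall>c\<in>regular_elements R. \<forall>r\<in>carrier R.
     \<exists>c'\<in>regular_elements R. \<exists>r'\<in>carrier R. c' \<otimes>\<^bsub>R\<^esub> r = r' \<otimes>\<^bsub>R\<^esub> c)"

locale ore_ring = ring R for R :: "('a, 'm) ring_scheme" (structure) +
  assumes left_ore: "left_ore R"
begin

abbreviation "C \<equiv> regular_elements R"

lemma ore:
  assumes "c \<in> C" "r \<in> carrier R"
  obtains c' r' where "c' \<in> C" "r' \<in> carrier R" "c' \<otimes> r = r' \<otimes> c"
  using left_ore assms unfolding left_ore_def by blast

text \<open>Only the common multiple \<open>a \<otimes> c\<close> is asserted to be regular, not its
  left factors. This is why \<open>frac_expand\<close> is stated for
  \<open>a \<otimes> c \<in> C\<close>.\<close>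

lemma common_multiple:
  assumes "c \<in> C" "d \<in> C"
  obtains a b where "a \<in> carrier R" "b \<in> carrier R" "a \<otimes> c = b \<otimes> d" "a \<otimes> c \<in> C"
proof -
  obtain c' r' where h: "c' \<in> C" "r' \<in> carrier R" "c' \<otimes> d = r' \<otimes> c"
    using ore[OF assms(1) regular_closed[OF assms(2)]] by blast
  have "c' \<otimes> d \<in> C" using h assms regular_mult by blast
  then show thesis using that[of r' c'] h regular_closed by simp
qed

lemma cancel_right:
  "c \<in> C \<Longrightarrow> x \<in> carrier R \<Longrightarrow> y \<in> carrier R \<Longrightarrow> x \<otimes> c = y \<otimes> c \<Longrightarrow> x = y"
  by (rule right_cancel_zero[of c]) (auto intro: regular_right regular_closed)

text \<open>The graph of right multiplication by \<open>c\<inverse> r\<close>.\<close>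

definition frac :: "'a \<Rightarrow> 'a \<Rightarrow> ('a \<times> 'a) set" where
  "frac c r = {(x, y). x \<in> carrier R \<and> y \<in> carrier R \<and>
     (\<exists>s\<in>C. \<exists>a\<in>carrier R. s \<otimes> x = a \<otimes> c \<and> s \<otimes> y = a \<otimes> r)}"

lemma frac_self: "c \<in> C \<Longrightarrow> r \<in> carrier R \<Longrightarrow> (c, r) \<in> frac c r"
  using regular_one regular_closed by (auto simp: frac_def)

lemma frac_subset:
  assumes c: "c \<in> C" "r \<in> carrier R" and d: "d \<in> C" "t \<in> carrier R"
    and s: "s \<in> C" "a \<in> carrier R" "s \<otimes> d = a \<otimes> c" "s \<otimes> t = a \<otimes> r"
  shows "frac d t \<subseteq> frac c r"
proof
  fix z assume "z \<in> frac d t"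
  then obtain x y p b where z: "z = (x, y)" "x \<in> carrier R" "y \<in> carrier R" "p \<in> C" "b \<in> carrier R"
    "p \<otimes> x = b \<otimes> d" "p \<otimes> y = b \<otimes> t" by (auto simp: frac_def)
  obtain s' b' where s': "s' \<in> C" "b' \<in> carrier R" "s' \<otimes> b = b' \<otimes> s"
    using ore[OF s(1) z(5)] by blast
  note car = c(2) d(2) s(2) z(2,3,5) s'(2) c(1)[THEN regular_closed] d(1)[THEN regular_closed]
    s(1)[THEN regular_closed] z(4)[THEN regular_closed] s'(1)[THEN regular_closed]
  have *: "(s' \<otimes> p) \<otimes> v = (b' \<otimes> a) \<otimes> w"
    if "p \<otimes> v = b \<otimes> u" "s \<otimes> u = a \<otimes> w" "v \<in> carrier R" "u \<in> carrier R" "w \<in> carrier R" for u v w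
  proof -
    have "(s' \<otimes> p) \<otimes> v = s' \<otimes> (p \<otimes> v)" using car that(3-5) by (simp add: m_assoc)
    also have "\<dots> = (s' \<otimes> b) \<otimes> u" unfolding that(1) using car that(3-5) by (simp add: m_assoc)
    also have "\<dots> = b' \<otimes> (s \<otimes> u)" unfolding s'(3) using car that(3-5) by (simp add: m_assoc)
    also have "\<dots> = (b' \<otimes> a) \<otimes> w" unfolding that(2) using car that(3-5) by (simp add: m_assoc)
    finally show ?thesis .
  qed
  have "(s' \<otimes> p) \<otimes> x = (b' \<otimes> a) \<otimes> c" "(s' \<otimes> p) \<otimes> y = (b' \<otimes> a) \<otimes> r"
    using *[OF z(6) s(3)] *[OF z(7) s(4)] car by auto
  moreover have "s' \<otimes> p \<in> C" using s' z regular_mult by blast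
  moreover have "b' \<otimes> a \<in> carrier R" using car by simp
  ultimately show "z \<in> frac c r" using z(1-3) unfolding frac_def by blast
qed

text \<open>The given relation is lopsided: the multiplier of \<open>d\<close> is regular, that of
  \<open>c\<close> is arbitrary. A further Ore step produces a regular multiplier of
  \<open>c\<close>, and right cancellation of \<open>c\<close> shows that it factors through
  \<open>a\<close>.\<close>

lemma frac_eqI:
  assumes c: "c \<in> C" "r \<in> carrier R" and d: "d \<in> C" "t \<in> carrier R"
    and s: "s \<in> C" "a \<in> carrier R" "s \<otimes> d = a \<otimes> c" "s \<otimes> t = a \<otimes> r"
  shows "frac c r = frac d t"
proof
  show "frac d t \<subseteq> frac c r" by (rule frac_subset[OF c d s])
  have sd: "s \<otimes> d \<in> C" using s d regular_mult by blast
  obtain s1 r1 where s1: "s1 \<in> C" "r1 \<in> carrier R" "s1 \<otimes> c = r1 \<otimes> (s \<otimes> d)"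
    using ore[OF sd regular_closed[OF c(1)]] by blast
  note car = c(2) d(2) s(2) s1(2) c(1)[THEN regular_closed] d(1)[THEN regular_closed]
    s(1)[THEN regular_closed] s1(1)[THEN regular_closed]
  have "s1 \<otimes> c = (r1 \<otimes> a) \<otimes> c" unfolding s1(3) s(3) using car by (simp add: m_assoc)
  then have e: "s1 = r1 \<otimes> a" using cancel_right[OF c(1)] car by simp
  have "s1 \<otimes> c = (r1 \<otimes> s) \<otimes> d" unfolding s1(3) using car by (simp add: m_assoc)
  moreover have "s1 \<otimes> r = (r1 \<otimes> s) \<otimes> t"
  proof -
    have "s1 \<otimes> r = r1 \<otimes> (a \<otimes> r)" unfolding e using car by (simp add: m_assoc)
    also have "\<dots> = (r1 \<otimes> s) \<otimes> t" unfolding s(4)[symmetric] using car by (simp add: m_assoc)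
    finally show ?thesis .
  qed
  ultimately show "frac c r \<subseteq> frac d t" using frac_subset[OF d c s1(1), of "r1 \<otimes> s"] car by simp
qed

lemma frac_eqD:
  assumes "frac c r = frac d t" "d \<in> C" "t \<in> carrier R"
  obtains s a where "s \<in> C" "a \<in> carrier R" "s \<otimes> d = a \<otimes> c" "s \<otimes> t = a \<otimes> r"
proof -
  have "(d, t) \<in> frac c r" using frac_self assms by blast
  then show thesis using that by (auto simp: frac_def)
qed

lemma frac_expand:
  assumes "c \<in> C" "r \<in> carrier R" "a \<in> carrier R" "a \<otimes> c \<in> C"
  shows "frac (a \<otimes> c) (a \<otimes> r) = frac c r"
proof (rule sym, rule frac_eqI[of _ _ _ _ \<one> a])
qed (use assms regular_one regular_closed in auto)

definition fracs :: "('a \<times> 'a) set set" where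
  "fracs = {frac c r | c r. c \<in> C \<and> r \<in> carrier R}"

text \<open>A union over all common denominators instead of a choice of one. The lemma
  \<open>frac_add\<close> shows that all of them give the same fraction.\<close>

definition frac_add :: "('a \<times> 'a) set \<Rightarrow> ('a \<times> 'a) set \<Rightarrow> ('a \<times> 'a) set" where
  "frac_add P Q = {z. \<exists>c u v. c \<in> C \<and> u \<in> carrier R \<and> v \<in> carrier R \<and> P = frac c u \<and> Q = frac c v \<and>
     z \<in> frac c (u \<oplus> v)}"

text \<open>The left numerator is required to end in the denominator \<open>d\<close> of the right
  factor, so that formally \<open>c^-1 e d d^-1 v = c^-1 e v\<close>. Such representations are
  provided by \<open>factor_through\<close>.\<close>

definition frac_mult :: "('a \<times> 'a) set \<Rightarrow> ('a \<times> 'a) set \<Rightarrow> ('a \<times> 'a) set" where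
  "frac_mult P Q = {z. \<exists>c e d v. c \<in> C \<and> d \<in> C \<and> e \<in> carrier R \<and> v \<in> carrier R \<and>
     P = frac c (e \<otimes> d) \<and> Q = frac d v \<and> z \<in> frac c (e \<otimes> v)}"

definition fraction_ring :: "('a \<times> 'a) set ring" where
  "fraction_ring = \<lparr>carrier = fracs, mult = frac_mult, one = frac \<one> \<one>,
     zero = frac \<one> \<zero>, add = frac_add\<rparr>"

lemma frac_add:
  assumes c: "c \<in> C" "u \<in> carrier R" "v \<in> carrier R"
  shows "frac_add (frac c u) (frac c v) = frac c (u \<oplus> v)"
proof
  show "frac c (u \<oplus> v) \<subseteq> frac_add (frac c u) (frac c v)" using c by (auto simp: frac_add_def)
  show "frac_add (frac c u) (frac c v) \<subseteq> frac c (u \<oplus> v)"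
  proof
    fix z assume "z \<in> frac_add (frac c u) (frac c v)"
    then obtain d u' v' where d: "d \<in> C" "u' \<in> carrier R" "v' \<in> carrier R"
      "frac c u = frac d u'" "frac c v = frac d v'" "z \<in> frac d (u' \<oplus> v')" by (auto simp: frac_add_def)
    obtain s a where s: "s \<in> C" "a \<in> carrier R" "s \<otimes> d = a \<otimes> c" "s \<otimes> u' = a \<otimes> u"
      using frac_eqD[OF d(4,1,2)] by blast
    obtain t b where t: "t \<in> C" "b \<in> carrier R" "t \<otimes> d = b \<otimes> c" "t \<otimes> v' = b \<otimes> v"
      using frac_eqD[OF d(5,1,3)] by blast
    obtain p q where p: "p \<in> carrier R" "q \<in> carrier R" "p \<otimes> s = q \<otimes> t" "p \<otimes> s \<in> C"
      using common_multiple[OF s(1) t(1)] by blast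
    note car = c(2,3) d(2,3) s(2) t(2) p(1,2) c(1)[THEN regular_closed] d(1)[THEN regular_closed]
      s(1)[THEN regular_closed] t(1)[THEN regular_closed]
    have "(p \<otimes> a) \<otimes> c = p \<otimes> (s \<otimes> d)" unfolding s(3) using car by (simp add: m_assoc)
    also have "\<dots> = (q \<otimes> t) \<otimes> d" unfolding p(3)[symmetric] using car by (simp add: m_assoc)
    also have "\<dots> = q \<otimes> (b \<otimes> c)" unfolding t(3)[symmetric] using car by (simp add: m_assoc)
    also have "\<dots> = (q \<otimes> b) \<otimes> c" using car by (simp add: m_assoc)
    \<comment> \<open>After adjustment by \<open>p\<close> and \<open>q\<close> both comparisons
      send \<open>c\<close> to the same multiple of \<open>d\<close>. Cancelling \<open>c\<close>
      makes the multipliers equal, and only then can the numerators be added.\<close>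
    finally have pa: "p \<otimes> a = q \<otimes> b" using cancel_right[OF c(1)] car by simp
    have "(p \<otimes> s) \<otimes> d = (p \<otimes> a) \<otimes> c" using car s(3) by (simp add: m_assoc)
    moreover have "(p \<otimes> s) \<otimes> (u' \<oplus> v') = (p \<otimes> a) \<otimes> (u \<oplus> v)"
    proof -
      have "(p \<otimes> s) \<otimes> (u' \<oplus> v') = p \<otimes> (s \<otimes> u') \<oplus> (p \<otimes> s) \<otimes> v'" using car by (simp add: r_distr m_assoc)
      also have "(p \<otimes> s) \<otimes> v' = q \<otimes> (t \<otimes> v')" unfolding p(3) using car by (simp add: m_assoc)
      also have "q \<otimes> (t \<otimes> v') = (q \<otimes> b) \<otimes> v" unfolding t(4) using car by (simp add: m_assoc)
      also have "p \<otimes> (s \<otimes> u') = (p \<otimes> a) \<otimes> u" unfolding s(4) using car by (simp add: m_assoc)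
      finally show ?thesis unfolding pa[symmetric] using car by (simp add: r_distr)
    qed
    ultimately have "frac c (u \<oplus> v) = frac d (u' \<oplus> v')"
      using car p(4) c(1) d(1) by (intro frac_eqI[of c _ d _ "p \<otimes> s" "p \<otimes> a"]) auto
    then show "z \<in> frac c (u \<oplus> v)" using d by simp
  qed
qed

lemma frac_mult:
  assumes c: "c \<in> C" "d \<in> C" "e \<in> carrier R" "v \<in> carrier R"
  shows "frac_mult (frac c (e \<otimes> d)) (frac d v) = frac c (e \<otimes> v)"
proof
  show "frac c (e \<otimes> v) \<subseteq> frac_mult (frac c (e \<otimes> d)) (frac d v)" using c by (auto simp: frac_mult_def)
  show "frac_mult (frac c (e \<otimes> d)) (frac d v) \<subseteq> frac c (e \<otimes> v)"
  proof
    fix z assume "z \<in> frac_mult (frac c (e \<otimes> d)) (frac d v)"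
    then obtain c' e' d' v' where c': "c' \<in> C" "d' \<in> C" "e' \<in> carrier R" "v' \<in> carrier R"
      "frac c (e \<otimes> d) = frac c' (e' \<otimes> d')" "frac d v = frac d' v'" "z \<in> frac c' (e' \<otimes> v')"
      by (auto simp: frac_mult_def)
    note car0 = c(3,4) c'(3,4) c(1,2)[THEN regular_closed] c'(1,2)[THEN regular_closed]
    have ed: "e' \<otimes> d' \<in> carrier R" using car0 by simp
    obtain s a where s: "s \<in> C" "a \<in> carrier R" "s \<otimes> c' = a \<otimes> c" "s \<otimes> (e' \<otimes> d') = a \<otimes> (e \<otimes> d)"
      using frac_eqD[OF c'(5,1) ed] by blast
    obtain t b where t: "t \<in> C" "b \<in> carrier R" "t \<otimes> d' = b \<otimes> d" "t \<otimes> v' = b \<otimes> v"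
      using frac_eqD[OF c'(6,2,4)] by blast
    have se: "s \<otimes> e' \<in> carrier R" using s car0 regular_closed by simp
    obtain p f where p: "p \<in> C" "f \<in> carrier R" "p \<otimes> (s \<otimes> e') = f \<otimes> t" using ore[OF t(1) se] by blast
    note car = car0 s(2) t(2) p(2) s(1)[THEN regular_closed] t(1)[THEN regular_closed] p(1)[THEN regular_closed]
    have "(p \<otimes> a \<otimes> e) \<otimes> d = p \<otimes> (a \<otimes> (e \<otimes> d))" using car by (simp add: m_assoc)
    also have "\<dots> = (p \<otimes> (s \<otimes> e')) \<otimes> d'" unfolding s(4)[symmetric] using car by (simp add: m_assoc)
    also have "\<dots> = f \<otimes> (t \<otimes> d')" unfolding p(3) using car by (simp add: m_assoc)
    also have "\<dots> = (f \<otimes> b) \<otimes> d" unfolding t(3) using car by (simp add: m_assoc)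
    \<comment> \<open>The Ore step moves \<open>e'\<close> past the multiplier \<open>t\<close>.
      Cancelling the regular \<open>d\<close> then shows that both representations put the same left
      factor in front of \<open>v\<close>.\<close>
    finally have pae: "p \<otimes> a \<otimes> e = f \<otimes> b" using cancel_right[OF c(2)] car by simp
    have "(p \<otimes> s) \<otimes> c' = (p \<otimes> a) \<otimes> c" using car s(3) by (simp add: m_assoc)
    moreover have "(p \<otimes> s) \<otimes> (e' \<otimes> v') = (p \<otimes> a) \<otimes> (e \<otimes> v)"
    proof -
      have "(p \<otimes> s) \<otimes> (e' \<otimes> v') = (p \<otimes> (s \<otimes> e')) \<otimes> v'" using car by (simp add: m_assoc)
      also have "\<dots> = f \<otimes> (t \<otimes> v')" unfolding p(3) using car by (simp add: m_assoc)
      also have "\<dots> = (f \<otimes> b) \<otimes> v" unfolding t(4) using car by (simp add: m_assoc)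
      finally show ?thesis unfolding pae[symmetric] using car by (simp add: m_assoc)
    qed
    moreover have "p \<otimes> s \<in> C" using p s regular_mult by blast
    ultimately have "frac c (e \<otimes> v) = frac c' (e' \<otimes> v')"
      using car c(1) c'(1) by (intro frac_eqI[of c _ c' _ "p \<otimes> s" "p \<otimes> a"]) auto
    then show "z \<in> frac c (e \<otimes> v)" using c' by simp
  qed
qed

lemma fracsE:
  assumes "P \<in> fracs" obtains c r where "c \<in> C" "r \<in> carrier R" "P = frac c r"
  using assms by (auto simp: fracs_def)

lemma fracsI: "c \<in> C \<Longrightarrow> r \<in> carrier R \<Longrightarrow> frac c r \<in> fracs"
  by (auto simp: fracs_def)

lemma common_denominator:
  assumes "P \<in> fracs" "Q \<in> fracs"
  obtains c u v where "c \<in> C" "u \<in> carrier R" "v \<in> carrier R" "P = frac c u" "Q = frac c v"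
proof -
  obtain c r where c: "c \<in> C" "r \<in> carrier R" "P = frac c r" using assms(1) by (rule fracsE)
  obtain d t where d: "d \<in> C" "t \<in> carrier R" "Q = frac d t" using assms(2) by (rule fracsE)
  obtain a b where a: "a \<in> carrier R" "b \<in> carrier R" "a \<otimes> c = b \<otimes> d" "a \<otimes> c \<in> C"
    using common_multiple[OF c(1) d(1)] by blast
  have "P = frac (a \<otimes> c) (a \<otimes> r)" using frac_expand[OF c(1,2) a(1,4)] c by simp
  moreover have "Q = frac (a \<otimes> c) (b \<otimes> t)" using frac_expand d a by simp
  ultimately show thesis using that a c d by blast
qed

lemma factor_through:
  assumes "P \<in> fracs" "d \<in> C"
  obtains c e where "c \<in> C" "e \<in> carrier R" "P = frac c (e \<otimes> d)"
proof -
  obtain c r where c: "c \<in> C" "r \<in> carrier R" "P = frac c r" using assms(1) by (rule fracsE)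
  obtain a e where a: "a \<in> C" "e \<in> carrier R" "a \<otimes> r = e \<otimes> d" using ore[OF assms(2) c(2)] by blast
  have ac: "a \<otimes> c \<in> C" using a c regular_mult by blast
  have "P = frac (a \<otimes> c) (a \<otimes> r)" using frac_expand[OF c(1,2) regular_closed[OF a(1)] ac] c by simp
  then show thesis using that ac a by simp
qed

lemma frac_zero: "c \<in> C \<Longrightarrow> frac c \<zero> = frac \<one> \<zero>"
  using frac_eqI[of \<one> \<zero> c \<zero> \<one> c] regular_one regular_closed by simp

lemma frac_one: "c \<in> C \<Longrightarrow> frac c c = frac \<one> \<one>"
  using frac_eqI[of \<one> \<one> c c \<one> c] regular_one regular_closed by simp

lemma fraction_ring_ring: "ring fraction_ring"
proof (rule ringI)
  note cl = regular_closed
  show "abelian_group fraction_ring"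
  proof (rule abelian_groupI, simp_all add: fraction_ring_def)
    show "frac \<one> \<zero> \<in> fracs" using fracsI regular_one by simp
    fix P assume P: "P \<in> fracs"
    then obtain c r where c: "c \<in> C" "r \<in> carrier R" "P = frac c r" by (rule fracsE)
    show "frac_add (frac \<one> \<zero>) P = P" using c frac_add[of c \<zero> r] frac_zero by simp
    have "frac_add (frac c (\<ominus> r)) P = frac \<one> \<zero>"
      using c frac_add[of c "\<ominus> r" r] frac_zero by (simp add: l_neg)
    then show "\<exists>Q\<in>fracs. frac_add Q P = frac \<one> \<zero>" using c fracsI by blast
    fix Q assume Q: "Q \<in> fracs"
    obtain c u v where c: "c \<in> C" "u \<in> carrier R" "v \<in> carrier R" "P = frac c u" "Q = frac c v"
      using common_denominator[OF P Q] by blast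
    then show "frac_add P Q \<in> fracs" using frac_add fracsI by simp
    show "frac_add P Q = frac_add Q P" using c frac_add by (simp add: a_comm)
    fix S assume S: "S \<in> fracs"
    then obtain d w where d: "d \<in> C" "w \<in> carrier R" "S = frac d w" by (rule fracsE)
    obtain a b where a: "a \<in> carrier R" "b \<in> carrier R" "a \<otimes> c = b \<otimes> d" "a \<otimes> c \<in> C"
      using common_multiple[OF c(1) d(1)] by blast
    have "P = frac (a \<otimes> c) (a \<otimes> u)" "Q = frac (a \<otimes> c) (a \<otimes> v)" "S = frac (a \<otimes> c) (b \<otimes> w)"
      using frac_expand[OF c(1) _ a(1,4)] frac_expand[OF d(1,2) a(2)] a(3,4) c d by simp_all
    then show "frac_add (frac_add P Q) S = frac_add P (frac_add Q S)"
      using a c d frac_add[OF a(4)] by (simp add: a_assoc)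
  qed
  show "Group.monoid fraction_ring"
  proof (rule Group.monoidI, simp_all add: fraction_ring_def)
    show "frac \<one> \<one> \<in> fracs" using fracsI regular_one by simp
    fix P assume P: "P \<in> fracs"
    then obtain c r where c: "c \<in> C" "r \<in> carrier R" "P = frac c r" by (rule fracsE)
    show "frac_mult (frac \<one> \<one>) P = P"
      using c frac_mult[of c c \<one> r] frac_one cl by simp
    show "frac_mult P (frac \<one> \<one>) = P" using c frac_mult[of c \<one> r \<one>] regular_one by simp
    fix Q assume Q: "Q \<in> fracs"
    then obtain d v where d: "d \<in> C" "v \<in> carrier R" "Q = frac d v" by (rule fracsE)
    obtain c e where c: "c \<in> C" "e \<in> carrier R" "P = frac c (e \<otimes> d)" using factor_through[OF P d(1)] by blast
    show "frac_mult P Q \<in> fracs" using c d frac_mult fracsI by simp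
    fix S assume S: "S \<in> fracs"
    then obtain g w where g: "g \<in> C" "w \<in> carrier R" "S = frac g w" by (rule fracsE)
    obtain d f where d: "d \<in> C" "f \<in> carrier R" "Q = frac d (f \<otimes> g)" using factor_through[OF Q g(1)] by blast
    obtain c e where c: "c \<in> C" "e \<in> carrier R" "P = frac c (e \<otimes> d)" using factor_through[OF P d(1)] by blast
    have gc: "g \<in> carrier R" using g cl by blast
    have "frac_mult P Q = frac c (e \<otimes> f \<otimes> g)" using c d g gc frac_mult[of c d e "f \<otimes> g"] by (simp add: m_assoc)
    then have "frac_mult (frac_mult P Q) S = frac c (e \<otimes> f \<otimes> w)" using c d g frac_mult[of c g "e \<otimes> f" w] by simp
    moreover have "frac_mult Q S = frac d (f \<otimes> w)" using d g frac_mult by simp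
    then have "frac_mult P (frac_mult Q S) = frac c (e \<otimes> (f \<otimes> w))" using c d g frac_mult[of c d e "f \<otimes> w"] by simp
    ultimately show "frac_mult (frac_mult P Q) S = frac_mult P (frac_mult Q S)" using c d g by (simp add: m_assoc)
  qed
  fix P Q S assume "P \<in> carrier fraction_ring" "Q \<in> carrier fraction_ring" "S \<in> carrier fraction_ring"
  then have P: "P \<in> fracs" and Q: "Q \<in> fracs" and S: "S \<in> fracs" by (simp_all add: fraction_ring_def)
  have "frac_mult (frac_add P Q) S = frac_add (frac_mult P S) (frac_mult Q S)"
  proof -
    obtain d w where d: "d \<in> C" "w \<in> carrier R" "S = frac d w" using S by (rule fracsE)
    obtain c u v where c: "c \<in> C" "u \<in> carrier R" "v \<in> carrier R" "P = frac c u" "Q = frac c v"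
      using common_denominator[OF P Q] by blast
    \<comment> \<open>Two Ore steps make both numerators end in \<open>d\<close>: \<open>p\<close>
      does it for \<open>u\<close>, then \<open>q\<close> for \<open>p \<otimes> v\<close>. The
      common denominator becomes \<open>(q \<otimes> p) \<otimes> c\<close>.\<close>
    obtain p e where p: "p \<in> C" "e \<in> carrier R" "p \<otimes> u = e \<otimes> d" using ore[OF d(1) c(2)] by blast
    have pv: "p \<otimes> v \<in> carrier R" using p c cl by simp
    obtain q f where q: "q \<in> C" "f \<in> carrier R" "q \<otimes> (p \<otimes> v) = f \<otimes> d" using ore[OF d(1) pv] by blast
    note car = c(2,3) d(2) p(2) q(2) c(1)[THEN cl] d(1)[THEN cl] p(1)[THEN cl] q(1)[THEN cl]
    have k: "(q \<otimes> p) \<otimes> c \<in> C" using p q c regular_mult by blast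
    have "(q \<otimes> p) \<otimes> u = (q \<otimes> e) \<otimes> d" using car p(3) by (simp add: m_assoc)
    moreover have "(q \<otimes> p) \<otimes> v = f \<otimes> d" using car q(3) by (simp add: m_assoc)
    ultimately have e: "P = frac ((q \<otimes> p) \<otimes> c) ((q \<otimes> e) \<otimes> d)" "Q = frac ((q \<otimes> p) \<otimes> c) (f \<otimes> d)"
      using frac_expand[OF c(1,2) _ k] frac_expand[OF c(1,3) _ k] c car by simp_all
    have "frac_add P Q = frac ((q \<otimes> p) \<otimes> c) ((q \<otimes> e \<oplus> f) \<otimes> d)"
      unfolding e using frac_add[OF k] car by (simp add: l_distr)
    then have "frac_mult (frac_add P Q) S = frac ((q \<otimes> p) \<otimes> c) ((q \<otimes> e \<oplus> f) \<otimes> w)"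
      using frac_mult[OF k d(1), of "q \<otimes> e \<oplus> f" w] car d by simp
    moreover have "frac_mult P S = frac ((q \<otimes> p) \<otimes> c) ((q \<otimes> e) \<otimes> w)" "frac_mult Q S = frac ((q \<otimes> p) \<otimes> c) (f \<otimes> w)"
      unfolding e d(3) using frac_mult[OF k d(1)] car by simp_all
    ultimately show ?thesis using frac_add[OF k] car by (simp add: l_distr)
  qed
  then show "(P \<oplus>\<^bsub>fraction_ring\<^esub> Q) \<otimes>\<^bsub>fraction_ring\<^esub> S =
      P \<otimes>\<^bsub>fraction_ring\<^esub> S \<oplus>\<^bsub>fraction_ring\<^esub> Q \<otimes>\<^bsub>fraction_ring\<^esub> S"
    by (simp add: fraction_ring_def)
  have "frac_mult S (frac_add P Q) = frac_add (frac_mult S P) (frac_mult S Q)"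
  proof -
    obtain d u v where d: "d \<in> C" "u \<in> carrier R" "v \<in> carrier R" "P = frac d u" "Q = frac d v"
      using common_denominator[OF P Q] by blast
    obtain c e where c: "c \<in> C" "e \<in> carrier R" "S = frac c (e \<otimes> d)" using factor_through[OF S d(1)] by blast
    show ?thesis using c d frac_add frac_mult by (simp add: r_distr)
  qed
  then show "S \<otimes>\<^bsub>fraction_ring\<^esub> (P \<oplus>\<^bsub>fraction_ring\<^esub> Q) =
      S \<otimes>\<^bsub>fraction_ring\<^esub> P \<oplus>\<^bsub>fraction_ring\<^esub> S \<otimes>\<^bsub>fraction_ring\<^esub> Q"
    by (simp add: fraction_ring_def)
qed

theorem fraction_ring_left_quotient_ring: "left_quotient_ring R fraction_ring (frac \<one>)"
  unfolding left_quotient_ring_def left_ring_of_fractions_def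
proof (intro conjI ballI)
  interpret Q: ring fraction_ring by (rule fraction_ring_ring)
  show "ring fraction_ring" by (rule fraction_ring_ring)
  note one = regular_one
  show "frac \<one> \<in> ring_hom R fraction_ring"
  proof (rule ring_hom_memI)
    fix x y assume xy: "x \<in> carrier R" "y \<in> carrier R"
    show "frac \<one> x \<in> carrier fraction_ring" using xy fracsI one by (simp add: fraction_ring_def)
    show "frac \<one> (x \<otimes> y) = frac \<one> x \<otimes>\<^bsub>fraction_ring\<^esub> frac \<one> y"
      using xy frac_mult[OF one one, of x y] by (simp add: fraction_ring_def)
    show "frac \<one> (x \<oplus> y) = frac \<one> x \<oplus>\<^bsub>fraction_ring\<^esub> frac \<one> y"
      using xy frac_add[OF one] by (simp add: fraction_ring_def)
  qed (simp add: fraction_ring_def)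
  have inv: "frac \<one> c \<in> Units fraction_ring \<and> inv\<^bsub>fraction_ring\<^esub> (frac \<one> c) = frac c \<one>" if c: "c \<in> C" for c
  proof -
    have cc: "c \<in> carrier R" using c regular_closed by blast
    have 1: "frac c \<one> \<otimes>\<^bsub>fraction_ring\<^esub> frac \<one> c = \<one>\<^bsub>fraction_ring\<^esub>"
      using frac_mult[OF c one, of \<one> c] cc frac_one[OF c] by (simp add: fraction_ring_def)
    have 2: "frac \<one> c \<otimes>\<^bsub>fraction_ring\<^esub> frac c \<one> = \<one>\<^bsub>fraction_ring\<^esub>"
      using frac_mult[OF one c, of \<one> \<one>] cc by (simp add: fraction_ring_def)
    have 3: "frac \<one> c \<in> carrier fraction_ring" "frac c \<one> \<in> carrier fraction_ring"
      using fracsI one c cc by (simp_all add: fraction_ring_def)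
    show ?thesis using 1 2 3 Q.inv_unique'[OF 3] by (auto simp: Units_def)
  qed
  show "frac \<one> c \<in> Units fraction_ring" if "c \<in> C" for c using inv[OF that] by simp
  show "\<exists>s\<in>C. \<exists>r\<in>carrier R. q = left_fraction fraction_ring (frac \<one>) s r"
    if q: "q \<in> carrier fraction_ring" for q
  proof -
    obtain c r where c: "c \<in> C" "r \<in> carrier R" "q = frac c r" using q by (auto simp: fraction_ring_def elim: fracsE)
    have "left_fraction fraction_ring (frac \<one>) c r = frac c r"
      using inv[OF c(1)] frac_mult[OF c(1) one, of \<one> r] c by (simp add: left_fraction_def fraction_ring_def)
    then show ?thesis using c by metis
  qed
  show "a_kernel R fraction_ring (frac \<one>) = {r \<in> carrier R. \<exists>s\<in>C. s \<otimes> r = \<zero>}"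
  proof -
    have "r = \<zero>" if r: "r \<in> carrier R" "frac \<one> r = frac \<one> \<zero>" for r
    proof -
      obtain s a where s: "s \<in> C" "a \<in> carrier R" "s \<otimes> \<one> = a \<otimes> \<one>" "s \<otimes> r = a \<otimes> \<zero>"
        using frac_eqD[of \<one> \<zero> \<one> r] r one by metis
      then show ?thesis using regular_left[of s r] r by simp
    qed
    moreover have "r = \<zero>" if "r \<in> carrier R" "s \<in> C" "s \<otimes> r = \<zero>" for r s
      using regular_left that by blast
    ultimately have "a_kernel R fraction_ring (frac \<one>) = {\<zero>}" "{r \<in> carrier R. \<exists>s\<in>C. s \<otimes> r = \<zero>} = {\<zero>}"
      using one by (auto simp: a_kernel_def' fraction_ring_def intro!: bexI[of _ \<one>])
    then show ?thesis by simp
  qed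
qed

end

section \<open>Extension and contraction of left ideals\<close>

definition saturated :: "('a, 'm) ring_scheme \<Rightarrow> 'a set \<Rightarrow> bool" where
  "saturated R I \<longleftrightarrow> (\<forall>c\<in>regular_elements R. \<forall>x\<in>carrier R. c \<otimes>\<^bsub>R\<^esub> x \<in> I \<longrightarrow> x \<in> I)"

text \<open>The left Artinian property of a left quotient ring, expressed inside \<open>R\<close>.
  As the quotient ring does not occur in it, it transfers the property between left quotient rings
  on different types.\<close>

definition dcc_saturated :: "('a, 'm) ring_scheme \<Rightarrow> bool" where
  "dcc_saturated R \<longleftrightarrow>
     (\<forall>I :: nat \<Rightarrow> 'a set. (\<forall>k. left_ideal (I k) R \<and> saturated R (I k)) \<and> (\<forall>k. I (Suc k) \<subseteq> I k)
        \<longrightarrow> (\<exists>n. \<forall>k\<ge>n. I k = I n))"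

locale left_quotient = ring R for R :: "('a, 'm) ring_scheme" (structure) +
  fixes Q :: "('q, 'n) ring_scheme" and \<sigma> :: "'a \<Rightarrow> 'q"
  assumes lq: "left_quotient_ring R Q \<sigma>"
begin

abbreviation "C \<equiv> regular_elements R"

sublocale Q: ring Q using lq by (simp add: left_quotient_ring_def left_ring_of_fractions_def)

lemma hom: "\<sigma> \<in> ring_hom R Q"
  using lq by (simp add: left_quotient_ring_def left_ring_of_fractions_def)

sublocale h: ring_hom_ring R Q \<sigma>
  using hom by (intro ring_hom_ringI2) (auto simp: ring_axioms Q.ring_axioms)

lemma \<sigma>_unit: "c \<in> C \<Longrightarrow> \<sigma> c \<in> Units Q"
  using lq by (simp add: left_quotient_ring_def left_ring_of_fractions_def)

lemma \<sigma>_eq_zero: "r \<in> carrier R \<Longrightarrow> \<sigma> r = \<zero>\<^bsub>Q\<^esub> \<longleftrightarrow> r = \<zero>"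
proof
  assume r: "r \<in> carrier R" "\<sigma> r = \<zero>\<^bsub>Q\<^esub>"
  then have "r \<in> a_kernel R Q \<sigma>" unfolding a_kernel_def' by blast
  then obtain s where "s \<in> C" "s \<otimes> r = \<zero>"
    using lq by (auto simp: left_quotient_ring_def left_ring_of_fractions_def)
  then show "r = \<zero>" using regular_left r by blast
qed simp

lemma \<sigma>_inj:
  assumes "x \<in> carrier R" "y \<in> carrier R" "\<sigma> x = \<sigma> y"
  shows "x = y"
proof -
  have "\<sigma> (x \<ominus> y) = \<zero>\<^bsub>Q\<^esub>" using assms by (simp add: minus_eq Q.r_neg)
  then show ?thesis using \<sigma>_eq_zero[of "x \<ominus> y"] assms diff_zero_iff by simp
qed

lemma cancel:
  "c \<in> C \<Longrightarrow> p \<in> carrier Q \<Longrightarrow> q \<in> carrier Q \<Longrightarrow> \<sigma> c \<otimes>\<^bsub>Q\<^esub> p = \<sigma> c \<otimes>\<^bsub>Q\<^esub> q \<Longrightarrow> p = q"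
  using Q.Units_l_cancel[OF \<sigma>_unit] by blast

lemma fraction_closed: "c \<in> C \<Longrightarrow> r \<in> carrier R \<Longrightarrow> left_fraction Q \<sigma> c r \<in> carrier Q"
  using \<sigma>_unit by (simp add: left_fraction_def)

lemma fraction_mult: "c \<in> C \<Longrightarrow> r \<in> carrier R \<Longrightarrow> \<sigma> c \<otimes>\<^bsub>Q\<^esub> left_fraction Q \<sigma> c r = \<sigma> r"
  using \<sigma>_unit regular_closed by (simp add: left_fraction_def Q.m_assoc[symmetric] Q.Units_closed)

lemma fraction_eqI:
  assumes "c \<in> C" "r \<in> carrier R" "q \<in> carrier Q" "\<sigma> c \<otimes>\<^bsub>Q\<^esub> q = \<sigma> r"
  shows "q = left_fraction Q \<sigma> c r"
  by (rule cancel[OF assms(1,3) fraction_closed]) (use assms fraction_mult in auto)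

lemma fraction_cases:
  assumes "q \<in> carrier Q"
  obtains c r where "c \<in> C" "r \<in> carrier R" "\<sigma> c \<otimes>\<^bsub>Q\<^esub> q = \<sigma> r" "q = left_fraction Q \<sigma> c r"
proof -
  obtain c r where "c \<in> C" "r \<in> carrier R" "q = left_fraction Q \<sigma> c r"
    using lq assms by (auto simp: left_quotient_ring_def left_ring_of_fractions_def)
  then show thesis using that fraction_mult by blast
qed

text \<open>The product of \<open>\<sigma> r\<close> and the inverse of \<open>\<sigma> c\<close> is
  again a left fraction. Clearing its denominators gives the Ore relation in \<open>Q\<close>, and
  injectivity of \<open>\<sigma>\<close> brings it back to \<open>R\<close>.\<close>

lemma left_ore: "left_ore R"
  unfolding left_ore_def
proof (intro ballI)
  fix c r assume c: "c \<in> C" and r: "r \<in> carrier R"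
  have u: "\<sigma> c \<in> Units Q" and cc: "c \<in> carrier R" using \<sigma>_unit regular_closed c by auto
  have q: "\<sigma> r \<otimes>\<^bsub>Q\<^esub> inv\<^bsub>Q\<^esub> \<sigma> c \<in> carrier Q" using u r by simp
  obtain c' r' where c': "c' \<in> C" "r' \<in> carrier R" "\<sigma> c' \<otimes>\<^bsub>Q\<^esub> (\<sigma> r \<otimes>\<^bsub>Q\<^esub> inv\<^bsub>Q\<^esub> \<sigma> c) = \<sigma> r'"
    using fraction_cases[OF q] by metis
  have c'c: "c' \<in> carrier R" using c' regular_closed by blast
  have "\<sigma> (r' \<otimes> c) = \<sigma> c' \<otimes>\<^bsub>Q\<^esub> (\<sigma> r \<otimes>\<^bsub>Q\<^esub> inv\<^bsub>Q\<^esub> \<sigma> c) \<otimes>\<^bsub>Q\<^esub> \<sigma> c" using c' cc by simp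
  also have "\<dots> = \<sigma> (c' \<otimes> r)" using c'c r u cc by (simp add: Q.m_assoc)
  finally have "c' \<otimes> r = r' \<otimes> c" using \<sigma>_inj c'c r c' cc by simp
  then show "\<exists>c'\<in>C. \<exists>r'\<in>carrier R. c' \<otimes> r = r' \<otimes> c" using c' by blast
qed

sublocale o: ore_ring R by unfold_locales (rule left_ore)

lemma common_denominator:
  assumes "p \<in> carrier Q" "q \<in> carrier Q"
  obtains c r t where "c \<in> C" "r \<in> carrier R" "t \<in> carrier R"
    "\<sigma> c \<otimes>\<^bsub>Q\<^esub> p = \<sigma> r" "\<sigma> c \<otimes>\<^bsub>Q\<^esub> q = \<sigma> t"
proof -
  obtain c r where c: "c \<in> C" "r \<in> carrier R" "\<sigma> c \<otimes>\<^bsub>Q\<^esub> p = \<sigma> r" using fraction_cases[OF assms(1)] by metis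
  have cc: "c \<in> carrier R" using c regular_closed by blast
  obtain d t where d: "d \<in> C" "t \<in> carrier R" "\<sigma> d \<otimes>\<^bsub>Q\<^esub> (\<sigma> c \<otimes>\<^bsub>Q\<^esub> q) = \<sigma> t"
    using fraction_cases[of "\<sigma> c \<otimes>\<^bsub>Q\<^esub> q"] assms cc by (metis Q.m_closed h.hom_closed)
  have dc: "d \<in> carrier R" using d regular_closed by blast
  have "\<sigma> (d \<otimes> c) \<otimes>\<^bsub>Q\<^esub> p = \<sigma> (d \<otimes> r)" "\<sigma> (d \<otimes> c) \<otimes>\<^bsub>Q\<^esub> q = \<sigma> t"
    using assms c d cc dc by (simp_all add: Q.m_assoc)
  moreover have "d \<otimes> c \<in> C" using c d regular_mult by blast
  ultimately show thesis using that[of "d \<otimes> c" "d \<otimes> r" t] c d dc by simp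
qed

text \<open>This is \<open>C^-1 I\<close>, described by clearing a denominator so that no inverse
  occurs.\<close>

definition ext :: "'a set \<Rightarrow> 'q set" where
  "ext I = {q \<in> carrier Q. \<exists>c\<in>C. \<exists>x\<in>I. \<sigma> c \<otimes>\<^bsub>Q\<^esub> q = \<sigma> x}"

definition contr :: "'q set \<Rightarrow> 'a set" where
  "contr L = {r \<in> carrier R. \<sigma> r \<in> L}"

lemma extI: "q \<in> carrier Q \<Longrightarrow> c \<in> C \<Longrightarrow> x \<in> I \<Longrightarrow> \<sigma> c \<otimes>\<^bsub>Q\<^esub> q = \<sigma> x \<Longrightarrow> q \<in> ext I"
  by (auto simp: ext_def)

lemma \<sigma>_in_ext: "I \<subseteq> carrier R \<Longrightarrow> x \<in> I \<Longrightarrow> \<sigma> x \<in> ext I"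
  by (rule extI[of _ \<one> x]) (auto simp: regular_one)

lemma localized_ideal_eq_ext:
  assumes "I \<subseteq> carrier R" shows "localized_ideal R Q \<sigma> I = ext I"
proof
  show "localized_ideal R Q \<sigma> I \<subseteq> ext I"
    using assms fraction_closed fraction_mult by (auto simp: localized_ideal_def intro!: extI)
  show "ext I \<subseteq> localized_ideal R Q \<sigma> I"
  proof
    fix q assume "q \<in> ext I"
    then obtain c x where c: "q \<in> carrier Q" "c \<in> C" "x \<in> I" "\<sigma> c \<otimes>\<^bsub>Q\<^esub> q = \<sigma> x" by (auto simp: ext_def)
    then have "q = left_fraction Q \<sigma> c x" using fraction_eqI assms by blast
    then show "q \<in> localized_ideal R Q \<sigma> I" using c unfolding localized_ideal_def by blast
  qed
qed

lemma ext_left_ideal: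
  assumes I: "left_ideal I R"
  shows "left_ideal (ext I) Q"
proof (rule Q.left_idealI)
  note Is = left_ideal_sub[OF I]
  show "ext I \<subseteq> carrier Q" by (auto simp: ext_def)
  show "\<zero>\<^bsub>Q\<^esub> \<in> ext I" using \<sigma>_in_ext[of I \<zero>] left_ideal_zero[OF I] Is by auto
  show "p \<oplus>\<^bsub>Q\<^esub> q \<in> ext I" if "p \<in> ext I" "q \<in> ext I" for p q
  proof -
    obtain c x where c: "p \<in> carrier Q" "c \<in> C" "x \<in> I" "\<sigma> c \<otimes>\<^bsub>Q\<^esub> p = \<sigma> x"
      using \<open>p \<in> ext I\<close> by (auto simp: ext_def)
    obtain d y where d: "q \<in> carrier Q" "d \<in> C" "y \<in> I" "\<sigma> d \<otimes>\<^bsub>Q\<^esub> q = \<sigma> y"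
      using \<open>q \<in> ext I\<close> by (auto simp: ext_def)
    obtain a b where a: "a \<in> carrier R" "b \<in> carrier R" "a \<otimes> c = b \<otimes> d" "a \<otimes> c \<in> C"
      using o.common_multiple[OF c(2) d(2)] by blast
    note cl = regular_closed[OF c(2)] regular_closed[OF d(2)] Is[OF c(3)] Is[OF d(3)]
    have "\<sigma> (a \<otimes> c) \<otimes>\<^bsub>Q\<^esub> p = \<sigma> (a \<otimes> x)" using a(1) c cl by (simp add: Q.m_assoc)
    moreover have "\<sigma> (a \<otimes> c) \<otimes>\<^bsub>Q\<^esub> q = \<sigma> (b \<otimes> y)" unfolding a(3) using a d cl by (simp add: Q.m_assoc)
    moreover have "\<sigma> (a \<otimes> c) \<in> carrier Q" using a(1) cl(1) by simp
    ultimately have "\<sigma> (a \<otimes> c) \<otimes>\<^bsub>Q\<^esub> (p \<oplus>\<^bsub>Q\<^esub> q) = \<sigma> (a \<otimes> x \<oplus> b \<otimes> y)"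
      using a c d cl by (simp add: Q.r_distr del: h.hom_mult)
    then show ?thesis using extI[of "p \<oplus>\<^bsub>Q\<^esub> q" "a \<otimes> c" "a \<otimes> x \<oplus> b \<otimes> y" I] a c d
        left_ideal_add[OF I] left_ideal_mult[OF I] by simp
  qed
  show "p \<otimes>\<^bsub>Q\<^esub> q \<in> ext I" if "p \<in> carrier Q" "q \<in> ext I" for p q
  proof -
    obtain c x where c: "q \<in> carrier Q" "c \<in> C" "x \<in> I" "\<sigma> c \<otimes>\<^bsub>Q\<^esub> q = \<sigma> x"
      using \<open>q \<in> ext I\<close> by (auto simp: ext_def)
    have u: "\<sigma> c \<in> Units Q" "\<sigma> c \<in> carrier Q" using \<sigma>_unit c regular_closed by auto
    \<comment> \<open>Writing \<open>p\<close> times the inverse of \<open>\<sigma> c\<close> as one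
      left fraction moves the denominator of \<open>q\<close> past \<open>p\<close>.\<close>
    obtain d r where d: "d \<in> C" "r \<in> carrier R" "\<sigma> d \<otimes>\<^bsub>Q\<^esub> (p \<otimes>\<^bsub>Q\<^esub> inv\<^bsub>Q\<^esub> \<sigma> c) = \<sigma> r"
      using fraction_cases[of "p \<otimes>\<^bsub>Q\<^esub> inv\<^bsub>Q\<^esub> \<sigma> c"] u \<open>p \<in> carrier Q\<close> by (metis Q.m_closed Q.Units_inv_closed)
    have dc: "\<sigma> d \<in> carrier Q" using regular_closed[OF d(1)] by simp
    have "\<sigma> d \<otimes>\<^bsub>Q\<^esub> (p \<otimes>\<^bsub>Q\<^esub> q) = \<sigma> d \<otimes>\<^bsub>Q\<^esub> (p \<otimes>\<^bsub>Q\<^esub> inv\<^bsub>Q\<^esub> \<sigma> c) \<otimes>\<^bsub>Q\<^esub> (\<sigma> c \<otimes>\<^bsub>Q\<^esub> q)"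
    proof -
      have "inv\<^bsub>Q\<^esub> \<sigma> c \<otimes>\<^bsub>Q\<^esub> (\<sigma> c \<otimes>\<^bsub>Q\<^esub> q) = q" using u c(1) by (simp add: Q.m_assoc[symmetric])
      then show ?thesis using dc u \<open>p \<in> carrier Q\<close> c(1) by (simp add: Q.m_assoc)
    qed
    also have "\<dots> = \<sigma> (r \<otimes> x)" unfolding d(3) c(4) using d c Is by simp
    finally show ?thesis using extI[of "p \<otimes>\<^bsub>Q\<^esub> q" d "r \<otimes> x" I] d c left_ideal_mult[OF I] \<open>p \<in> carrier Q\<close> by simp
  qed
qed

lemma contr_left_ideal:
  assumes "left_ideal L Q" shows "left_ideal (contr L) R"
  by (rule left_idealI)
    (use Q.left_ideal_zero[OF assms] Q.left_ideal_add[OF assms] Q.left_ideal_mult[OF assms] in \<open>auto simp: contr_def\<close>)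

lemma unit_mult_mem:
  assumes L: "left_ideal L Q" and c: "c \<in> C" "q \<in> carrier Q" "\<sigma> c \<otimes>\<^bsub>Q\<^esub> q \<in> L"
  shows "q \<in> L"
proof -
  have u: "\<sigma> c \<in> Units Q" "\<sigma> c \<in> carrier Q" using \<sigma>_unit c regular_closed by auto
  have "inv\<^bsub>Q\<^esub> \<sigma> c \<otimes>\<^bsub>Q\<^esub> (\<sigma> c \<otimes>\<^bsub>Q\<^esub> q) \<in> L" using Q.left_ideal_mult[OF L] u c by simp
  then show ?thesis using u c by (simp add: Q.m_assoc[symmetric])
qed

lemma contr_saturated:
  assumes "left_ideal L Q" shows "saturated R (contr L)"
  using unit_mult_mem[OF assms] regular_closed by (auto simp: saturated_def contr_def)

lemma ext_contr:
  assumes L: "left_ideal L Q" shows "ext (contr L) = L"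
proof
  show "ext (contr L) \<subseteq> L" using unit_mult_mem[OF L] by (fastforce simp: ext_def contr_def)
  show "L \<subseteq> ext (contr L)"
  proof
    fix q assume q: "q \<in> L"
    then have qc: "q \<in> carrier Q" using Q.left_ideal_sub[OF L] by blast
    then obtain c r where c: "c \<in> C" "r \<in> carrier R" "\<sigma> c \<otimes>\<^bsub>Q\<^esub> q = \<sigma> r" using fraction_cases by metis
    then have "\<sigma> r \<in> L" using Q.left_ideal_mult[OF L _ q, of "\<sigma> c"] regular_closed[OF c(1)] by auto
    then show "q \<in> ext (contr L)" using extI[OF qc c(1) _ c(3)] c by (simp add: contr_def)
  qed
qed

text \<open>The right-hand side is the saturation of \<open>I\<close>. Injectivity of
  \<open>\<sigma>\<close> turns an equation between images into one in \<open>R\<close>.\<close>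

lemma contr_ext:
  assumes I: "left_ideal I R" shows "contr (ext I) = {x \<in> carrier R. \<exists>c\<in>C. c \<otimes> x \<in> I}"
proof -
  have "(\<exists>c\<in>C. \<exists>y\<in>I. \<sigma> c \<otimes>\<^bsub>Q\<^esub> \<sigma> x = \<sigma> y) \<longleftrightarrow> (\<exists>c\<in>C. c \<otimes> x \<in> I)" if x: "x \<in> carrier R" for x
  proof
    assume "\<exists>c\<in>C. \<exists>y\<in>I. \<sigma> c \<otimes>\<^bsub>Q\<^esub> \<sigma> x = \<sigma> y"
    then obtain c y where c: "c \<in> C" "y \<in> I" "\<sigma> c \<otimes>\<^bsub>Q\<^esub> \<sigma> x = \<sigma> y" by blast
    then have "c \<otimes> x = y" using \<sigma>_inj[of "c \<otimes> x" y] x regular_closed left_ideal_sub[OF I] by simp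
    then show "\<exists>c\<in>C. c \<otimes> x \<in> I" using c by blast
  next
    assume "\<exists>c\<in>C. c \<otimes> x \<in> I"
    then obtain c where c: "c \<in> C" "c \<otimes> x \<in> I" by blast
    then have "\<sigma> c \<otimes>\<^bsub>Q\<^esub> \<sigma> x = \<sigma> (c \<otimes> x)" using x regular_closed by simp
    then show "\<exists>c\<in>C. \<exists>y\<in>I. \<sigma> c \<otimes>\<^bsub>Q\<^esub> \<sigma> x = \<sigma> y" using c by blast
  qed
  then show ?thesis by (auto simp: contr_def ext_def)
qed

lemma contr_ext_saturated:
  assumes "left_ideal I R" "saturated R I" shows "contr (ext I) = I"
proof
  show "contr (ext I) \<subseteq> I" using contr_ext assms by (auto simp: saturated_def)
  show "I \<subseteq> contr (ext I)"
    using \<sigma>_in_ext[of I] left_ideal_sub[OF assms(1)] by (auto simp: contr_def)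
qed

text \<open>Extension and contraction are mutually inverse, inclusion-preserving maps between the
  left ideals of \<open>Q\<close> and the saturated left ideals of \<open>R\<close>.\<close>

lemma left_artinian_iff: "left_artinian Q \<longleftrightarrow> dcc_saturated R"
proof
  assume Q: "left_artinian Q"
  show "dcc_saturated R"
    unfolding dcc_saturated_def
  proof (intro allI impI)
    fix I :: "nat \<Rightarrow> 'a set"
    assume I: "(\<forall>k. left_ideal (I k) R \<and> saturated R (I k)) \<and> (\<forall>k. I (Suc k) \<subseteq> I k)"
    then have "(\<forall>k. left_ideal (ext (I k)) Q) \<and> (\<forall>k. ext (I (Suc k)) \<subseteq> ext (I k))"
      using ext_left_ideal by (fastforce simp: ext_def)
    then obtain n where "\<forall>k\<ge>n. ext (I k) = ext (I n)" using Q[unfolded left_artinian_def, rule_format, of "\<lambda>k. ext (I k)"] by auto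
    then have "\<forall>k\<ge>n. I k = I n" using contr_ext_saturated I by metis
    then show "\<exists>n. \<forall>k\<ge>n. I k = I n" by blast
  qed
next
  assume R: "dcc_saturated R"
  show "left_artinian Q"
    unfolding left_artinian_def
  proof (intro allI impI)
    fix L :: "nat \<Rightarrow> 'q set"
    assume L: "(\<forall>k. left_ideal (L k) Q) \<and> (\<forall>k. L (Suc k) \<subseteq> L k)"
    then have "(\<forall>k. left_ideal (contr (L k)) R \<and> saturated R (contr (L k))) \<and> (\<forall>k. contr (L (Suc k)) \<subseteq> contr (L k))"
      using contr_left_ideal contr_saturated by (fastforce simp: contr_def)
    then obtain n where "\<forall>k\<ge>n. contr (L k) = contr (L n)"
      using R[unfolded dcc_saturated_def, rule_format, of "\<lambda>k. contr (L k)"] by auto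
    then have "\<forall>k\<ge>n. L k = L n" using ext_contr L by metis
    then show "\<exists>n. \<forall>k\<ge>n. L k = L n" by blast
  qed
qed

end

text \<open>The graph of the comparison map between two left quotient rings. Its symmetry lets one
  uniqueness lemma serve both the well-definedness and the injectivity of that map.\<close>

definition same_fraction ::
  "[('a, 'm) ring_scheme, ('q, 'n) ring_scheme, 'a \<Rightarrow> 'q, ('p, 'k) ring_scheme, 'a \<Rightarrow> 'p, 'q, 'p] \<Rightarrow> bool" where
  "same_fraction R Q \<sigma> P \<tau> q p \<longleftrightarrow> (\<exists>c\<in>regular_elements R. \<exists>r\<in>carrier R.
     \<sigma> c \<otimes>\<^bsub>Q\<^esub> q = \<sigma> r \<and> \<tau> c \<otimes>\<^bsub>P\<^esub> p = \<tau> r)"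

lemma same_fraction_unique:
  assumes R: "ring R" and Q: "left_quotient_ring R Q \<sigma>" and P: "left_quotient_ring R P \<tau>"
    and q: "q \<in> carrier Q" "p \<in> carrier P" "p' \<in> carrier P"
    and 1: "same_fraction R Q \<sigma> P \<tau> q p" and 2: "same_fraction R Q \<sigma> P \<tau> q p'"
  shows "p = p'"
proof -
  interpret ring R by fact
  interpret Q: left_quotient R Q \<sigma> using Q by unfold_locales
  interpret P: left_quotient R P \<tau> using P by unfold_locales
  obtain c r where c: "c \<in> regular_elements R" "r \<in> carrier R" "\<sigma> c \<otimes>\<^bsub>Q\<^esub> q = \<sigma> r" "\<tau> c \<otimes>\<^bsub>P\<^esub> p = \<tau> r"
    using 1 by (auto simp: same_fraction_def)
  obtain d t where d: "d \<in> regular_elements R" "t \<in> carrier R" "\<sigma> d \<otimes>\<^bsub>Q\<^esub> q = \<sigma> t" "\<tau> d \<otimes>\<^bsub>P\<^esub> p' = \<tau> t"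
    using 2 by (auto simp: same_fraction_def)
  obtain a b where a: "a \<in> carrier R" "b \<in> carrier R" "a \<otimes>\<^bsub>R\<^esub> c = b \<otimes>\<^bsub>R\<^esub> d" "a \<otimes>\<^bsub>R\<^esub> c \<in> regular_elements R"
    using Q.o.common_multiple[OF c(1) d(1)] by blast
  note cl = regular_closed[OF c(1)] regular_closed[OF d(1)]
  have "\<sigma> (a \<otimes>\<^bsub>R\<^esub> r) = \<sigma> (a \<otimes>\<^bsub>R\<^esub> c) \<otimes>\<^bsub>Q\<^esub> q" using a(1,2) c q cl by (simp add: Q.Q.m_assoc)
  also have "\<dots> = \<sigma> (b \<otimes>\<^bsub>R\<^esub> t)" unfolding a(3) using a(1,2) d q cl by (simp add: Q.Q.m_assoc)
  finally have e: "a \<otimes>\<^bsub>R\<^esub> r = b \<otimes>\<^bsub>R\<^esub> t" using Q.\<sigma>_inj a c d by simp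
  have "\<tau> (a \<otimes>\<^bsub>R\<^esub> c) \<otimes>\<^bsub>P\<^esub> p = \<tau> (a \<otimes>\<^bsub>R\<^esub> r)" using a(1,2) c q cl by (simp add: P.Q.m_assoc)
  also have "\<dots> = \<tau> (b \<otimes>\<^bsub>R\<^esub> t)" unfolding e ..
  also have "\<dots> = \<tau> (a \<otimes>\<^bsub>R\<^esub> c) \<otimes>\<^bsub>P\<^esub> p'" unfolding a(3) using a(1,2) d q cl by (simp add: P.Q.m_assoc)
  finally show ?thesis using P.cancel[OF a(4)] q by blast
qed

text \<open>Sums and products are compared after clearing denominators in both rings at once. For
  products an Ore step moves the denominator of the right factor past the numerator of the left
  one.\<close>

theorem left_quotient_ring_unique:
  assumes R: "ring R" and Q: "left_quotient_ring R Q \<sigma>" and P: "left_quotient_ring R P \<tau>"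
  shows "\<exists>\<phi>\<in>ring_iso Q P. \<forall>c\<in>regular_elements R. \<forall>r\<in>carrier R.
    \<phi> (left_fraction Q \<sigma> c r) = left_fraction P \<tau> c r"
proof -
  interpret ring R by fact
  interpret Q: left_quotient R Q \<sigma> using Q by unfold_locales
  interpret P: left_quotient R P \<tau> using P by unfold_locales
  let ?s = "same_fraction R Q \<sigma> P \<tau>"
  have sym: "?s q p \<longleftrightarrow> same_fraction R P \<tau> Q \<sigma> p q" for q p by (auto simp: same_fraction_def)
  note uniq = same_fraction_unique[OF R Q P] same_fraction_unique[OF R P Q, folded sym]
  have lf: "?s (left_fraction Q \<sigma> c r) (left_fraction P \<tau> c r)"
    if "c \<in> regular_elements R" "r \<in> carrier R" for c r
    unfolding same_fraction_def using that Q.fraction_mult P.fraction_mult by blast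
  define \<phi> where "\<phi> q = (THE p. p \<in> carrier P \<and> ?s q p)" for q
  have \<phi>I: "\<phi> q = p" if "q \<in> carrier Q" "p \<in> carrier P" "?s q p" for q p
    unfolding \<phi>_def using that uniq(1) by (intro the_equality) auto
  have ex: "\<phi> q \<in> carrier P \<and> ?s q (\<phi> q)" if q: "q \<in> carrier Q" for q
  proof -
    obtain c r where c: "c \<in> regular_elements R" "r \<in> carrier R" "q = left_fraction Q \<sigma> c r"
      using Q.fraction_cases[OF q] by metis
    then show ?thesis using \<phi>I[OF q P.fraction_closed[OF c(1,2)]] lf P.fraction_closed by simp
  qed
  have add: "\<phi> (p \<oplus>\<^bsub>Q\<^esub> q) = \<phi> p \<oplus>\<^bsub>P\<^esub> \<phi> q" if pq: "p \<in> carrier Q" "q \<in> carrier Q" for p q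
  proof -
    obtain c r t where c: "c \<in> regular_elements R" "r \<in> carrier R" "t \<in> carrier R"
      "\<sigma> c \<otimes>\<^bsub>Q\<^esub> p = \<sigma> r" "\<sigma> c \<otimes>\<^bsub>Q\<^esub> q = \<sigma> t"
      using Q.common_denominator[OF pq] by blast
    have e: "p = left_fraction Q \<sigma> c r" "q = left_fraction Q \<sigma> c t" using Q.fraction_eqI c pq by auto
    have f: "\<phi> p = left_fraction P \<tau> c r" "\<phi> q = left_fraction P \<tau> c t"
      using \<phi>I pq P.fraction_closed c lf unfolding e by auto
    have cc: "c \<in> carrier R" using c regular_closed by blast
    have "\<sigma> c \<otimes>\<^bsub>Q\<^esub> (p \<oplus>\<^bsub>Q\<^esub> q) = \<sigma> (r \<oplus>\<^bsub>R\<^esub> t)" using c pq cc by (simp add: Q.Q.r_distr)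
    moreover have "\<tau> c \<otimes>\<^bsub>P\<^esub> (\<phi> p \<oplus>\<^bsub>P\<^esub> \<phi> q) = \<tau> (r \<oplus>\<^bsub>R\<^esub> t)"
      unfolding f using c cc P.fraction_closed P.fraction_mult by (simp add: P.Q.r_distr)
    moreover have "r \<oplus>\<^bsub>R\<^esub> t \<in> carrier R" using c by simp
    ultimately have "?s (p \<oplus>\<^bsub>Q\<^esub> q) (\<phi> p \<oplus>\<^bsub>P\<^esub> \<phi> q)"
      unfolding same_fraction_def using c(1) by blast
    moreover have "\<phi> p \<oplus>\<^bsub>P\<^esub> \<phi> q \<in> carrier P" using ex pq by simp
    ultimately show ?thesis using \<phi>I[OF Q.Q.a_closed[OF pq]] by blast
  qed
  have mult: "\<phi> (p \<otimes>\<^bsub>Q\<^esub> q) = \<phi> p \<otimes>\<^bsub>P\<^esub> \<phi> q" if pq: "p \<in> carrier Q" "q \<in> carrier Q" for p q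
  proof -
    obtain c r where c: "c \<in> regular_elements R" "r \<in> carrier R" "\<sigma> c \<otimes>\<^bsub>Q\<^esub> p = \<sigma> r" "\<tau> c \<otimes>\<^bsub>P\<^esub> \<phi> p = \<tau> r"
      using ex[OF pq(1)] by (auto simp: same_fraction_def)
    obtain d t where d: "d \<in> regular_elements R" "t \<in> carrier R" "\<sigma> d \<otimes>\<^bsub>Q\<^esub> q = \<sigma> t" "\<tau> d \<otimes>\<^bsub>P\<^esub> \<phi> q = \<tau> t"
      using ex[OF pq(2)] by (auto simp: same_fraction_def)
    obtain d' r' where d': "d' \<in> regular_elements R" "r' \<in> carrier R" "d' \<otimes>\<^bsub>R\<^esub> r = r' \<otimes>\<^bsub>R\<^esub> d"
      using Q.o.ore[OF d(1) c(2)] by blast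
    note cl = regular_closed[OF c(1)] regular_closed[OF d(1)] regular_closed[OF d'(1)]
    have "\<sigma> (d' \<otimes>\<^bsub>R\<^esub> c) \<otimes>\<^bsub>Q\<^esub> (p \<otimes>\<^bsub>Q\<^esub> q) = \<sigma> d' \<otimes>\<^bsub>Q\<^esub> (\<sigma> c \<otimes>\<^bsub>Q\<^esub> p) \<otimes>\<^bsub>Q\<^esub> q"
      using cl pq by (simp add: Q.Q.m_assoc)
    also have "\<dots> = \<sigma> (d' \<otimes>\<^bsub>R\<^esub> r) \<otimes>\<^bsub>Q\<^esub> q" unfolding c(3) using cl c by simp
    also have "\<dots> = \<sigma> r' \<otimes>\<^bsub>Q\<^esub> (\<sigma> d \<otimes>\<^bsub>Q\<^esub> q)" unfolding d'(3) using cl d' pq by (simp add: Q.Q.m_assoc)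
    also have "\<dots> = \<sigma> (r' \<otimes>\<^bsub>R\<^esub> t)" unfolding d(3) using d' d by simp
    finally have 1: "\<sigma> (d' \<otimes>\<^bsub>R\<^esub> c) \<otimes>\<^bsub>Q\<^esub> (p \<otimes>\<^bsub>Q\<^esub> q) = \<sigma> (r' \<otimes>\<^bsub>R\<^esub> t)" .
    note pq' = ex[OF pq(1), THEN conjunct1] ex[OF pq(2), THEN conjunct1]
    have "\<tau> (d' \<otimes>\<^bsub>R\<^esub> c) \<otimes>\<^bsub>P\<^esub> (\<phi> p \<otimes>\<^bsub>P\<^esub> \<phi> q) = \<tau> d' \<otimes>\<^bsub>P\<^esub> (\<tau> c \<otimes>\<^bsub>P\<^esub> \<phi> p) \<otimes>\<^bsub>P\<^esub> \<phi> q"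
      using cl pq' by (simp add: P.Q.m_assoc)
    also have "\<dots> = \<tau> (d' \<otimes>\<^bsub>R\<^esub> r) \<otimes>\<^bsub>P\<^esub> \<phi> q" unfolding c(4) using cl c by simp
    also have "\<dots> = \<tau> r' \<otimes>\<^bsub>P\<^esub> (\<tau> d \<otimes>\<^bsub>P\<^esub> \<phi> q)" unfolding d'(3) using cl d' pq' by (simp add: P.Q.m_assoc)
    also have "\<dots> = \<tau> (r' \<otimes>\<^bsub>R\<^esub> t)" unfolding d(4) using d' d by simp
    finally have 2: "\<tau> (d' \<otimes>\<^bsub>R\<^esub> c) \<otimes>\<^bsub>P\<^esub> (\<phi> p \<otimes>\<^bsub>P\<^esub> \<phi> q) = \<tau> (r' \<otimes>\<^bsub>R\<^esub> t)" .
    have "d' \<otimes>\<^bsub>R\<^esub> c \<in> regular_elements R" "r' \<otimes>\<^bsub>R\<^esub> t \<in> carrier R" using regular_mult c d d' by auto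
    then have "?s (p \<otimes>\<^bsub>Q\<^esub> q) (\<phi> p \<otimes>\<^bsub>P\<^esub> \<phi> q)" using 1 2 unfolding same_fraction_def by blast
    then show ?thesis by (rule \<phi>I[OF Q.Q.m_closed[OF pq] P.Q.m_closed[OF pq']])
  qed
  have "\<phi> \<in> ring_hom Q P"
  proof (rule ring_hom_memI)
    have "\<sigma> \<one>\<^bsub>R\<^esub> \<otimes>\<^bsub>Q\<^esub> \<one>\<^bsub>Q\<^esub> = \<sigma> \<one>\<^bsub>R\<^esub>" "\<tau> \<one>\<^bsub>R\<^esub> \<otimes>\<^bsub>P\<^esub> \<one>\<^bsub>P\<^esub> = \<tau> \<one>\<^bsub>R\<^esub>" by simp_all
    then have "?s \<one>\<^bsub>Q\<^esub> \<one>\<^bsub>P\<^esub>" unfolding same_fraction_def using regular_one one_closed by blast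
    then show "\<phi> \<one>\<^bsub>Q\<^esub> = \<one>\<^bsub>P\<^esub>" using \<phi>I by simp
  qed (use ex add mult in auto)
  moreover have "bij_betw \<phi> (carrier Q) (carrier P)"
  proof (rule bij_betwI')
    show "\<phi> x = \<phi> y \<longleftrightarrow> x = y" if "x \<in> carrier Q" "y \<in> carrier Q" for x y
      using uniq(2)[of "\<phi> x" x y] ex[of x] ex[of y] that by metis
    show "\<phi> x \<in> carrier P" if "x \<in> carrier Q" for x using ex that by blast
    show "\<exists>x\<in>carrier Q. y = \<phi> x" if y: "y \<in> carrier P" for y
    proof -
      obtain c r where c: "c \<in> regular_elements R" "r \<in> carrier R" "y = left_fraction P \<tau> c r"
        using P.fraction_cases[OF y] by metis
      then show ?thesis using \<phi>I[OF Q.fraction_closed[OF c(1,2)] y] lf[OF c(1,2)] Q.fraction_closed by metis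
    qed
  qed
  moreover have "\<phi> (left_fraction Q \<sigma> c r) = left_fraction P \<tau> c r"
    if "c \<in> regular_elements R" "r \<in> carrier R" for c r
    by (rule \<phi>I[OF Q.fraction_closed[OF that] P.fraction_closed[OF that] lf[OF that]])
  ultimately show ?thesis unfolding ring_iso_def by blast
qed

section \<open>Left Artinian rings\<close>

context ring
begin

text \<open>Iterating the equation replaces \<open>k\<close> by its powers. The lemma stands for the
  invertibility of \<open>\<one> \<ominus> k\<close> for nilpotent \<open>k\<close>.\<close>

lemma nil_fixed_zero:
  assumes k: "k \<in> carrier R" "k [^] (n::nat) = \<zero>" and z: "z \<in> carrier R" "z = k \<otimes> z \<or> z = z \<otimes> k"
  shows "z = \<zero>"
proof -
  have "z = k [^] j \<otimes> z \<or> z = z \<otimes> k [^] j" for j :: nat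
    using z(2)
  proof
    assume kz: "z = k \<otimes> z"
    have "z = k [^] j \<otimes> z"
    proof (induction j)
      case (Suc j)
      have "k [^] Suc j \<otimes> z = k [^] j \<otimes> (k \<otimes> z)" using k(1) z(1) by (simp add: m_assoc)
      then show ?case using Suc kz by simp
    qed (use z in simp)
    then show ?thesis by blast
  next
    assume kz: "z = z \<otimes> k"
    have "z = z \<otimes> k [^] j"
    proof (induction j)
      case (Suc j)
      have "z \<otimes> k [^] Suc j = z \<otimes> k [^] j \<otimes> k" using k(1) z(1) by (simp add: m_assoc)
      then show ?case using Suc kz by simp
    qed (use z in simp)
    then show ?thesis by blast
  qed
  from this[of n] show ?thesis using k z by auto
qed

lemma left_artinianD:
  assumes "left_artinian R" "\<And>k. left_ideal (I k) R" "\<And>k. I (Suc k) \<subseteq> I k"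
  obtains n where "\<And>k. n \<le> k \<Longrightarrow> I k = I n"
  using assms unfolding left_artinian_def by blast

text \<open>If the powers of the radical \<open>K\<close> stabilise at a nonzero
  \<open>A = A K\<close>, there are elements \<open>z j\<close> not killed by \<open>A\<close> such
  that \<open>z (Suc j)\<close> is a multiple of \<open>z j\<close> by an element of
  \<open>K\<close>. The cyclic left ideals \<open>R (z j)\<close> stabilise, so some
  \<open>z j\<close> is fixed by an element of the nil ideal \<open>K\<close> and must
  vanish.\<close>

lemma left_artinian_imp_prime_radical_nilpotent:
  assumes art: "left_artinian R"
  shows "nilpotent_ideal (prime_radical R) R"
proof -
  define K where "K = prime_radical R"
  have K: "ideal K R" unfolding K_def by (rule prime_radical_ideal)
  have li: "left_ideal (ideal_power R K k) R" "ideal_power R K (Suc k) \<subseteq> ideal_power R K k" for k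
    using ideal_left_ideal[OF ideal_power_ideal[OF K]] ideal_power_decreasing[OF K, of k "Suc k"] by auto
  obtain n where n: "\<And>k. n \<le> k \<Longrightarrow> ideal_power R K k = ideal_power R K n"
    using left_artinianD[of "ideal_power R K", OF art li] by blast
  define A where "A = ideal_power R K n"
  have AK: "A = A \<cdot> K" using n[of "Suc n"] by (simp add: A_def)
  have A: "ideal A R" unfolding A_def by (rule ideal_power_ideal[OF K])
  \<comment> \<open>Since \<open>A = A K\<close>, an element of \<open>A\<close> that does not kill
    \<open>z\<close> is a sum of products from \<open>A\<close> and \<open>K\<close>, and one of
    these products does not kill \<open>z\<close> either.\<close>
  have step: "\<exists>k\<in>K. \<exists>a\<in>A. a \<otimes> (k \<otimes> z) \<noteq> \<zero>"
    if z: "z \<in> carrier R" and az: "a \<in> A" "a \<otimes> z \<noteq> \<zero>" for z a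
  proof (rule ccontr)
    assume neg: "\<not> (\<exists>k\<in>K. \<exists>a\<in>A. a \<otimes> (k \<otimes> z) \<noteq> \<zero>)"
    have "b \<in> carrier R \<and> b \<otimes> z = \<zero>" if "b \<in> A \<cdot> K" for b
      using that
    proof (induction rule: ideal_prod.induct)
      case (prod i j)
      then show ?case using neg z ideal_closed[OF A] ideal_closed[OF K] by (simp add: m_assoc)
    next
      case (sum b c)
      then show ?case using z by (simp add: l_distr)
    qed
    then show False using az AK by blast
  qed
  have "A = {\<zero>}"
  proof (rule ccontr)
    assume "A \<noteq> {\<zero>}"
    then obtain a where a: "a \<in> A" "a \<noteq> \<zero>" using left_ideal_zero[OF ideal_left_ideal[OF A]] by blast
    have 1: "\<exists>z. z \<in> carrier R \<and> (\<exists>a\<in>A. a \<otimes> z \<noteq> \<zero>)"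
      by (intro exI[of _ \<one>]) (use a ideal_closed[OF A] in auto)
    have 2: "\<exists>z'. (z' \<in> carrier R \<and> (\<exists>a\<in>A. a \<otimes> z' \<noteq> \<zero>)) \<and> (\<exists>k\<in>K. z' = k \<otimes> z)"
      if h: "z \<in> carrier R \<and> (\<exists>a\<in>A. a \<otimes> z \<noteq> \<zero>)" for z
    proof -
      obtain a where "a \<in> A" "a \<otimes> z \<noteq> \<zero>" using h by blast
      then obtain k b where "k \<in> K" "b \<in> A" "b \<otimes> (k \<otimes> z) \<noteq> \<zero>" using step h by blast
      then show ?thesis using h ideal_closed[OF K] by (intro exI[of _ "k \<otimes> z"]) auto
    qed
    obtain z where z: "\<And>j::nat. z j \<in> carrier R" "\<And>j. \<exists>a\<in>A. a \<otimes> z j \<noteq> \<zero>" "\<And>j. \<exists>k\<in>K. z (Suc j) = k \<otimes> z j"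
      using dependent_nat_choice[of "\<lambda>_ z. z \<in> carrier R \<and> (\<exists>a\<in>A. a \<otimes> z \<noteq> \<zero>)" "\<lambda>_ z z'. \<exists>k\<in>K. z' = k \<otimes> z"]
        1 2 by blast
    define L where "L j = (\<lambda>r. r \<otimes> z j) ` carrier R" for j
    have Ll: "left_ideal (L j) R" for j unfolding L_def by (rule left_ideal_right_multiples[OF left_ideal_carrier z(1)])
    have Ld: "L (Suc j) \<subseteq> L j" for j
      unfolding L_def
    proof -
      obtain k where k: "k \<in> K" "z (Suc j) = k \<otimes> z j" using z(3) by blast
      have "r \<otimes> z (Suc j) = (r \<otimes> k) \<otimes> z j" if "r \<in> carrier R" for r
        using that k ideal_closed[OF K] z(1) by (simp add: m_assoc)
      then show "(\<lambda>r. r \<otimes> z (Suc j)) ` carrier R \<subseteq> (\<lambda>r. r \<otimes> z j) ` carrier R"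
        using ideal_closed[OF K k(1)] by auto
    qed
    obtain j where j: "\<And>k. j \<le> k \<Longrightarrow> L k = L j"
      using left_artinianD[of L, OF art Ll Ld] by blast
    have "z j \<in> L j" unfolding L_def by (rule image_eqI[of _ _ \<one>]) (use z(1) in auto)
    then have "z j \<in> L (Suc j)" using j[of "Suc j"] by simp
    then obtain q where q: "q \<in> carrier R" "z j = q \<otimes> z (Suc j)" unfolding L_def by blast
    obtain k where k: "k \<in> K" "z (Suc j) = k \<otimes> z j" using z(3) by blast
    have qk: "q \<otimes> k \<in> K" "q \<otimes> k \<in> carrier R" using ideal_mult_closed[OF K k(1) q(1)] ideal_closed[OF K] by auto
    have "z j = (q \<otimes> k) \<otimes> z j" using q k z(1)[of j] ideal_closed[OF K k(1)] by (metis m_assoc)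
    moreover obtain m :: nat where "(q \<otimes> k) [^] m = \<zero>" using prime_radical_nil qk unfolding K_def by blast
    ultimately have "z j = \<zero>" using nil_fixed_zero qk z(1) by blast
    then show False using z(2)[of j] ideal_closed[OF A] by auto
  qed
  then show ?thesis using K unfolding nilpotent_ideal_def K_def A_def by blast
qed

text \<open>Descending-chain counterpart of \<open>exists_square_stable\<close>. Without such an
  \<open>a\<close>, every nonzero left ideal \<open>J\<close> inside \<open>L\<close> would contain
  the nonzero left ideal of its elements annihilating a suitable \<open>a = r \<otimes> j\<close>.
  The choice \<open>j \<otimes> a \<noteq> \<zero>\<close> makes that inclusion strict, and the
  chain never stops.\<close>

lemma semiprime_artinian_square_stable:
  assumes sp: "semiprime_ring R" and art: "left_artinian R" and L: "left_ideal L R" "x \<in> L" "x \<noteq> \<zero>"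
  shows "\<exists>a\<in>L. a \<noteq> \<zero> \<and> (\<forall>r\<in>carrier R. r \<otimes> a \<otimes> a = \<zero> \<longrightarrow> r \<otimes> a = \<zero>)"
proof (rule ccontr)
  assume neg: "\<not> ?thesis"
  define P where "P J \<longleftrightarrow> left_ideal J R \<and> J \<subseteq> L \<and> J \<noteq> {\<zero>}" for J
  have step: "\<exists>J'. P J' \<and> J' \<subset> J" if J: "P J" for J
  proof -
    have Jl: "left_ideal J R" and JL: "J \<subseteq> L" using J by (auto simp: P_def)
    obtain j where j: "j \<in> J" "j \<noteq> \<zero>" using J left_ideal_zero by (auto simp: P_def)
    have jc: "j \<in> carrier R" using left_ideal_sub[OF Jl j(1)] .
    obtain r where r: "r \<in> carrier R" "j \<otimes> r \<otimes> j \<noteq> \<zero>" using sp jc j(2) by (auto simp: semiprime_ring_def)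
    define a where "a = r \<otimes> j"
    have a: "a \<in> J" "a \<in> carrier R" using r j jc left_ideal_mult[OF Jl] by (auto simp: a_def)
    have ja: "j \<otimes> a \<noteq> \<zero>" using r jc by (simp add: a_def m_assoc)
    define J' where "J' = J \<inter> {s \<in> carrier R. s \<otimes> a = \<zero>}"
    have J'l: "left_ideal J' R" unfolding J'_def by (rule left_ideal_inter[OF Jl left_ideal_annihilator_elt[OF a(2)]])
    have "J' \<noteq> {\<zero>}"
    proof
      assume J'0: "J' = {\<zero>}"
      have "s \<otimes> a = \<zero>" if s: "s \<in> carrier R" "s \<otimes> a \<otimes> a = \<zero>" for s
      proof -
        have "s \<otimes> a \<in> J'" using s a left_ideal_mult[OF Jl s(1) a(1)] by (simp add: J'_def)
        then show ?thesis using J'0 by simp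
      qed
      moreover have "a \<noteq> \<zero>" using ja jc by auto
      ultimately show False using neg a JL by blast
    qed
    moreover have "J' \<subset> J" using j ja by (auto simp: J'_def)
    ultimately show ?thesis using J'l JL unfolding P_def by blast
  qed
  have "P L" using L by (auto simp: P_def)
  then have "\<exists>f. \<forall>n. P (f n) \<and> f (Suc n) \<subset> f n"
    using dependent_nat_choice[of "\<lambda>_. P" "\<lambda>_ J J'. J' \<subset> J"] step by blast
  then obtain f where f: "\<And>n::nat. P (f n)" "\<And>n. f (Suc n) \<subset> f n" by blast
  obtain n where n: "\<And>k. n \<le> k \<Longrightarrow> f k = f n"
    using left_artinianD[OF art, of f] f unfolding P_def by blast
  have "f (Suc n) = f n" by (rule n) simp
  then show False using f(2)[of n] by blast
qed

lemma presented_regular: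
  "presented_module R R (left_regular_module R) (\<lambda>x. x) (\<lambda>x. x) (carrier R) {\<zero>}"
  by unfold_locales (auto simp: left_ideal_carrier left_regular_module_def)

text \<open>Once the \<open>D k\<close> are constant, \<open>x n\<close> itself lies in
  \<open>D (Suc n)\<close>, and the flag condition for the multiplier \<open>\<one>\<close> puts it
  into \<open>T\<close>.\<close>

lemma left_artinian_no_flag:
  assumes "left_artinian R" shows "\<nexists>D x. descending_flag R I T D x"
proof
  assume "\<exists>D x. descending_flag R I T D x"
  then obtain D x where f: "descending_flag R I T D x" by blast
  then obtain n where n: "\<And>k. n \<le> k \<Longrightarrow> D k = D n"
    using left_artinianD[OF assms, of D] unfolding descending_flag_def by blast
  have "x n \<in> D n" and xT: "x n \<notin> T" and xc: "x n \<in> carrier R"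
    using f left_ideal_sub unfolding descending_flag_def by blast+
  then have "\<one> \<otimes> x n \<in> D (Suc n)" using n[of "Suc n"] by simp
  then have "\<one> \<otimes> x n \<in> T" using f unfolding descending_flag_def by blast
  then show False using xT xc by simp
qed

text \<open>A strictly ascending chain of annihilators is turned into an infinite direct sum: each
  step contains a nonzero \<open>z\<close> whose left multiples meet the previous annihilator only
  in zero. This bypasses the Noetherian property.\<close>

theorem semiprime_left_artinian_imp_left_goldie:
  assumes sp: "semiprime_ring R" and art: "left_artinian R"
  shows "left_goldie R"
  unfolding left_goldie_def
proof
  interpret M: presented_module R R "left_regular_module R" "\<lambda>x. x" "\<lambda>x. x" "carrier R" "{\<zero>}"
    by (rule presented_regular)
  show nids: "no_infinite_direct_sums R (left_regular_module R)"
    using M.direct_sum_imp_flag left_artinian_no_flag[OF art] by blast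
  show "acc_left_annihilators R"
    unfolding acc_left_annihilators_def
  proof (intro allI impI, rule ccontr)
    fix A :: "nat \<Rightarrow> 'a set"
    assume A: "(\<forall>k. \<exists>X\<subseteq>carrier R. A k = left_annihilator R X) \<and> (\<forall>k. A k \<subseteq> A (Suc k))"
      and ns: "\<not> (\<exists>n. \<forall>k\<ge>n. A k = A n)"
    \<comment> \<open>Complements turn the ascending chain into a descending one, to which
      \<open>strict_subchain\<close> applies.\<close>
    have "- A (Suc k) \<subseteq> - A k" for k using A by blast
    moreover have "\<not> (\<exists>n. \<forall>k\<ge>n. - A k = - A n)" using ns by simp
    ultimately obtain g where "strict_mono g" and g': "\<And>k. - A (g (Suc k)) \<subset> - A (g k)"
      using strict_subchain[of "\<lambda>k. - A k"] by blast
    have g: "A (g k) \<subset> A (g (Suc k))" for k using g'[of k] by blast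
    obtain X where X: "\<And>k. X k \<subseteq> carrier R" "\<And>k. A k = left_annihilator R (X k)" using A by metis
    have Al: "left_ideal (A k) R" for k
      unfolding X(2) left_annihilator_def
      by (rule left_idealI) (use X(1)[of k] in \<open>auto simp: l_distr m_assoc subset_iff\<close>)
    have "\<exists>z. z \<in> A (g (Suc k)) \<and> z \<noteq> \<zero> \<and> (\<forall>r\<in>carrier R. r \<otimes> z \<in> A (g k) \<longrightarrow> r \<otimes> z = \<zero>)" for k
    proof -
      obtain y where y: "y \<in> A (g (Suc k))" "y \<notin> A (g k)" using g by blast
      have yc: "y \<in> carrier R" using left_ideal_sub[OF Al y(1)] .
      obtain x where x: "x \<in> X (g k)" "y \<otimes> x \<noteq> \<zero>" using y(2) yc unfolding X(2) left_annihilator_def by blast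
      have xc: "x \<in> carrier R" using x X(1) by blast
      have "y \<otimes> x \<in> (\<lambda>r. r \<otimes> (y \<otimes> x)) ` carrier R" by (rule image_eqI[of _ _ \<one>]) (use yc xc in auto)
      then obtain a where a: "a \<in> (\<lambda>r. r \<otimes> (y \<otimes> x)) ` carrier R" "a \<noteq> \<zero>"
        "\<And>r. r \<in> carrier R \<Longrightarrow> r \<otimes> a \<otimes> a = \<zero> \<Longrightarrow> r \<otimes> a = \<zero>"
        using semiprime_artinian_square_stable[OF sp art left_ideal_right_multiples[OF left_ideal_carrier, of "y \<otimes> x"]] x yc xc
        by (metis m_closed)
      then obtain d where d: "d \<in> carrier R" "a = d \<otimes> (y \<otimes> x)" by blast
      have ac: "a \<in> carrier R" using d yc xc by simp
      \<comment> \<open>\<open>z x = a\<^sup>2\<close>, so \<open>r z\<close> annihilates \<open>X (g k)\<close> only if \<open>r a = \<zero>\<close>, that is, only if \<open>r z = \<zero>\<close>.\<close>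
      define z where "z = a \<otimes> d \<otimes> y"
      have zx: "r \<otimes> z \<otimes> x = r \<otimes> a \<otimes> a" if "r \<in> carrier R" for r
      proof -
        have "r \<otimes> z \<otimes> x = r \<otimes> a \<otimes> (d \<otimes> (y \<otimes> x))" using that ac d(1) yc xc by (simp add: z_def m_assoc)
        then show ?thesis unfolding d(2)[symmetric] .
      qed
      have "z \<in> A (g (Suc k))" using left_ideal_mult[OF Al _ y(1)] ac d(1) by (simp add: z_def)
      moreover have "z \<noteq> \<zero>"
      proof
        assume "z = \<zero>"
        then have "\<one> \<otimes> a \<otimes> a = \<zero>" using zx[of \<one>] xc by simp
        then show False using a(2) a(3)[of \<one>] ac by simp
      qed
      moreover have "r \<otimes> z = \<zero>" if r: "r \<in> carrier R" "r \<otimes> z \<in> A (g k)" for r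
      proof -
        have "r \<otimes> z \<otimes> x = \<zero>" using r(2) x(1) unfolding X(2) left_annihilator_def by blast
        then have "r \<otimes> a = \<zero>" using zx[OF r(1)] a(3) r by simp
        moreover have "r \<otimes> z = r \<otimes> a \<otimes> d \<otimes> y" using r ac d(1) yc by (simp add: z_def m_assoc)
        ultimately show ?thesis using d(1) yc by simp
      qed
      ultimately show ?thesis by blast
    qed
    then obtain z where z: "\<And>k. z k \<in> A (g (Suc k))" "\<And>k. z k \<noteq> \<zero>"
      "\<And>k r. r \<in> carrier R \<Longrightarrow> r \<otimes> z k \<in> A (g k) \<Longrightarrow> r \<otimes> z k = \<zero>" by metis
    have "\<not> no_infinite_direct_sums R (left_regular_module R)"
      by (rule M.ascending_flag_imp_direct_sum[of "\<lambda>k. A (g k)" z])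
        (use Al z g[THEN psubset_imp_subset] left_ideal_zero[OF Al] left_ideal_sub[OF Al z(1)] in \<open>simp_all\<close>)
    then show False using nids by blast
  qed
qed

end

text \<open>Left annihilators in \<open>R\<close> are contractions of left annihilators in
  \<open>Q\<close>, and a flag in \<open>R\<close> extends to a flag in \<open>Q\<close>.\<close>

lemma (in left_quotient) left_goldie_descends:
  assumes g: "left_goldie Q"
  shows "left_goldie R"
  unfolding left_goldie_def
proof
  interpret M: presented_module R R "left_regular_module R" "\<lambda>x. x" "\<lambda>x. x" "carrier R" "{\<zero>}"
    by (rule presented_regular)
  interpret MQ: presented_module Q Q "left_regular_module Q" "\<lambda>x. x" "\<lambda>x. x" "carrier Q" "{\<zero>\<^bsub>Q\<^esub>}"
    by (rule Q.presented_regular)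
  show "acc_left_annihilators R"
    unfolding acc_left_annihilators_def
  proof (intro allI impI)
    fix A :: "nat \<Rightarrow> 'a set"
    assume A: "(\<forall>k. \<exists>X\<subseteq>carrier R. A k = left_annihilator R X) \<and> (\<forall>k. A k \<subseteq> A (Suc k))"
    then obtain X where X: "\<And>k. X k \<subseteq> carrier R" "\<And>k. A k = left_annihilator R (X k)" by metis
    \<comment> \<open>The sets \<open>X k\<close> may fail to be nested. The right annihilators
      \<open>Y k\<close> of the \<open>A k\<close> decrease and still have \<open>A k\<close> as
      left annihilator, so the \<open>B k\<close> form an ascending chain in
      \<open>Q\<close>.\<close>
    define Y where "Y k = {x \<in> carrier R. \<forall>r\<in>A k. r \<otimes> x = \<zero>}" for k
    define B where "B k = left_annihilator Q (\<sigma> ` Y k)" for k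
    have AB: "A k = {r \<in> carrier R. \<sigma> r \<in> B k}" for k
    proof
      show "A k \<subseteq> {r \<in> carrier R. \<sigma> r \<in> B k}"
      proof
        fix r assume r: "r \<in> A k"
        then have rc: "r \<in> carrier R" unfolding X(2) left_annihilator_def by blast
        have "\<sigma> r \<otimes>\<^bsub>Q\<^esub> \<sigma> y = \<zero>\<^bsub>Q\<^esub>" if "y \<in> Y k" for y
        proof -
          have y: "y \<in> carrier R" "r \<otimes> y = \<zero>" using that r by (auto simp: Y_def)
          then show ?thesis using h.hom_mult[OF rc y(1)] by simp
        qed
        then show "r \<in> {r \<in> carrier R. \<sigma> r \<in> B k}" using rc by (auto simp: B_def left_annihilator_def)
      qed
      show "{r \<in> carrier R. \<sigma> r \<in> B k} \<subseteq> A k"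
      proof
        fix r assume "r \<in> {r \<in> carrier R. \<sigma> r \<in> B k}"
        then have r: "r \<in> carrier R" "\<And>y. y \<in> Y k \<Longrightarrow> \<sigma> r \<otimes>\<^bsub>Q\<^esub> \<sigma> y = \<zero>\<^bsub>Q\<^esub>"
          by (auto simp: B_def left_annihilator_def)
        have "r \<otimes> x = \<zero>" if x: "x \<in> X k" for x
        proof -
          have xc: "x \<in> carrier R" using x X(1) by blast
          moreover have "x \<in> Y k" using x xc unfolding Y_def X(2) left_annihilator_def by blast
          ultimately show ?thesis using r \<sigma>_eq_zero[of "r \<otimes> x"] by simp
        qed
        then show "r \<in> A k" unfolding X(2) left_annihilator_def using r by blast
      qed
    qed
    have "\<exists>n. \<forall>k\<ge>n. B k = B n"
    proof (rule conjunct1[OF g[unfolded left_goldie_def], unfolded acc_left_annihilators_def, rule_format], intro conjI allI)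
      show "\<exists>X\<subseteq>carrier Q. B k = left_annihilator Q X" for k unfolding B_def
        by (rule exI[of _ "\<sigma> ` Y k"]) (auto simp: Y_def)
      show "B k \<subseteq> B (Suc k)" for k using A by (fastforce simp: B_def Y_def left_annihilator_def)
    qed
    then obtain n where "\<forall>k\<ge>n. B k = B n" by blast
    then have "A k = A n" if "n \<le> k" for k unfolding AB[of k] AB[of n] using that by metis
    then show "\<exists>n. \<forall>k\<ge>n. A k = A n" by blast
  qed
  have "\<not> descending_flag R (carrier R) {\<zero>} D x" for D x
  proof
    assume f: "descending_flag R (carrier R) {\<zero>} D x"
    then have D: "left_ideal (D k) R" "D (Suc k) \<subseteq> D k" "x k \<in> D k" "x k \<noteq> \<zero>"
      and xT: "r \<in> carrier R \<Longrightarrow> r \<otimes> x k \<in> D (Suc k) \<Longrightarrow> r \<otimes> x k = \<zero>" for k r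
      by (auto simp: descending_flag_def)
    have xc: "x k \<in> carrier R" for k using left_ideal_sub[OF D(1) D(3)] .
    have "descending_flag Q (carrier Q) {\<zero>\<^bsub>Q\<^esub>} (\<lambda>k. ext (D k)) (\<lambda>k. \<sigma> (x k))"
    proof (rule descending_flagI)
      show E: "left_ideal (ext (D k)) Q" for k by (rule ext_left_ideal[OF D(1)])
      show "{\<zero>\<^bsub>Q\<^esub>} \<subseteq> ext (D k)" for k using Q.left_ideal_zero[OF E] by simp
      show "ext (D (Suc k)) \<subseteq> ext (D k)" for k using D(2) by (auto simp: ext_def)
      show "\<sigma> (x k) \<in> ext (D k)" for k using \<sigma>_in_ext[OF _ D(3)] left_ideal_sub[OF D(1)] by blast
      show "\<sigma> (x k) \<notin> {\<zero>\<^bsub>Q\<^esub>}" for k using \<sigma>_eq_zero[OF xc] D(4) by simp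
      fix k q assume q: "q \<in> carrier Q" "q \<otimes>\<^bsub>Q\<^esub> \<sigma> (x k) \<in> ext (D (Suc k))"
      obtain c r where c: "c \<in> C" "r \<in> carrier R" "\<sigma> c \<otimes>\<^bsub>Q\<^esub> q = \<sigma> r" using fraction_cases[OF q(1)] by metis
      have cc: "\<sigma> c \<in> carrier Q" using regular_closed[OF c(1)] by simp
      have e: "\<sigma> (r \<otimes> x k) = \<sigma> c \<otimes>\<^bsub>Q\<^esub> (q \<otimes>\<^bsub>Q\<^esub> \<sigma> (x k))"
        using c(2) xc q(1) cc by (simp add: c(3)[symmetric] Q.m_assoc)
      then have "\<sigma> (r \<otimes> x k) \<in> ext (D (Suc k))" using Q.left_ideal_mult[OF E cc q(2)] by simp
      then have "r \<otimes> x k \<in> contr (ext (D (Suc k)))" using c xc by (simp add: contr_def)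
      then obtain d where d: "d \<in> C" "d \<otimes> (r \<otimes> x k) \<in> D (Suc k)" unfolding contr_ext[OF D(1)] by blast
      have dc: "d \<in> carrier R" using regular_closed[OF d(1)] .
      have "(d \<otimes> r) \<otimes> x k = \<zero>" using xT[of "d \<otimes> r" k] d dc c xc by (simp add: m_assoc)
      then have "r \<otimes> x k = \<zero>" using regular_left[OF d(1), of "r \<otimes> x k"] dc c xc by (simp add: m_assoc)
      then have "\<sigma> c \<otimes>\<^bsub>Q\<^esub> (q \<otimes>\<^bsub>Q\<^esub> \<sigma> (x k)) = \<sigma> c \<otimes>\<^bsub>Q\<^esub> \<zero>\<^bsub>Q\<^esub>"
        using e[symmetric] cc by (simp del: h.hom_mult)
      then show "q \<otimes>\<^bsub>Q\<^esub> \<sigma> (x k) \<in> {\<zero>\<^bsub>Q\<^esub>}" using cancel[OF c(1)] q xc by simp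
    qed (auto simp: ext_def)
    then show False using MQ.flag_imp_direct_sum g by (auto simp: left_goldie_def)
  qed
  then show "no_infinite_direct_sums R (left_regular_module R)" using M.direct_sum_imp_flag by blast
qed

section \<open>The layers of the prime radical\<close>

context ring
begin

lemma
  assumes N: "ideal N R"
  shows quot_ring: "ring (R Quot N)"
    and quot_hom: "(+>) N \<in> ring_hom R (R Quot N)"
    and quot_surj: "(+>) N ` carrier R = carrier (R Quot N)"
proof -
  interpret ideal N R by fact
  show "ring (R Quot N)" "(+>) N \<in> ring_hom R (R Quot N)"
    by (rule quotient_is_ring, rule rcos_ring_hom)
  show "(+>) N ` carrier R = carrier (R Quot N)"
    by (auto simp: FactRing_def A_RCOSETS_def')
qed

lemma coset_eq_iff:
  assumes N: "left_ideal N R" and xy: "x \<in> carrier R" "y \<in> carrier R"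
  shows "N +> x = N +> y \<longleftrightarrow> x \<ominus> y \<in> N"
proof
  assume e: "N +> x = N +> y"
  have "\<zero> \<oplus> x \<in> N +> x" using left_ideal_zero[OF N] by (auto simp: a_r_coset_def')
  then have "x \<in> N +> y" using e xy by simp
  then obtain n where "n \<in> N" "x = n \<oplus> y" by (auto simp: a_r_coset_def')
  then show "x \<ominus> y \<in> N" using xy left_ideal_sub[OF N] by (simp add: minus_eq a_assoc r_neg)
next
  have sub: "N +> x \<subseteq> N +> y" if "x \<ominus> y \<in> N" "x \<in> carrier R" "y \<in> carrier R" for x y
  proof
    fix z assume "z \<in> N +> x"
    then obtain n where n: "n \<in> N" "z = n \<oplus> x" by (auto simp: a_r_coset_def')
    have "z = (n \<oplus> (x \<ominus> y)) \<oplus> y"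
      using n that left_ideal_sub[OF N] by (simp add: minus_eq a_assoc l_neg)
    then show "z \<in> N +> y" using left_ideal_add[OF N n(1) that(1)] by (auto simp: a_r_coset_def')
  qed
  assume d: "x \<ominus> y \<in> N"
  have "\<ominus> (x \<ominus> y) = y \<ominus> x" using xy by (simp add: minus_eq minus_add a_comm)
  then have "y \<ominus> x \<in> N" using left_ideal_minus[OF N d] by simp
  then show "N +> x = N +> y" using sub xy d by blast
qed

lemma coset_zero: "left_ideal N R \<Longrightarrow> N +> \<zero> = N"
  using left_ideal_sub by (force simp: a_r_coset_def')

lemma quot_zero_iff:
  assumes N: "ideal N R" and x: "x \<in> carrier R"
  shows "N +> x = \<zero>\<^bsub>R Quot N\<^esub> \<longleftrightarrow> x \<in> N"
  using coset_eq_iff[OF ideal_left_ideal[OF N] x zero_closed] coset_zero[OF ideal_left_ideal[OF N]] x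
  by (simp add: FactRing_def minus_eq)

lemma quot_simps:
  assumes N: "ideal N R" and x: "x \<in> carrier R" "y \<in> carrier R"
  shows "(N +> x) \<otimes>\<^bsub>R Quot N\<^esub> (N +> y) = N +> (x \<otimes> y)"
    "(N +> x) \<oplus>\<^bsub>R Quot N\<^esub> (N +> y) = N +> (x \<oplus> y)"
  using ring_hom_mult[OF quot_hom[OF N] x] ring_hom_add[OF quot_hom[OF N] x] by auto

lemma presented_quotient:
  assumes N: "ideal N R"
  shows "presented_module R (R Quot N) (left_regular_module (R Quot N)) ((+>) N) ((+>) N) (carrier R) N"
proof (unfold_locales)
  show "(+>) N ` carrier R = carrier (R Quot N)" by (rule quot_surj[OF N])
  then show "(+>) N ` carrier R = carrier (left_regular_module (R Quot N))" by (simp add: left_regular_module_def)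
  show "left_ideal (carrier R) R" by (rule left_ideal_carrier)
  show "N \<subseteq> carrier R" using ideal_closed[OF N] by blast
qed (use quot_simps[OF N] quot_zero_iff[OF N] left_ideal_zero[OF ideal_left_ideal[OF N]] in
    \<open>auto simp: left_regular_module_def\<close>)

lemma semiprime_quotient:
  assumes N: "ideal N R"
    and sp: "\<And>a. a \<in> carrier R \<Longrightarrow> (\<And>r. r \<in> carrier R \<Longrightarrow> a \<otimes> r \<otimes> a \<in> N) \<Longrightarrow> a \<in> N"
  shows "semiprime_ring (R Quot N)"
  unfolding semiprime_ring_def quot_surj[OF N, symmetric]
proof (clarify)
  fix a assume a: "a \<in> carrier R"
    and h: "\<forall>r\<in>(+>) N ` carrier R. (N +> a) \<otimes>\<^bsub>R Quot N\<^esub> r \<otimes>\<^bsub>R Quot N\<^esub> (N +> a) = \<zero>\<^bsub>R Quot N\<^esub>"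
  have "a \<otimes> r \<otimes> a \<in> N" if r: "r \<in> carrier R" for r
  proof -
    have "(N +> a) \<otimes>\<^bsub>R Quot N\<^esub> (N +> r) \<otimes>\<^bsub>R Quot N\<^esub> (N +> a) = \<zero>\<^bsub>R Quot N\<^esub>" using h r by blast
    then show ?thesis using quot_simps[OF N] quot_zero_iff[OF N] a r by simp
  qed
  then show "N +> a = \<zero>\<^bsub>R Quot N\<^esub>" using sp[OF a] quot_zero_iff[OF N a] by blast
qed

lemma quotient_vimage_left_ideal:
  assumes N: "ideal N R" and L: "left_ideal L (R Quot N)"
  shows "left_ideal {x \<in> carrier R. N +> x \<in> L} R"
proof -
  interpret S: ring "R Quot N" by (rule quot_ring[OF N])
  have z: "N +> \<zero> = \<zero>\<^bsub>R Quot N\<^esub>" using quot_zero_iff[OF N zero_closed] left_ideal_zero[OF ideal_left_ideal[OF N]] by simp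
  have c: "N +> r \<in> carrier (R Quot N)" if "r \<in> carrier R" for r using quot_surj[OF N] that by blast
  show ?thesis
  proof (rule left_idealI)
    show "\<zero> \<in> {x \<in> carrier R. N +> x \<in> L}" using z S.left_ideal_zero[OF L] by simp
    show "x \<oplus> y \<in> {x \<in> carrier R. N +> x \<in> L}"
      if "x \<in> {x \<in> carrier R. N +> x \<in> L}" "y \<in> {x \<in> carrier R. N +> x \<in> L}" for x y
      using that S.left_ideal_add[OF L, of "N +> x" "N +> y"] quot_simps(2)[OF N, of x y] by simp
    show "r \<otimes> x \<in> {x \<in> carrier R. N +> x \<in> L}"
      if "r \<in> carrier R" "x \<in> {x \<in> carrier R. N +> x \<in> L}" for r x
      using that S.left_ideal_mult[OF L c, of r "N +> x"] quot_simps(1)[OF N, of r x] by simp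
  qed auto
qed

lemma left_artinian_quotient:
  assumes N: "ideal N R" and art: "left_artinian R"
  shows "left_artinian (R Quot N)"
  unfolding left_artinian_def
proof (intro allI impI)
  interpret S: ring "R Quot N" by (rule quot_ring[OF N])
  fix L :: "nat \<Rightarrow> 'a set set"
  assume L: "(\<forall>k. left_ideal (L k) (R Quot N)) \<and> (\<forall>k. L (Suc k) \<subseteq> L k)"
  define I where "I k = {x \<in> carrier R. N +> x \<in> L k}" for k
  obtain n where n: "\<And>k. n \<le> k \<Longrightarrow> I k = I n"
    using left_artinianD[OF art, of I] quotient_vimage_left_ideal[OF N] L unfolding I_def by blast
  have "L k = (+>) N ` I k" for k
  proof
    show "(+>) N ` I k \<subseteq> L k" by (auto simp: I_def)
    show "L k \<subseteq> (+>) N ` I k"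
    proof
      fix X assume X: "X \<in> L k"
      then have "X \<in> (+>) N ` carrier R" using S.left_ideal_sub[of "L k" X] L quot_surj[OF N] by simp
      then show "X \<in> (+>) N ` I k" using X unfolding I_def by blast
    qed
  qed
  then show "\<exists>n. \<forall>k\<ge>n. L k = L n" using n by metis
qed

end

text \<open>Dividing by the kernel of \<open>\<pi>\<close> and then by the image of \<open>T\<close>
  is dividing by \<open>T\<close> at once. This makes the torsion-free layers, built as quotients of
  quotients, accessible from \<open>R\<close>. In the second part \<open>f\<close> is the map on
  \<open>I\<close> that induces the right action of \<open>s\<close>.\<close>

lemma quotient_bimodule_presented:
  fixes M :: "('s, 'c, 'n) bimodule_scheme"
  assumes M: "presented_module R S M \<rho> \<pi> I T\<^sub>0" and U: "left_ideal T R" "T\<^sub>0 \<subseteq> T" "T \<subseteq> I"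
  shows "presented_module R S (quotient_bimodule M (\<pi> ` T)) \<rho> (\<lambda>x. (\<pi> ` T) +>\<^bsub>M\<^esub> \<pi> x) I T"
    and "\<And>f s x. (\<And>x. x \<in> I \<Longrightarrow> f x \<in> I \<and> rsmult M (\<pi> x) s = \<pi> (f x)) \<Longrightarrow> (\<And>x. x \<in> T \<Longrightarrow> f x \<in> T) \<Longrightarrow>
       (\<And>x y. x \<in> I \<Longrightarrow> y \<in> I \<Longrightarrow> f (x \<oplus>\<^bsub>R\<^esub> y) = f x \<oplus>\<^bsub>R\<^esub> f y) \<Longrightarrow> x \<in> I \<Longrightarrow>
       rsmult (quotient_bimodule M (\<pi> ` T)) ((\<pi> ` T) +>\<^bsub>M\<^esub> \<pi> x) s = (\<pi> ` T) +>\<^bsub>M\<^esub> \<pi> (f x)"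
proof -
  interpret presented_module R S M \<rho> \<pi> I T\<^sub>0 by fact
  define H where "H = \<pi> ` T"
  have "left_submodule S M H" unfolding H_def by (rule image_submodule[OF U(1,3)])
  then interpret H: abelian_subgroup H M
    by (intro abelian_subgroupI3) (auto simp: left_submodule_def abelian_group_M)
  have Ti: "t \<in> T \<Longrightarrow> t \<in> I" for t using U by blast
  have mem: "u \<in> H +>\<^bsub>M\<^esub> \<pi> x \<longleftrightarrow> (\<exists>t\<in>T. u = \<pi> (t \<oplus>\<^bsub>R\<^esub> x))" if "x \<in> I" for u x
    using add Ti that by (auto simp: a_r_coset_def' H_def)
  have eq: "H +>\<^bsub>M\<^esub> \<pi> (t \<oplus>\<^bsub>R\<^esub> x) = H +>\<^bsub>M\<^esub> \<pi> x" if "t \<in> T" "x \<in> I" for t x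
    using H.a_repr_independence'[of "\<pi> (t \<oplus>\<^bsub>R\<^esub> x)" "\<pi> x"] mem[OF that(2)] that pi_closed by blast
  \<comment> \<open>The actions on the quotient are unions over all representatives of a coset. For
    an additive \<open>f\<close> that preserves \<open>T\<close> all members of the union coincide;
    the left and the right action are both instances.\<close>
  have union: "(\<Union>u\<in>H +>\<^bsub>M\<^esub> \<pi> x. H +>\<^bsub>M\<^esub> g u) = H +>\<^bsub>M\<^esub> \<pi> (f x)"
    if x: "x \<in> I" and g: "\<And>y. y \<in> I \<Longrightarrow> f y \<in> I \<and> g (\<pi> y) = \<pi> (f y)" and fT: "\<And>y. y \<in> T \<Longrightarrow> f y \<in> T"
      and fa: "\<And>x y. x \<in> I \<Longrightarrow> y \<in> I \<Longrightarrow> f (x \<oplus>\<^bsub>R\<^esub> y) = f x \<oplus>\<^bsub>R\<^esub> f y" for f g x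
  proof -
    have "H +>\<^bsub>M\<^esub> g u = H +>\<^bsub>M\<^esub> \<pi> (f x)" if u: "u \<in> H +>\<^bsub>M\<^esub> \<pi> x" for u
    proof -
      obtain t where t: "t \<in> T" "u = \<pi> (t \<oplus>\<^bsub>R\<^esub> x)" using mem[OF x] u by blast
      then have "g u = \<pi> (f t \<oplus>\<^bsub>R\<^esub> f x)" using g[of "t \<oplus>\<^bsub>R\<^esub> x"] left_ideal_add[OF I Ti[OF t(1)] x] fa[OF Ti[OF t(1)] x] by simp
      then show ?thesis using eq[OF fT[OF t(1)]] g[OF x] by simp
    qed
    moreover have "\<pi> x \<in> H +>\<^bsub>M\<^esub> \<pi> x" using H.a_rcos_self pi_closed[OF x] by blast
    ultimately show ?thesis by blast
  qed
  have inT: "H +>\<^bsub>M\<^esub> \<pi> x = H \<longleftrightarrow> x \<in> T" if x: "x \<in> I" for x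
  proof
    assume "H +>\<^bsub>M\<^esub> \<pi> x = H"
    then have "\<pi> x \<in> H" using H.a_rcos_self pi_closed[OF x] by blast
    then obtain t where t: "t \<in> T" "\<pi> x = \<pi> t" by (auto simp: H_def)
    then have "x \<ominus>\<^bsub>R\<^esub> t \<in> T" using pi_eq_iff[OF x Ti] U by blast
    then have "(x \<ominus>\<^bsub>R\<^esub> t) \<oplus>\<^bsub>R\<^esub> t \<in> T" using left_ideal_add[OF U(1)] t by blast
    then show "x \<in> T" using Isub x Ti t by (simp add: minus_eq a_assoc l_neg)
  next
    assume "x \<in> T"
    then show "H +>\<^bsub>M\<^esub> \<pi> x = H" using H.a_rcos_const by (simp add: H_def)
  qed
  show "presented_module R S (quotient_bimodule M (\<pi> ` T)) \<rho> (\<lambda>x. (\<pi> ` T) +>\<^bsub>M\<^esub> \<pi> x) I T"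
    unfolding H_def[symmetric]
  proof
    show "\<rho> ` carrier R = carrier S" by (rule scalars)
    show "left_ideal I R" by (rule I)
    show "(\<lambda>x. H +>\<^bsub>M\<^esub> \<pi> x) ` I = carrier (quotient_bimodule M H)"
      by (auto simp: quotient_bimodule_def A_RCOSETS_def' onto[symmetric])
    show "(H +>\<^bsub>M\<^esub> \<pi> x) \<oplus>\<^bsub>quotient_bimodule M H\<^esub> (H +>\<^bsub>M\<^esub> \<pi> y) = H +>\<^bsub>M\<^esub> \<pi> (x \<oplus>\<^bsub>R\<^esub> y)"
      if "x \<in> I" "y \<in> I" for x y
      using H.a_rcos_sum[OF pi_closed pi_closed] that add by (simp add: quotient_bimodule_def)
    show "H +>\<^bsub>M\<^esub> \<pi> \<zero>\<^bsub>R\<^esub> = \<zero>\<^bsub>quotient_bimodule M H\<^esub>"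
      using inT[OF left_ideal_zero[OF I]] left_ideal_zero[OF U(1)] by (simp add: quotient_bimodule_def)
    show "\<rho> r \<odot>\<^bsub>quotient_bimodule M H\<^esub> (H +>\<^bsub>M\<^esub> \<pi> x) = H +>\<^bsub>M\<^esub> \<pi> (r \<otimes>\<^bsub>R\<^esub> x)"
      if r: "r \<in> carrier R" and x: "x \<in> I" for r x
      unfolding quotient_bimodule_def module.simps
      by (rule union[OF x]) (use smult[OF r] left_ideal_mult[OF I r] left_ideal_mult[OF U(1) r] Isub r in \<open>auto simp: r_distr\<close>)
    show "H +>\<^bsub>M\<^esub> \<pi> x = \<zero>\<^bsub>quotient_bimodule M H\<^esub> \<longleftrightarrow> x \<in> T" if "x \<in> I" for x
      using inT[OF that] by (simp add: quotient_bimodule_def)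
    show "T \<subseteq> I" by (rule U)
  qed
  show "rsmult (quotient_bimodule M (\<pi> ` T)) ((\<pi> ` T) +>\<^bsub>M\<^esub> \<pi> x) s = (\<pi> ` T) +>\<^bsub>M\<^esub> \<pi> (f x)"
    if "\<And>x. x \<in> I \<Longrightarrow> f x \<in> I \<and> rsmult M (\<pi> x) s = \<pi> (f x)" "\<And>x. x \<in> T \<Longrightarrow> f x \<in> T"
       "\<And>x y. x \<in> I \<Longrightarrow> y \<in> I \<Longrightarrow> f (x \<oplus>\<^bsub>R\<^esub> y) = f x \<oplus>\<^bsub>R\<^esub> f y" "x \<in> I" for f s x
    unfolding H_def[symmetric] quotient_bimodule_def bimodule.simps
    by (rule union[OF that(4)]) (use that in auto)
qed

section \<open>The layers of the radical, pulled back to left ideals of \<open>R\<close>\<close>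

context ring
begin

abbreviation rad :: "'a set" where "rad \<equiv> prime_radical R"
abbreviation rad_power :: "nat \<Rightarrow> 'a set" where "rad_power i \<equiv> ideal_power R (prime_radical R) i"
abbreviation reg_mod :: "'a set" where "reg_mod \<equiv> regular_mod_radical R"

lemma rad_left_ideal: "left_ideal rad R"
  by (rule ideal_left_ideal[OF prime_radical_ideal])

lemma rad_power_left_ideal: "left_ideal (rad_power i) R"
  by (rule ideal_left_ideal[OF ideal_power_ideal[OF prime_radical_ideal]])

lemma rad_power_right: "x \<in> rad_power i \<Longrightarrow> r \<in> carrier R \<Longrightarrow> x \<otimes> r \<in> rad_power i"
  by (rule ideal_mult_closed(2)[OF ideal_power_ideal[OF prime_radical_ideal]])

lemma rad_power_closed: "x \<in> rad_power i \<Longrightarrow> x \<in> carrier R"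
  by (rule left_ideal_sub[OF rad_power_left_ideal])

lemma rad_mult_rad_power: "n \<in> rad \<Longrightarrow> x \<in> rad_power i \<Longrightarrow> n \<otimes> x \<in> rad_power (Suc i)"
  by (rule ideal_power_mult_left[OF prime_radical_ideal])

lemma rad_power_Suc: "rad_power (Suc i) \<subseteq> rad_power i"
  by (rule ideal_power_decreasing[OF prime_radical_ideal]) simp

lemma reduced_ring_ring: "ring (reduced_ring R)"
  unfolding reduced_ring_def by (rule quot_ring[OF prime_radical_ideal])

lemma residue_class_eq: "residue_class R = (+>) rad"
  by (rule ext) (simp add: residue_class_def)

lemma residue_surj: "residue_class R ` carrier R = carrier (reduced_ring R)"
  unfolding residue_class_eq reduced_ring_def by (rule quot_surj[OF prime_radical_ideal])

lemma residue_mult: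
  "x \<in> carrier R \<Longrightarrow> y \<in> carrier R \<Longrightarrow>
    residue_class R x \<otimes>\<^bsub>reduced_ring R\<^esub> residue_class R y = residue_class R (x \<otimes> y)"
  unfolding residue_class_eq reduced_ring_def by (rule quot_simps(1)[OF prime_radical_ideal])

lemma residue_zero_iff:
  "x \<in> carrier R \<Longrightarrow> residue_class R x = \<zero>\<^bsub>reduced_ring R\<^esub> \<longleftrightarrow> x \<in> rad"
  unfolding residue_class_eq reduced_ring_def by (rule quot_zero_iff[OF prime_radical_ideal])

lemma residue_eq_iff:
  "x \<in> carrier R \<Longrightarrow> y \<in> carrier R \<Longrightarrow> residue_class R x = residue_class R y \<longleftrightarrow> x \<ominus> y \<in> rad"
  unfolding residue_class_eq by (rule coset_eq_iff[OF rad_left_ideal])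

lemma semiprime_reduced: "semiprime_ring (reduced_ring R)"
  unfolding reduced_ring_def by (rule semiprime_quotient[OF prime_radical_ideal prime_radical_semiprime])

lemma regular_mod_iff:
  "c \<in> reg_mod \<longleftrightarrow> c \<in> carrier R \<and>
     (\<forall>x\<in>carrier R. (c \<otimes> x \<in> rad \<longrightarrow> x \<in> rad) \<and> (x \<otimes> c \<in> rad \<longrightarrow> x \<in> rad))"
proof (cases "c \<in> carrier R")
  case True
  then have "residue_class R c \<in> carrier (reduced_ring R)" using residue_surj by blast
  then show ?thesis using True residue_mult residue_zero_iff
    unfolding regular_mod_radical_def regular_elements_def residue_surj[symmetric] by simp
qed (simp add: regular_mod_radical_def)

lemma
  assumes "c \<in> reg_mod"
  shows reg_mod_closed: "c \<in> carrier R"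
    and reg_mod_left: "x \<in> carrier R \<Longrightarrow> c \<otimes> x \<in> rad \<Longrightarrow> x \<in> rad"
    and reg_mod_right: "x \<in> carrier R \<Longrightarrow> x \<otimes> c \<in> rad \<Longrightarrow> x \<in> rad"
  using assms unfolding regular_mod_iff by blast+

lemma reg_mod_one: "\<one> \<in> reg_mod"
  unfolding regular_mod_iff by simp

lemma reg_mod_mult:
  assumes "c \<in> reg_mod" "d \<in> reg_mod"
  shows "c \<otimes> d \<in> reg_mod"
  unfolding regular_mod_iff
proof (intro conjI ballI impI)
  note cl = reg_mod_closed[OF assms(1)] reg_mod_closed[OF assms(2)]
  show "c \<otimes> d \<in> carrier R" using cl by simp
  show "x \<in> rad" if "x \<in> carrier R" "c \<otimes> d \<otimes> x \<in> rad" for x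
    using that cl reg_mod_left[OF assms(1), of "d \<otimes> x"] reg_mod_left[OF assms(2), of x] by (simp add: m_assoc)
  show "x \<in> rad" if "x \<in> carrier R" "x \<otimes> (c \<otimes> d) \<in> rad" for x
    using that cl reg_mod_right[OF assms(1), of x] reg_mod_right[OF assms(2), of "x \<otimes> c"] by (simp add: m_assoc)
qed

lemma regular_reduced: "regular_elements (reduced_ring R) = residue_class R ` reg_mod"
proof
  show "residue_class R ` reg_mod \<subseteq> regular_elements (reduced_ring R)" by (auto simp: regular_mod_radical_def)
  show "regular_elements (reduced_ring R) \<subseteq> residue_class R ` reg_mod"
  proof
    fix X assume X: "X \<in> regular_elements (reduced_ring R)"
    then have "X \<in> residue_class R ` carrier R" unfolding residue_surj by (simp add: regular_elements_def)
    then show "X \<in> residue_class R ` reg_mod" using X by (auto simp: regular_mod_radical_def)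
  qed
qed

lemma layer_simps:
  "carrier (radical_layer R i) = (\<lambda>x. rad_power (Suc i) +> x) ` rad_power i"
  "zero (radical_layer R i) = rad_power (Suc i)"
  "add (radical_layer R i) = set_add R"
  "module.smult (radical_layer R i) = rcoset_mult R (rad_power (Suc i))"
  "rsmult (radical_layer R i) = rcoset_mult R (rad_power (Suc i))"
  by (simp_all add: radical_layer_def Let_def)

lemma layer_smult:
  assumes r: "r \<in> carrier R" and x: "x \<in> rad_power i"
  shows "residue_class R r \<odot>\<^bsub>radical_layer R i\<^esub> (rad_power (Suc i) +> x) = rad_power (Suc i) +> (r \<otimes> x)"
    and "rsmult (radical_layer R i) (rad_power (Suc i) +> x) (residue_class R r) = rad_power (Suc i) +> (x \<otimes> r)"
proof -
  let ?J = "rad_power (Suc i)"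
  note J = rad_power_left_ideal[of "Suc i"]
  have xc: "x \<in> carrier R" using rad_power_closed x .
  have Ji: "j \<in> rad_power i" if "j \<in> ?J" for j using that rad_power_Suc by blast
  \<comment> \<open>\<open>rcoset_mult\<close> collects the products of all representatives. They
    fall into one coset because \<open>?J\<close> is an ideal and a change of the scalar changes the
    product by an element of \<open>rad\<close> times one of \<open>rad_power i\<close>, in either
    order.\<close>
  have 1: "?J +> (a \<otimes> b) = ?J +> (r \<otimes> x) \<and> ?J +> (b \<otimes> a) = ?J +> (x \<otimes> r)"
    if a: "a \<in> residue_class R r" and b: "b \<in> ?J +> x" for a b
  proof -
    obtain n where n: "n \<in> rad" "a = n \<oplus> r" using a by (auto simp: residue_class_def a_r_coset_def')
    obtain j where j: "j \<in> ?J" "b = j \<oplus> x" using b by (auto simp: a_r_coset_def')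
    have c: "n \<in> carrier R" "j \<in> carrier R"
      by (rule left_ideal_sub[OF rad_left_ideal n(1)], rule rad_power_closed[OF j(1)])
    have bi: "b \<in> rad_power i" using j Ji x left_ideal_add[OF rad_power_left_ideal] by blast
    have bc: "b \<in> carrier R" using j c xc by simp
    have "a \<otimes> b \<ominus> r \<otimes> x = n \<otimes> b \<oplus> r \<otimes> j"
    proof -
      have "a \<otimes> b = n \<otimes> b \<oplus> r \<otimes> j \<oplus> r \<otimes> x" using n j c xc r bc by (simp add: l_distr r_distr a_ac)
      then show ?thesis using c bc xc r by (simp add: minus_eq a_assoc r_neg)
    qed
    moreover have "n \<otimes> b \<in> ?J" by (rule rad_mult_rad_power[OF n(1) bi])
    moreover have "r \<otimes> j \<in> ?J" using left_ideal_mult[OF J r j(1)] .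
    ultimately have l: "a \<otimes> b \<ominus> r \<otimes> x \<in> ?J" using left_ideal_add[OF J] by simp
    have "b \<otimes> a \<ominus> x \<otimes> r = b \<otimes> n \<oplus> j \<otimes> r"
    proof -
      have "b \<otimes> a = b \<otimes> n \<oplus> j \<otimes> r \<oplus> x \<otimes> r" using n j c xc r by (simp add: l_distr r_distr a_ac)
      then show ?thesis using c bc xc r by (simp add: minus_eq a_assoc r_neg)
    qed
    moreover have "b \<otimes> n \<in> ?J" by (rule ideal_power_mult_right[OF bi n(1)])
    moreover have "j \<otimes> r \<in> ?J" by (rule rad_power_right[OF j(1) r])
    ultimately have r': "b \<otimes> a \<ominus> x \<otimes> r \<in> ?J" using left_ideal_add[OF J] by simp
    show ?thesis using coset_eq_iff[OF J] l r' n c r xc bc by simp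
  qed
  have "\<zero> \<oplus> r \<in> residue_class R r" "\<zero> \<oplus> x \<in> ?J +> x"
    using left_ideal_zero[OF rad_left_ideal] left_ideal_zero[OF J] by (auto simp: residue_class_def a_r_coset_def')
  then have ne: "residue_class R r \<noteq> {}" "?J +> x \<noteq> {}" by auto
  show "residue_class R r \<odot>\<^bsub>radical_layer R i\<^esub> (?J +> x) = ?J +> (r \<otimes> x)"
    unfolding layer_simps rcoset_mult_def using 1 ne by blast
  show "rsmult (radical_layer R i) (?J +> x) (residue_class R r) = ?J +> (x \<otimes> r)"
    unfolding layer_simps rcoset_mult_def using 1 ne by blast
qed

lemma layer_zero_iff:
  "x \<in> carrier R \<Longrightarrow> rad_power (Suc i) +> x = \<zero>\<^bsub>radical_layer R i\<^esub> \<longleftrightarrow> x \<in> rad_power (Suc i)"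
  using coset_eq_iff[OF rad_power_left_ideal, of x \<zero> "Suc i"] coset_zero[OF rad_power_left_ideal, of "Suc i"]
  unfolding layer_simps by (simp add: minus_eq)

lemma presented_layer:
  "presented_module R (reduced_ring R) (radical_layer R i) (residue_class R)
     (\<lambda>x. rad_power (Suc i) +> x) (rad_power i) (rad_power (Suc i))"
proof
  show "residue_class R ` carrier R = carrier (reduced_ring R)" by (rule residue_surj)
  show "left_ideal (rad_power i) R" by (rule rad_power_left_ideal)
  show "(\<lambda>x. rad_power (Suc i) +> x) ` rad_power i = carrier (radical_layer R i)" by (simp add: layer_simps)
  show "(rad_power (Suc i) +> x) \<oplus>\<^bsub>radical_layer R i\<^esub> (rad_power (Suc i) +> y) = rad_power (Suc i) +> (x \<oplus> y)"
    if "x \<in> rad_power i" "y \<in> rad_power i" for x y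
  proof -
    interpret ideal "rad_power (Suc i)" R by (rule ideal_power_ideal[OF prime_radical_ideal])
    show ?thesis unfolding layer_simps using a_rcos_sum that rad_power_closed by blast
  qed
  show "rad_power (Suc i) +> \<zero> = \<zero>\<^bsub>radical_layer R i\<^esub>"
    using layer_zero_iff[OF zero_closed] left_ideal_zero[OF rad_power_left_ideal] by blast
  show "rad_power (Suc i) +> x = \<zero>\<^bsub>radical_layer R i\<^esub> \<longleftrightarrow> x \<in> rad_power (Suc i)" if "x \<in> rad_power i" for x
    using layer_zero_iff[OF rad_power_closed[OF that]] .
qed (use layer_smult(1) rad_power_Suc in auto)

text \<open>The preimage of \<open>layer_torsion R i\<close> in \<open>rad_power i\<close>. For
  \<open>i = 0\<close> it is the radical itself, so \<open>R/rad\<close> is the torsion-free layer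
  of index 0.\<close>

definition tors :: "nat \<Rightarrow> 'a set" where
  "tors i = {x \<in> rad_power i. \<exists>c\<in>reg_mod. c \<otimes> x \<in> rad_power (Suc i)}"

lemma layer_torsion_iff:
  assumes x: "x \<in> rad_power i"
  shows "(\<exists>c\<in>regular_elements (reduced_ring R). c \<odot>\<^bsub>radical_layer R i\<^esub> (rad_power (Suc i) +> x) = \<zero>\<^bsub>radical_layer R i\<^esub>)
    \<longleftrightarrow> x \<in> tors i"
proof -
  have "residue_class R c \<odot>\<^bsub>radical_layer R i\<^esub> (rad_power (Suc i) +> x) = \<zero>\<^bsub>radical_layer R i\<^esub> \<longleftrightarrow>
      c \<otimes> x \<in> rad_power (Suc i)" if "c \<in> reg_mod" for c
    using layer_smult(1)[OF reg_mod_closed[OF that] x] layer_zero_iff[of "c \<otimes> x" i]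
      reg_mod_closed[OF that] rad_power_closed[OF x] by simp
  then show ?thesis unfolding regular_reduced tors_def using x by blast
qed

lemma layer_torsion_eq: "layer_torsion R i = (\<lambda>x. rad_power (Suc i) +> x) ` tors i"
proof -
  have "layer_torsion R i = (\<lambda>x. rad_power (Suc i) +> x) ` {x \<in> rad_power i. x \<in> tors i}"
    unfolding layer_torsion_def layer_simps(1) using layer_torsion_iff by blast
  moreover have "{x \<in> rad_power i. x \<in> tors i} = tors i" by (auto simp: tors_def)
  ultimately show ?thesis by simp
qed

lemma two_sided_torsion_condition_iff:
  "two_sided_torsion_condition R i \<longleftrightarrow>
     (\<forall>x\<in>rad_power i. \<forall>s\<in>reg_mod. \<forall>c\<in>reg_mod. s \<otimes> x \<otimes> c \<in> rad_power (Suc i) \<longrightarrow> x \<in> tors i)"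
proof -
  have "rsmult (radical_layer R i) (residue_class R s \<odot>\<^bsub>radical_layer R i\<^esub> (rad_power (Suc i) +> x)) (residue_class R c)
      = \<zero>\<^bsub>radical_layer R i\<^esub> \<longleftrightarrow> s \<otimes> x \<otimes> c \<in> rad_power (Suc i)"
    if "s \<in> reg_mod" "c \<in> reg_mod" "x \<in> rad_power i" for s c x
  proof -
    note cl = reg_mod_closed[OF that(1)] reg_mod_closed[OF that(2)] rad_power_closed[OF that(3)]
    have "s \<otimes> x \<in> rad_power i" using left_ideal_mult[OF rad_power_left_ideal] cl that by blast
    then show ?thesis using layer_smult(1)[OF cl(1) that(3)] layer_smult(2)[OF cl(2)]
        layer_zero_iff[of "s \<otimes> x \<otimes> c"] cl by simp
  qed
  then show ?thesis
    unfolding two_sided_torsion_condition_def Let_def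
    by (simp add: layer_simps(1) layer_torsion_iff regular_reduced[symmetric] del: ideal_power.simps)
       (auto simp: regular_reduced simp del: ideal_power.simps)
qed

lemma right_torsion_condition_iff:
  "right_torsion_condition R i \<longleftrightarrow>
     (\<forall>x\<in>rad_power i. \<forall>c\<in>reg_mod. x \<otimes> c \<in> rad_power (Suc i) \<longrightarrow> x \<in> tors i)"
proof -
  have "rsmult (radical_layer R i) (rad_power (Suc i) +> x) (residue_class R c)
      = \<zero>\<^bsub>radical_layer R i\<^esub> \<longleftrightarrow> x \<otimes> c \<in> rad_power (Suc i)"
    if "c \<in> reg_mod" "x \<in> rad_power i" for c x
    using layer_smult(2)[OF reg_mod_closed[OF that(1)] that(2)] layer_zero_iff[of "x \<otimes> c"]
      reg_mod_closed[OF that(1)] rad_power_closed[OF that(2)] by simp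
  then show ?thesis
    unfolding right_torsion_condition_def Let_def
    by (simp add: layer_simps(1) layer_torsion_iff regular_reduced[symmetric] del: ideal_power.simps)
       (auto simp: regular_reduced simp del: ideal_power.simps)
qed

end

text \<open>The Ore condition of \<open>R/rad\<close> pulled back to \<open>R\<close>: the two
  products agree only up to the radical. The exact relation is obtained later in
  \<open>exact_ore\<close>.\<close>

locale ore_mod = ring R for R :: "('a, 'm) ring_scheme" (structure) +
  assumes ore_mod: "c \<in> regular_mod_radical R \<Longrightarrow> r \<in> carrier R \<Longrightarrow>
    \<exists>c'\<in>regular_mod_radical R. \<exists>r'\<in>carrier R. c' \<otimes> r \<ominus> r' \<otimes> c \<in> prime_radical R"
begin

text \<open>On a layer the error of the Ore relation is harmless: it lies in \<open>rad\<close>,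
  which maps \<open>rad_power i\<close> into \<open>rad_power (Suc i)\<close>. This makes torsion
  closed under sums and left multiples.\<close>

lemma tors_absorb:
  assumes c: "c \<in> reg_mod" "c \<otimes> x \<in> rad_power (Suc i)" and x: "x \<in> rad_power i" and r: "r \<in> carrier R"
  shows "\<exists>c'\<in>reg_mod. (c' \<otimes> r) \<otimes> x \<in> rad_power (Suc i)"
proof -
  obtain c' r' where h: "c' \<in> reg_mod" "r' \<in> carrier R" "c' \<otimes> r \<ominus> r' \<otimes> c \<in> rad"
    using ore_mod[OF c(1) r] by blast
  note cl = reg_mod_closed[OF c(1)] reg_mod_closed[OF h(1)] rad_power_closed[OF x]
  have "(c' \<otimes> r) \<otimes> x = (c' \<otimes> r \<ominus> r' \<otimes> c) \<otimes> x \<oplus> r' \<otimes> (c \<otimes> x)"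
    using cl r h(2) by (simp add: minus_eq l_distr l_minus m_assoc a_assoc l_neg)
  moreover have "(c' \<otimes> r \<ominus> r' \<otimes> c) \<otimes> x \<in> rad_power (Suc i)" by (rule rad_mult_rad_power[OF h(3) x])
  moreover have "r' \<otimes> (c \<otimes> x) \<in> rad_power (Suc i)" by (rule left_ideal_mult[OF rad_power_left_ideal h(2) c(2)])
  ultimately have "(c' \<otimes> r) \<otimes> x \<in> rad_power (Suc i)" using left_ideal_add[OF rad_power_left_ideal] by metis
  then show ?thesis using h(1) by blast
qed

lemma tors_left_ideal: "left_ideal (tors i) R"
proof (rule left_idealI)
  show "tors i \<subseteq> carrier R" using rad_power_closed by (auto simp: tors_def)
  show "\<zero> \<in> tors i" using reg_mod_one left_ideal_zero[OF rad_power_left_ideal]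
    by (auto simp: tors_def simp del: ideal_power.simps intro!: bexI[of _ \<one>])
  show "x \<oplus> y \<in> tors i" if xy: "x \<in> tors i" "y \<in> tors i" for x y
  proof -
    obtain c where c: "c \<in> reg_mod" "c \<otimes> x \<in> rad_power (Suc i)" using xy by (auto simp: tors_def)
    obtain d where d: "d \<in> reg_mod" "d \<otimes> y \<in> rad_power (Suc i)" using xy by (auto simp: tors_def)
    have x: "x \<in> rad_power i" and y: "y \<in> rad_power i" using xy by (auto simp: tors_def)
    obtain e where e: "e \<in> reg_mod" "(e \<otimes> d) \<otimes> x \<in> rad_power (Suc i)"
      using tors_absorb[OF c x reg_mod_closed[OF d(1)]] by blast
    note cl = reg_mod_closed[OF d(1)] reg_mod_closed[OF e(1)] rad_power_closed[OF x] rad_power_closed[OF y]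
    have "(e \<otimes> d) \<otimes> y \<in> rad_power (Suc i)"
      using left_ideal_mult[OF rad_power_left_ideal cl(2) d(2)] cl by (simp add: m_assoc del: ideal_power.simps)
    then have "(e \<otimes> d) \<otimes> (x \<oplus> y) \<in> rad_power (Suc i)"
      using left_ideal_add[OF rad_power_left_ideal e(2)] cl by (simp add: r_distr del: ideal_power.simps)
    then show ?thesis unfolding tors_def
      using left_ideal_add[OF rad_power_left_ideal x y] reg_mod_mult[OF e(1) d(1)] by blast
  qed
  show "r \<otimes> x \<in> tors i" if r: "r \<in> carrier R" and xt: "x \<in> tors i" for r x
  proof -
    obtain c where c: "c \<in> reg_mod" "c \<otimes> x \<in> rad_power (Suc i)" using xt by (auto simp: tors_def)
    have x: "x \<in> rad_power i" using xt by (auto simp: tors_def)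
    obtain e where e: "e \<in> reg_mod" "(e \<otimes> r) \<otimes> x \<in> rad_power (Suc i)"
      using tors_absorb[OF c x r] by blast
    then have "e \<otimes> (r \<otimes> x) \<in> rad_power (Suc i)"
      using reg_mod_closed[OF e(1)] r rad_power_closed[OF x] by (simp add: m_assoc del: ideal_power.simps)
    then show ?thesis unfolding tors_def using left_ideal_mult[OF rad_power_left_ideal r x] e(1) by blast
  qed
qed

lemma tors_right:
  assumes "x \<in> tors i" "r \<in> carrier R" shows "x \<otimes> r \<in> tors i"
proof -
  obtain c where c: "c \<in> reg_mod" "c \<otimes> x \<in> rad_power (Suc i)" and x: "x \<in> rad_power i"
    using assms(1) by (auto simp: tors_def)
  have "c \<otimes> (x \<otimes> r) \<in> rad_power (Suc i)"
    using rad_power_right[OF c(2) assms(2)] reg_mod_closed[OF c(1)] rad_power_closed[OF x] assms(2)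
    by (simp add: m_assoc del: ideal_power.simps)
  then show ?thesis using c(1) rad_power_right[OF x assms(2)] unfolding tors_def by blast
qed

lemma tors_sub: "tors i \<subseteq> rad_power i" by (auto simp: tors_def)

lemma rad_power_Suc_tors: "rad_power (Suc i) \<subseteq> tors i"
proof
  fix x assume x: "x \<in> rad_power (Suc i)"
  then have "\<one> \<otimes> x \<in> rad_power (Suc i)" using rad_power_closed[OF x] by simp
  then show "x \<in> tors i" using x rad_power_Suc reg_mod_one unfolding tors_def by blast
qed

lemma tors_saturated:
  assumes x: "x \<in> rad_power i" and c: "c \<in> reg_mod" "c \<otimes> x \<in> tors i"
  shows "x \<in> tors i"
proof -
  obtain d where d: "d \<in> reg_mod" "d \<otimes> (c \<otimes> x) \<in> rad_power (Suc i)" using c(2) by (auto simp: tors_def)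
  then have "(d \<otimes> c) \<otimes> x \<in> rad_power (Suc i)"
    using reg_mod_closed[OF c(1)] reg_mod_closed[OF d(1)] rad_power_closed[OF x] by (simp add: m_assoc del: ideal_power.simps)
  then show ?thesis using x reg_mod_mult[OF d(1) c(1)] unfolding tors_def by blast
qed

text \<open>The quotient map from \<open>rad_power i\<close> onto the torsion-free layer. Its values
  are cosets of cosets because the layer is formed in two stages.\<close>

abbreviation layer_class :: "nat \<Rightarrow> 'a \<Rightarrow> 'a set set" where
  "layer_class i x \<equiv> (\<lambda>x. rad_power (Suc i) +> x) ` tors i +>\<^bsub>radical_layer R i\<^esub> (rad_power (Suc i) +> x)"

lemma presented_torsion_free_layer:
  "presented_module R (reduced_ring R) (torsion_free_layer R i) (residue_class R)
     (layer_class i) (rad_power i) (tors i)"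
  unfolding torsion_free_layer_def layer_torsion_eq
  by (rule quotient_bimodule_presented(1)[OF presented_layer tors_left_ideal rad_power_Suc_tors tors_sub])

lemma torsion_free_layer_rsmult:
  assumes x: "x \<in> rad_power i" and r: "r \<in> carrier R"
  shows "rsmult (torsion_free_layer R i) (layer_class i x) (residue_class R r) = layer_class i (x \<otimes> r)"
  unfolding torsion_free_layer_def layer_torsion_eq
  by (rule quotient_bimodule_presented(2)[OF presented_layer tors_left_ideal rad_power_Suc_tors tors_sub _ _ _ x])
    (use layer_smult(2)[OF r] rad_power_right[OF _ r] tors_right[OF _ r] rad_power_closed r in \<open>auto simp: l_distr simp del: ideal_power.simps\<close>)

lemma no_infinite_direct_sums_layer_iff:
  "no_infinite_direct_sums (reduced_ring R) (torsion_free_layer R i) \<longleftrightarrow>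
     (\<nexists>D x. descending_flag R (rad_power i) (tors i) D x)"
  by (rule presented_module.no_infinite_direct_sums_iff[OF presented_torsion_free_layer])

text \<open>Additivity of right multiplication reduces injectivity to a trivial kernel, which is
  then read in \<open>rad_power i\<close> modulo \<open>tors i\<close>.\<close>

lemma right_mult_injective_iff:
  "right_mult_injective R i \<longleftrightarrow> (\<forall>c\<in>reg_mod. \<forall>x\<in>rad_power i. x \<otimes> c \<in> tors i \<longrightarrow> x \<in> tors i)"
proof -
  interpret M: presented_module R "reduced_ring R" "torsion_free_layer R i" "residue_class R"
    "layer_class i" "rad_power i" "tors i"
    by (rule presented_torsion_free_layer)
  have "inj_on (\<lambda>f. rsmult (torsion_free_layer R i) f (residue_class R c)) (carrier (torsion_free_layer R i))
      \<longleftrightarrow> (\<forall>x\<in>rad_power i. x \<otimes> c \<in> tors i \<longrightarrow> x \<in> tors i)" (is "?L \<longleftrightarrow> ?R") if c: "c \<in> reg_mod" for c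
  proof
    note cc = reg_mod_closed[OF c]
    assume inj: ?L
    show ?R
    proof (intro ballI impI)
      fix x assume x: "x \<in> rad_power i" "x \<otimes> c \<in> tors i"
      have z: "\<zero> \<in> rad_power i" by (rule left_ideal_zero[OF rad_power_left_ideal])
      have "layer_class i (x \<otimes> c) = layer_class i (\<zero> \<otimes> c)"
        using M.ker[OF rad_power_right[OF x(1) cc]] M.zero x(2) cc by simp
      then have "rsmult (torsion_free_layer R i) (layer_class i x) (residue_class R c) =
          rsmult (torsion_free_layer R i) (layer_class i \<zero>) (residue_class R c)"
        using torsion_free_layer_rsmult[OF _ cc] x(1) z by (simp del: ideal_power.simps)
      then have "layer_class i x = layer_class i \<zero>"
        using inj M.pi_closed[OF x(1)] M.pi_closed[OF z] unfolding inj_on_def by blast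
      then show "x \<in> tors i" using M.ker[OF x(1)] M.zero by simp
    qed
  next
    note cc = reg_mod_closed[OF c]
    assume R: ?R
    show ?L
      unfolding M.onto[symmetric]
    proof (rule inj_onI, clarify)
      fix x y assume xy: "x \<in> rad_power i" "y \<in> rad_power i"
        and e: "rsmult (torsion_free_layer R i) (layer_class i x) (residue_class R c) =
          rsmult (torsion_free_layer R i) (layer_class i y) (residue_class R c)"
      have "layer_class i (x \<otimes> c) = layer_class i (y \<otimes> c)"
        using e torsion_free_layer_rsmult[OF _ cc] xy by (simp del: ideal_power.simps)
      then have "x \<otimes> c \<ominus> y \<otimes> c \<in> tors i" using M.pi_eq_iff rad_power_right[OF _ cc] xy by blast
      moreover have "x \<otimes> c \<ominus> y \<otimes> c = (x \<ominus> y) \<otimes> c"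
        using rad_power_closed[OF xy(1)] rad_power_closed[OF xy(2)] cc by (simp add: minus_eq l_distr l_minus)
      ultimately have "x \<ominus> y \<in> tors i" using R left_ideal_diff[OF rad_power_left_ideal xy] by simp
      then show "layer_class i x = layer_class i y" using M.pi_eq_iff[OF xy] by blast
    qed
  qed
  then show ?thesis unfolding right_mult_injective_def regular_reduced by (simp del: ideal_power.simps)
qed

text \<open>The left factor \<open>s\<close> of the two-sided condition is the one hidden in the
  membership of \<open>x \<otimes> c\<close> in \<open>tors i\<close>.\<close>

lemma right_mult_injective_iff_two_sided:
  "right_mult_injective R i \<longleftrightarrow> two_sided_torsion_condition R i"
  unfolding right_mult_injective_iff two_sided_torsion_condition_iff
proof (intro iffI ballI impI)
  fix x s c assume h: "\<forall>c\<in>reg_mod. \<forall>x\<in>rad_power i. x \<otimes> c \<in> tors i \<longrightarrow> x \<in> tors i"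
    and x: "x \<in> rad_power i" and sc: "s \<in> reg_mod" "c \<in> reg_mod" and m: "s \<otimes> x \<otimes> c \<in> rad_power (Suc i)"
  note cl = reg_mod_closed[OF sc(1)] reg_mod_closed[OF sc(2)] rad_power_closed[OF x]
  have "s \<otimes> (x \<otimes> c) \<in> rad_power (Suc i)" using m cl by (simp add: m_assoc del: ideal_power.simps)
  then have "x \<otimes> c \<in> tors i" using rad_power_right[OF x cl(2)] sc(1) unfolding tors_def by blast
  then show "x \<in> tors i" using h x sc(2) by blast
next
  fix c x assume h: "\<forall>x\<in>rad_power i. \<forall>s\<in>reg_mod. \<forall>c\<in>reg_mod. s \<otimes> x \<otimes> c \<in> rad_power (Suc i) \<longrightarrow> x \<in> tors i"
    and c: "c \<in> reg_mod" and x: "x \<in> rad_power i" and t: "x \<otimes> c \<in> tors i"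
  obtain s where s: "s \<in> reg_mod" "s \<otimes> (x \<otimes> c) \<in> rad_power (Suc i)" using t by (auto simp: tors_def)
  then have "s \<otimes> x \<otimes> c \<in> rad_power (Suc i)"
    using reg_mod_closed[OF s(1)] reg_mod_closed[OF c] rad_power_closed[OF x] by (simp add: m_assoc del: ideal_power.simps)
  then show "x \<in> tors i" using h x s(1) c by blast
qed

text \<open>From right to left, the factor \<open>s\<close> witnessing that
  \<open>x \<otimes> c\<close> is torsion is moved onto \<open>x\<close>. The right-hand condition
  makes \<open>s \<otimes> x\<close> torsion, and \<open>tors i\<close> is saturated.\<close>

lemma right_mult_injective_iff_right:
  "right_mult_injective R i \<longleftrightarrow> right_torsion_condition R i"
  unfolding right_mult_injective_iff right_torsion_condition_iff
proof (intro iffI ballI impI)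
  fix x c assume h: "\<forall>c\<in>reg_mod. \<forall>x\<in>rad_power i. x \<otimes> c \<in> tors i \<longrightarrow> x \<in> tors i"
    and "x \<in> rad_power i" "c \<in> reg_mod" "x \<otimes> c \<in> rad_power (Suc i)"
  then show "x \<in> tors i" using rad_power_Suc_tors by blast
next
  fix c x assume h: "\<forall>x\<in>rad_power i. \<forall>c\<in>reg_mod. x \<otimes> c \<in> rad_power (Suc i) \<longrightarrow> x \<in> tors i"
    and c: "c \<in> reg_mod" and x: "x \<in> rad_power i" and t: "x \<otimes> c \<in> tors i"
  obtain s where s: "s \<in> reg_mod" "s \<otimes> (x \<otimes> c) \<in> rad_power (Suc i)" using t by (auto simp: tors_def)
  then have "(s \<otimes> x) \<otimes> c \<in> rad_power (Suc i)"
    using reg_mod_closed[OF s(1)] reg_mod_closed[OF c] rad_power_closed[OF x] by (simp add: m_assoc del: ideal_power.simps)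
  moreover have "s \<otimes> x \<in> rad_power i" by (rule left_ideal_mult[OF rad_power_left_ideal reg_mod_closed[OF s(1)] x])
  ultimately have "s \<otimes> x \<in> tors i" using h c by blast
  then show "x \<in> tors i" by (rule tors_saturated[OF x s(1)])
qed

end

section \<open>Goldie's theorem for the reduced ring, pulled back to \<open>R\<close>\<close>

lemma (in ring) goldie_reduced_flag:
  assumes "left_goldie (reduced_ring R)"
  shows "\<nexists>D x. descending_flag (reduced_ring R) (carrier (reduced_ring R)) {\<zero>\<^bsub>reduced_ring R\<^esub>} D x"
    and "\<nexists>D x. descending_flag R (carrier R) rad D x"
proof -
  interpret S: ring "reduced_ring R" by (rule reduced_ring_ring)
  have n: "no_infinite_direct_sums (reduced_ring R) (left_regular_module (reduced_ring R))"
    using assms by (simp add: left_goldie_def)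
  show "\<nexists>D x. descending_flag (reduced_ring R) (carrier (reduced_ring R)) {\<zero>\<^bsub>reduced_ring R\<^esub>} D x"
    using presented_module.no_infinite_direct_sums_iff[OF S.presented_regular] n by blast
  show "\<nexists>D x. descending_flag R (carrier R) rad D x"
    using presented_module.no_infinite_direct_sums_iff[OF presented_quotient[OF prime_radical_ideal]] n
    unfolding reduced_ring_def by blast
qed

lemma (in ring) goldie_imp_ore_mod:
  assumes g: "left_goldie (reduced_ring R)"
  shows "ore_mod R"
proof
  interpret S: ring "reduced_ring R" by (rule reduced_ring_ring)
  fix c r assume c: "c \<in> reg_mod" and r: "r \<in> carrier R"
  have "residue_class R c \<in> regular_elements (reduced_ring R)" using c unfolding regular_reduced by blast
  moreover have "residue_class R r \<in> carrier (reduced_ring R)" using r residue_surj by blast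
  ultimately obtain X Y where X: "X \<in> regular_elements (reduced_ring R)" "Y \<in> carrier (reduced_ring R)"
    "X \<otimes>\<^bsub>reduced_ring R\<^esub> residue_class R r = Y \<otimes>\<^bsub>reduced_ring R\<^esub> residue_class R c"
    using S.goldie_ore[OF semiprime_reduced _ goldie_reduced_flag(1)[OF g]] g unfolding left_goldie_def by blast
  obtain c' where c': "c' \<in> reg_mod" "X = residue_class R c'" using X(1) unfolding regular_reduced by blast
  obtain r' where r': "r' \<in> carrier R" "Y = residue_class R r'" using X(2) unfolding residue_surj[symmetric] by blast
  note cl = reg_mod_closed[OF c] reg_mod_closed[OF c'(1)]
  have "residue_class R (c' \<otimes> r) = residue_class R (r' \<otimes> c)"
    using X(3) c' r' residue_mult cl r by simp
  then have "c' \<otimes> r \<ominus> r' \<otimes> c \<in> rad" using residue_eq_iff cl r r' by simp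
  then show "\<exists>c'\<in>reg_mod. \<exists>r'\<in>carrier R. c' \<otimes> r \<ominus> r' \<otimes> c \<in> rad" using c' r' by blast
qed

text \<open>The contrapositive is the source of flags: if \<open>L\<close> misses
  \<open>reg_mod\<close>, there is a \<open>b\<close> outside the radical whose left multiples lie
  in \<open>L\<close> only when they lie in the radical.\<close>

lemma (in ring) goldie_essential_reg_mod:
  assumes g: "left_goldie (reduced_ring R)" and L: "left_ideal L R"
    and ess: "\<And>b. b \<in> carrier R \<Longrightarrow> b \<notin> rad \<Longrightarrow> \<exists>r\<in>carrier R. r \<otimes> b \<in> L \<and> r \<otimes> b \<notin> rad"
  shows "\<exists>c\<in>L. c \<in> reg_mod"
proof -
  interpret S: ring "reduced_ring R" by (rule reduced_ring_ring)
  interpret M: presented_module R "reduced_ring R" "left_regular_module (reduced_ring R)" "residue_class R"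
    "residue_class R" "carrier R" rad
    unfolding residue_class_eq reduced_ring_def by (rule presented_quotient[OF prime_radical_ideal])
  have "left_ideal (residue_class R ` L) (reduced_ring R)"
    unfolding left_ideal_def by (rule M.image_submodule[OF L]) (use left_ideal_sub[OF L] in blast)
  moreover have "\<exists>r\<in>carrier (reduced_ring R). r \<otimes>\<^bsub>reduced_ring R\<^esub> X \<in> residue_class R ` L \<and>
      r \<otimes>\<^bsub>reduced_ring R\<^esub> X \<noteq> \<zero>\<^bsub>reduced_ring R\<^esub>"
    if X: "X \<in> carrier (reduced_ring R)" "X \<noteq> \<zero>\<^bsub>reduced_ring R\<^esub>" for X
  proof -
    obtain b where b: "b \<in> carrier R" "X = residue_class R b" using X(1) unfolding residue_surj[symmetric] by blast
    then have "b \<notin> rad" using X(2) residue_zero_iff by blast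
    then obtain r where r: "r \<in> carrier R" "r \<otimes> b \<in> L" "r \<otimes> b \<notin> rad" using ess b by blast
    have "residue_class R r \<otimes>\<^bsub>reduced_ring R\<^esub> X = residue_class R (r \<otimes> b)" using residue_mult r b by simp
    then show ?thesis using r b residue_zero_iff[of "r \<otimes> b"] residue_surj by (metis imageI m_closed)
  qed
  ultimately obtain X where "X \<in> residue_class R ` L" "X \<in> regular_elements (reduced_ring R)"
    using S.goldie_essential_regular[OF semiprime_reduced _ goldie_reduced_flag(1)[OF g], of "residue_class R ` L"] g
    unfolding left_goldie_def by blast
  then show ?thesis using left_ideal_sub[OF L] unfolding regular_mod_radical_def by blast
qed

lemma (in ring) goldie_left_cancellable_reg_mod:
  assumes g: "left_goldie (reduced_ring R)" and c: "c \<in> carrier R"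
    and lc: "\<And>x. x \<in> carrier R \<Longrightarrow> x \<otimes> c \<in> rad \<Longrightarrow> x \<in> rad"
  shows "c \<in> reg_mod"
proof -
  interpret S: ring "reduced_ring R" by (rule reduced_ring_ring)
  have cS: "residue_class R c \<in> carrier (reduced_ring R)" using c residue_surj by blast
  have "X = \<zero>\<^bsub>reduced_ring R\<^esub>"
    if X: "X \<in> carrier (reduced_ring R)" "X \<otimes>\<^bsub>reduced_ring R\<^esub> residue_class R c = \<zero>\<^bsub>reduced_ring R\<^esub>" for X
  proof -
    obtain b where b: "b \<in> carrier R" "X = residue_class R b" using X(1) unfolding residue_surj[symmetric] by blast
    then have "b \<otimes> c \<in> rad" using X(2) residue_mult residue_zero_iff[of "b \<otimes> c"] c by simp
    then show ?thesis using lc b residue_zero_iff by blast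
  qed
  then have "residue_class R c \<in> regular_elements (reduced_ring R)"
    using S.left_cancellable_imp_regular[OF semiprime_reduced _ goldie_reduced_flag(1)[OF g] cS] g
    unfolding left_goldie_def by blast
  then show ?thesis using c by (simp add: regular_mod_radical_def)
qed

section \<open>Existence of a left Artinian left quotient ring\<close>

lemma (in ring) nilpotency_degree_spec:
  assumes I: "nilpotent_ideal I R" and i: "nilpotency_degree I R < i"
  shows "ideal_power R I i = {\<zero>}"
proof -
  have Ii: "ideal I R" using I by (simp add: nilpotent_ideal_def)
  obtain k where k: "ideal_power R I k = {\<zero>}" using I by (auto simp: nilpotent_ideal_def)
  show ?thesis
  proof (cases "carrier R = {\<zero>}")
    \<comment> \<open>In the zero ring the degree is an arbitrary number, but every power is
      zero.\<close>
    case True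
    then show ?thesis using ideal_power_zero[OF Ii, of 0 i] by simp
  next
    case False
    \<comment> \<open>The least vanishing exponent is nonzero outside the zero ring, and the degree
      is its predecessor.\<close>
    define m where "m = (LEAST k. ideal_power R I k = {\<zero>})"
    have m: "ideal_power R I m = {\<zero>}" unfolding m_def by (rule LeastI[of _ k]) (rule k)
    then have "m \<noteq> 0" using False by (metis ideal_power.simps(1))
    then obtain j where j: "m = Suc j" by (cases m) auto
    have ml: "ideal_power R I l \<noteq> {\<zero>}" if "l < m" for l
      using not_less_Least that unfolding m_def by blast
    have "nilpotency_degree I R = j"
      unfolding nilpotency_degree_def
    proof (rule the_equality)
      show "ideal_power R I j \<noteq> {\<zero>} \<and> ideal_power R I (Suc j) = {\<zero>}" using m ml j by blast
      fix l assume l: "ideal_power R I l \<noteq> {\<zero>} \<and> ideal_power R I (Suc l) = {\<zero>}"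
      then have "\<not> Suc l < m" "\<not> m \<le> l" using ml ideal_power_zero[OF Ii m] by blast+
      then show "l = j" using j by simp
    qed
    then show ?thesis using ideal_power_zero[OF Ii m, of i] i j by simp
  qed
qed

text \<open>Conditions (a) to (e) in pulled-back form, with (d) and (e) for every \<open>i\<close>:
  index 0 is \<open>R/rad\<close>, and beyond the nilpotency degree the layers vanish. Inductions
  over the layers thus carry no range condition.\<close>

locale quotient_conditions = ore_mod R for R :: "('a, 'm) ring_scheme" (structure) +
  assumes goldie: "left_goldie (reduced_ring R)"
    and nilpotent: "nilpotent_ideal (prime_radical R) R"
    and reg_mod_regular: "regular_mod_radical R \<subseteq> regular_elements R"
    and no_flag: "\<not> descending_flag R (ideal_power R (prime_radical R) i) (tors i) D x"
    and torsion_right: "c \<in> regular_mod_radical R \<Longrightarrow> y \<in> ideal_power R (prime_radical R) i \<Longrightarrow>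
      y \<otimes> c \<in> tors i \<Longrightarrow> y \<in> tors i"
begin

lemma rad_power_eventually_zero:
  obtains K where "rad_power K = {\<zero>}"
  using nilpotent by (auto simp: nilpotent_ideal_def)

lemma torsion_right_pow:
  assumes c: "c \<in> reg_mod" and y: "y \<in> rad_power i" "y \<otimes> c [^] (k::nat) \<in> tors i"
  shows "y \<in> tors i"
  using y(2)
proof (induction k)
  case 0
  then show ?case using rad_power_closed[OF y(1)] by simp
next
  case (Suc k)
  note cl = reg_mod_closed[OF c] rad_power_closed[OF y(1)]
  have "(y \<otimes> c [^] k) \<otimes> c \<in> tors i" using Suc.prems cl by (simp add: m_assoc)
  then have "y \<otimes> c [^] k \<in> tors i" using torsion_right[OF c rad_power_right[OF y(1)]] cl by simp
  then show ?case by (rule Suc.IH)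
qed

text \<open>If the left ideal of all \<open>s\<close> with \<open>s w \<in> \<ff>\<^sub>i c\<close> were not essential modulo the radical, then \<open>b w c\<^sup>k\<close>
  (\<open>k \<in> \<nat>\<close>) would give a flag in \<open>\<ff>\<^sub>i\<close> with respect to the submodules \<open>\<ff>\<^sub>i c\<^sup>k\<close>.\<close>

lemma ore_step:
  assumes c: "c \<in> reg_mod" and w: "w \<in> rad_power i"
  shows "\<exists>s\<in>reg_mod. \<exists>v\<in>rad_power i. s \<otimes> w \<ominus> v \<otimes> c \<in> tors i"
proof -
  note cc = reg_mod_closed[OF c] and wc = rad_power_closed[OF w]
  \<comment> \<open>\<open>E k\<close> is the preimage in \<open>rad_power i\<close> of the right
    multiples by \<open>c [^] k\<close> in the torsion-free layer.\<close>
  define E where "E k = {x \<oplus> t | x t. x \<in> (\<lambda>v. v \<otimes> c [^] (k::nat)) ` rad_power i \<and> t \<in> tors i}" for k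
  have El: "left_ideal (E k) R" for k
    unfolding E_def using left_ideal_plus[OF left_ideal_right_multiples[OF rad_power_left_ideal] tors_left_ideal] cc by simp
  have mem: "y \<in> E k \<longleftrightarrow> (\<exists>v\<in>rad_power i. y \<ominus> v \<otimes> c [^] k \<in> tors i)" if y: "y \<in> carrier R" for y k
  proof
    assume "y \<in> E k"
    then obtain v t where v: "v \<in> rad_power i" "t \<in> tors i" "y = v \<otimes> c [^] k \<oplus> t" by (auto simp: E_def)
    note cl = rad_power_closed[OF v(1)] left_ideal_sub[OF tors_left_ideal v(2)]
    have "y \<ominus> v \<otimes> c [^] k = t" unfolding v(3) by (rule diff_add_eq) (use cl cc in auto)
    then have "y \<ominus> v \<otimes> c [^] k \<in> tors i" using v(2) by simp
    then show "\<exists>v\<in>rad_power i. y \<ominus> v \<otimes> c [^] k \<in> tors i" using v(1) by blast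
  next
    assume "\<exists>v\<in>rad_power i. y \<ominus> v \<otimes> c [^] k \<in> tors i"
    then obtain v where v: "v \<in> rad_power i" "y \<ominus> v \<otimes> c [^] k \<in> tors i" by blast
    have "y = v \<otimes> c [^] k \<oplus> (y \<ominus> v \<otimes> c [^] k)"
      by (rule add_diff_eq[symmetric]) (use rad_power_closed[OF v(1)] cc y in auto)
    then show "y \<in> E k" using v unfolding E_def by blast
  qed
  define J where "J = {s \<in> carrier R. s \<otimes> w \<in> E 1}"
  have Jl: "left_ideal J R" unfolding J_def by (rule left_ideal_colon[OF El wc])
  have z: "\<zero> \<in> tors i" "\<zero> \<in> rad_power i"
    by (rule left_ideal_zero[OF tors_left_ideal], rule left_ideal_zero[OF rad_power_left_ideal])
  have TE: "tors i \<subseteq> E k" for k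
  proof
    fix t assume t: "t \<in> tors i"
    have "\<zero> \<otimes> c [^] k \<oplus> t = t" using left_ideal_sub[OF tors_left_ideal t] cc by simp
    then show "t \<in> E k" using t z unfolding E_def by (metis (mono_tags, lifting) image_eqI mem_Collect_eq)
  qed
  have "\<exists>r\<in>carrier R. r \<otimes> b \<in> J \<and> r \<otimes> b \<notin> rad" if b: "b \<in> carrier R" "b \<notin> rad" for b
  proof (rule ccontr)
    assume "\<not> ?thesis"
    then have neg: "r \<otimes> b \<in> rad" if "r \<in> carrier R" "r \<otimes> b \<otimes> w \<in> E 1" for r
    proof -
      have "r \<otimes> b \<in> J" using that b(1) by (simp add: J_def)
      then show ?thesis using \<open>\<not> (\<exists>r\<in>carrier R. r \<otimes> b \<in> J \<and> r \<otimes> b \<notin> rad)\<close> that(1) by blast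
    qed
    have bw: "b \<otimes> w \<in> rad_power i" by (rule left_ideal_mult[OF rad_power_left_ideal b(1) w])
    have "descending_flag R (rad_power i) (tors i) E (\<lambda>k. (b \<otimes> w) \<otimes> c [^] k)"
    proof (rule descending_flagI)
      show "left_ideal (E k) R" "tors i \<subseteq> E k" for k by (rule El, rule TE)
      show "E k \<subseteq> rad_power i" for k
      proof
        fix y assume "y \<in> E k"
        then obtain v t where v: "v \<in> rad_power i" "t \<in> tors i" "y = v \<otimes> c [^] k \<oplus> t" by (auto simp: E_def)
        have "v \<otimes> c [^] k \<in> rad_power i" by (rule rad_power_right[OF v(1)]) (use cc in simp)
        moreover have "t \<in> rad_power i" using v(2) tors_sub by blast
        ultimately show "y \<in> rad_power i" unfolding v(3) by (rule left_ideal_add[OF rad_power_left_ideal])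
      qed
      show "E (Suc k) \<subseteq> E k" for k
      proof
        fix y assume y: "y \<in> E (Suc k)"
        then obtain v t where v: "v \<in> rad_power i" "t \<in> tors i" "y = v \<otimes> c [^] Suc k \<oplus> t" by (auto simp: E_def)
        have "v \<otimes> c [^] Suc k = (v \<otimes> c) \<otimes> c [^] k"
          unfolding nat_pow_Suc2[OF cc] using rad_power_closed[OF v(1)] cc by (simp add: m_assoc)
        then show "y \<in> E k" using v rad_power_right[OF v(1) cc] unfolding E_def by blast
      qed
      show "b \<otimes> w \<otimes> c [^] k \<in> E k" for k
      proof -
        have "b \<otimes> w \<otimes> c [^] k = b \<otimes> w \<otimes> c [^] k \<oplus> \<zero>" using rad_power_closed[OF bw] cc by simp
        then show ?thesis using bw z unfolding E_def by blast
      qed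
      show "b \<otimes> w \<otimes> c [^] k \<notin> tors i" for k :: nat
      proof
        assume "b \<otimes> w \<otimes> c [^] k \<in> tors i"
        then have "b \<otimes> w \<in> tors i" by (rule torsion_right_pow[OF c bw])
        then have "\<one> \<otimes> b \<otimes> w \<in> E 1" using TE b by auto
        then show False using neg[of \<one>] b by simp
      qed
      fix k r assume r: "r \<in> carrier R" "r \<otimes> (b \<otimes> w \<otimes> c [^] k) \<in> E (Suc k)"
      have rbw: "r \<otimes> b \<otimes> w \<in> rad_power i" using left_ideal_mult[OF rad_power_left_ideal _ w, of "r \<otimes> b"] r(1) b(1) by simp
      have rbwc: "r \<otimes> b \<otimes> w \<in> carrier R" using rad_power_closed[OF rbw] .
      have e: "r \<otimes> (b \<otimes> w \<otimes> c [^] k) = (r \<otimes> b \<otimes> w) \<otimes> c [^] k" using r(1) b wc cc by (simp add: m_assoc)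
      have "(r \<otimes> b \<otimes> w) \<otimes> c [^] k \<in> E (Suc k)" using r(2) unfolding e .
      then obtain v where v: "v \<in> rad_power i" "(r \<otimes> b \<otimes> w) \<otimes> c [^] k \<ominus> v \<otimes> c [^] Suc k \<in> tors i"
        using mem[of "(r \<otimes> b \<otimes> w) \<otimes> c [^] k" "Suc k"] rbwc cc by auto
      note vc = rad_power_closed[OF v(1)]
      have "v \<otimes> c [^] Suc k = (v \<otimes> c) \<otimes> c [^] k"
        unfolding nat_pow_Suc2[OF cc] using vc cc by (simp add: m_assoc)
      then have "(r \<otimes> b \<otimes> w) \<otimes> c [^] k \<ominus> v \<otimes> c [^] Suc k = (r \<otimes> b \<otimes> w \<ominus> v \<otimes> c) \<otimes> c [^] k"
        using rbwc vc cc by (simp add: minus_eq l_distr l_minus del: nat_pow_Suc)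
      \<comment> \<open>Injectivity of right multiplication cancels \<open>c [^] k\<close> modulo
        torsion. This reduces level \<open>k\<close> to level 0, where the choice of
        \<open>b\<close> applies.\<close>
      then have "(r \<otimes> b \<otimes> w \<ominus> v \<otimes> c) \<otimes> c [^] k \<in> tors i" using v(2) by simp
      then have "r \<otimes> b \<otimes> w \<ominus> v \<otimes> c \<in> tors i"
        by (rule torsion_right_pow[OF c left_ideal_diff[OF rad_power_left_ideal rbw rad_power_right[OF v(1) cc]]])
      then have "r \<otimes> b \<otimes> w \<in> E 1" using mem[OF rbwc, of 1] v(1) cc by auto
      then have "r \<otimes> b \<in> rad" by (rule neg[OF r(1)])
      then have "r \<otimes> b \<otimes> w \<in> tors i" using rad_mult_rad_power[OF _ w] rad_power_Suc_tors by blast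
      then show "r \<otimes> (b \<otimes> w \<otimes> c [^] k) \<in> tors i" unfolding e using tors_right cc by simp
    qed
    then show False using no_flag by blast
  qed
  then obtain s where s: "s \<in> J" "s \<in> reg_mod" using goldie_essential_reg_mod[OF goldie Jl] by blast
  then have "s \<otimes> w \<in> E 1" by (simp add: J_def)
  then obtain v where "v \<in> rad_power i" "s \<otimes> w \<ominus> v \<otimes> c [^] (1::nat) \<in> tors i"
    using mem[of "s \<otimes> w" 1] reg_mod_closed[OF s(2)] wc by auto
  then show ?thesis using s(2) cc by auto
qed

text \<open>Successive approximation along the powers of the radical: an error in
  \<open>rad_power i\<close> is corrected by \<open>ore_step\<close> up to torsion, and a further
  left factor clears the torsion into \<open>rad_power (Suc i)\<close>. Nilpotence ends the process
  with error zero.\<close>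

lemma exact_ore:
  assumes c: "c \<in> reg_mod" and r: "r \<in> carrier R"
  shows "\<exists>c'\<in>reg_mod. \<exists>r'\<in>carrier R. c' \<otimes> r = r' \<otimes> c"
proof -
  note cc = reg_mod_closed[OF c]
  have "\<exists>c'\<in>reg_mod. \<exists>a\<in>carrier R. c' \<otimes> r \<ominus> a \<otimes> c \<in> rad_power i" for i
  proof (induction i)
    \<comment> \<open>\<open>rad_power 0\<close> is the whole ring, so any pair can serve as the
      start.\<close>
    case 0
    show ?case using reg_mod_one r cc by (intro bexI[of _ \<one>] bexI[of _ \<zero>]) auto
  next
    case (Suc i)
    then obtain c' a where c': "c' \<in> reg_mod" "a \<in> carrier R" "c' \<otimes> r \<ominus> a \<otimes> c \<in> rad_power i" by blast
    define w where "w = c' \<otimes> r \<ominus> a \<otimes> c"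
    obtain s v where s: "s \<in> reg_mod" "v \<in> rad_power i" "s \<otimes> w \<ominus> v \<otimes> c \<in> tors i"
      using ore_step[OF c, of w i] c' unfolding w_def by blast
    then obtain t where t: "t \<in> reg_mod" "t \<otimes> (s \<otimes> w \<ominus> v \<otimes> c) \<in> rad_power (Suc i)" by (auto simp: tors_def)
    note cl = reg_mod_closed[OF c'(1)] reg_mod_closed[OF s(1)] reg_mod_closed[OF t(1)] rad_power_closed[OF s(2)]
    have "t \<otimes> (s \<otimes> w \<ominus> v \<otimes> c) = (t \<otimes> (s \<otimes> c')) \<otimes> r \<ominus> (t \<otimes> (s \<otimes> a) \<oplus> t \<otimes> v) \<otimes> c"
      unfolding w_def using cl c'(2) r cc
      by (simp add: minus_eq r_distr l_distr r_minus l_minus minus_add m_assoc a_assoc)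
    moreover have "t \<otimes> (s \<otimes> c') \<in> reg_mod" using reg_mod_mult t s c' by blast
    moreover have "t \<otimes> (s \<otimes> a) \<oplus> t \<otimes> v \<in> carrier R" using cl c' by simp
    ultimately show ?case using t(2) by metis
  qed
  moreover obtain K where "rad_power K = {\<zero>}" by (rule rad_power_eventually_zero)
  ultimately obtain c' a where "c' \<in> reg_mod" "a \<in> carrier R" "c' \<otimes> r \<ominus> a \<otimes> c = \<zero>" by blast
  then show ?thesis using diff_zero_iff[of "c' \<otimes> r" "a \<otimes> c"] reg_mod_closed r cc by (metis m_closed)
qed

text \<open>The analogue of \<open>saturated\<close> for \<open>reg_mod\<close>. That regular
  elements belong to \<open>reg_mod\<close> is proved only in \<open>regular_imp_reg_mod\<close>, by
  means of chains of such left ideals.\<close>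

definition sat_mod :: "'a set \<Rightarrow> bool" where
  "sat_mod I \<longleftrightarrow> (\<forall>c\<in>reg_mod. \<forall>x\<in>carrier R. c \<otimes> x \<in> I \<longrightarrow> x \<in> I)"

text \<open>At a strict step choose \<open>y\<close> in the larger member only. By saturation the
  left ideal of all \<open>r\<close> with \<open>r \<otimes> y\<close> in the smaller member misses
  \<open>reg_mod\<close>, so by Goldie's theorem some \<open>b\<close> outside \<open>rad\<close>
  has multiples in it only inside \<open>rad\<close>. Then \<open>b \<otimes> y\<close> is the next
  element of a flag.\<close>

lemma layer_chain_stable:
  assumes X: "\<And>k. left_ideal (X k) R" "\<And>k. X k \<subseteq> rad_power i" "\<And>k. tors i \<subseteq> X k" "\<And>k. X (Suc k) \<subseteq> X k"
    and sat: "\<And>k c x. c \<in> reg_mod \<Longrightarrow> x \<in> rad_power i \<Longrightarrow> c \<otimes> x \<in> X k \<Longrightarrow> x \<in> X k"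
  shows "\<exists>n. \<forall>k\<ge>n. X k = X n"
proof (rule ccontr)
  assume ns: "\<not> ?thesis"
  obtain g :: "nat \<Rightarrow> nat" where "strict_mono g" and g: "\<And>k. X (g (Suc k)) \<subset> X (g k)"
    using strict_subchain[of X, OF X(4) ns] by blast
  have "\<exists>z. z \<in> X (g k) \<and> z \<notin> tors i \<and> (\<forall>r\<in>carrier R. r \<otimes> z \<in> X (g (Suc k)) \<longrightarrow> r \<otimes> z \<in> tors i)" for k
  proof -
    obtain y where y: "y \<in> X (g k)" "y \<notin> X (g (Suc k))" using g by blast
    have yp: "y \<in> rad_power i" using X(2) y by blast
    note yc = rad_power_closed[OF yp]
    define J where "J = {r \<in> carrier R. r \<otimes> y \<in> X (g (Suc k))}"
    have Jl: "left_ideal J R" unfolding J_def by (rule left_ideal_colon[OF X(1) yc])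
    have "c \<notin> J" if "c \<in> reg_mod" for c using sat[OF that yp] y(2) by (auto simp: J_def)
    then obtain b where b: "b \<in> carrier R" "b \<notin> rad" "\<And>r. r \<in> carrier R \<Longrightarrow> r \<otimes> b \<in> J \<Longrightarrow> r \<otimes> b \<in> rad"
      using goldie_essential_reg_mod[OF goldie Jl] by blast
    define z where "z = b \<otimes> y"
    have "z \<in> X (g k)" unfolding z_def by (rule left_ideal_mult[OF X(1) b(1) y(1)])
    moreover have "z \<notin> tors i"
    proof
      assume "z \<in> tors i"
      then have "\<one> \<otimes> b \<in> J" using X(3) b(1) by (auto simp: J_def z_def)
      then have "\<one> \<otimes> b \<in> rad" using b(3) by blast
      then show False using b by simp
    qed
    moreover have "r \<otimes> z \<in> tors i" if r: "r \<in> carrier R" "r \<otimes> z \<in> X (g (Suc k))" for r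
    proof -
      have "r \<otimes> b \<in> J" using r b(1) yc by (simp add: J_def z_def m_assoc)
      then have "r \<otimes> b \<otimes> y \<in> tors i" using b(3)[OF r(1)] rad_mult_rad_power[OF _ yp] rad_power_Suc_tors by blast
      then show ?thesis using r b(1) yc by (simp add: z_def m_assoc)
    qed
    ultimately show ?thesis by blast
  qed
  then obtain z where z: "\<And>k. z k \<in> X (g k)" "\<And>k. z k \<notin> tors i"
    "\<And>k r. r \<in> carrier R \<Longrightarrow> r \<otimes> z k \<in> X (g (Suc k)) \<Longrightarrow> r \<otimes> z k \<in> tors i" by metis
  have "descending_flag R (rad_power i) (tors i) (\<lambda>k. X (g k)) z"
    by (rule descending_flagI) (use X(1-3) g[THEN psubset_imp_subset] z in blast)+
  then show False using no_flag by blast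
qed

text \<open>The chain is compared layer by layer. Nilpotence leaves finitely many layers to
  consider, so their stabilisation indices have a maximum. Agreement in the layers gives equality up
  to a left factor from \<open>reg_mod\<close>, and saturation removes that factor.\<close>

lemma sat_mod_chain_stable:
  assumes I: "\<And>k. left_ideal (I k) R" "\<And>k. sat_mod (I k)" "\<And>k. I (Suc k) \<subseteq> I k"
  shows "\<exists>n. \<forall>k\<ge>n. I k = I n"
proof -
  \<comment> \<open>\<open>X i k\<close> is the preimage of the saturated image of
    \<open>I k \<inter> rad_power i\<close> in layer \<open>i\<close>. The element \<open>b\<close>
    lies in \<open>rad_power i\<close> automatically, since \<open>c \<otimes> x\<close> and the
    difference do.\<close>
  define X where "X i k = {x \<in> rad_power i. \<exists>c\<in>reg_mod. \<exists>b\<in>I k. c \<otimes> x \<ominus> b \<in> rad_power (Suc i)}" for i k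
  have bc: "b \<in> carrier R" if "b \<in> I k" for b k using left_ideal_sub[OF I(1) that] .
  \<comment> \<open>A witness \<open>c\<close> can be multiplied by any \<open>r\<close> on the
    left, which is how two witnesses are brought to a common one.\<close>
  have mult: "\<exists>b'\<in>I k. (d \<otimes> x) \<ominus> b' \<in> rad_power (Suc i)"
    if "c \<in> reg_mod" "b \<in> I k" "c \<otimes> x \<ominus> b \<in> rad_power (Suc i)" "x \<in> carrier R" "d = r \<otimes> c" "r \<in> carrier R" for c b k x i d r
  proof (intro bexI)
    have cl: "c \<in> carrier R" "b \<in> carrier R" using reg_mod_closed that(1) bc[OF that(2)] by auto
    have "r \<otimes> (c \<otimes> x \<ominus> b) = d \<otimes> x \<ominus> r \<otimes> b" using cl that(4-6) by (simp add: minus_eq r_distr r_minus m_assoc)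
    then show "d \<otimes> x \<ominus> r \<otimes> b \<in> rad_power (Suc i)" using left_ideal_mult[OF rad_power_left_ideal that(6,3)] by simp
    show "r \<otimes> b \<in> I k" by (rule left_ideal_mult[OF I(1) that(6,2)])
  qed
  have XI: "x \<in> X i k" if "x \<in> rad_power i" "c \<in> reg_mod" "b \<in> I k" "c \<otimes> x \<ominus> b \<in> rad_power (Suc i)" for x i k c b
    using that unfolding X_def by blast
  have Xl: "left_ideal (X i k) R" for i k
  proof (rule left_idealI)
    show "X i k \<subseteq> carrier R" using rad_power_closed by (auto simp: X_def)
    show "\<zero> \<in> X i k"
      by (rule XI[OF left_ideal_zero[OF rad_power_left_ideal] reg_mod_one left_ideal_zero[OF I(1)]])
        (use left_ideal_zero[OF rad_power_left_ideal, of "Suc i"] in \<open>simp add: minus_eq del: ideal_power.simps\<close>)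
    show "x \<oplus> y \<in> X i k" if xy: "x \<in> X i k" "y \<in> X i k" for x y
    proof -
      obtain c b where c: "c \<in> reg_mod" "b \<in> I k" "c \<otimes> x \<ominus> b \<in> rad_power (Suc i)" using xy by (auto simp: X_def)
      obtain d b' where d: "d \<in> reg_mod" "b' \<in> I k" "d \<otimes> y \<ominus> b' \<in> rad_power (Suc i)" using xy by (auto simp: X_def)
      have xp: "x \<in> rad_power i" "y \<in> rad_power i" using xy by (auto simp: X_def)
      obtain s t where s: "s \<in> reg_mod" "t \<in> carrier R" "s \<otimes> d = t \<otimes> c" using exact_ore[OF c(1) reg_mod_closed[OF d(1)]] by blast
      note cl = rad_power_closed[OF xp(1)] rad_power_closed[OF xp(2)] reg_mod_closed[OF s(1)] reg_mod_closed[OF d(1)]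
      obtain u where u: "u \<in> I k" "(s \<otimes> d) \<otimes> x \<ominus> u \<in> rad_power (Suc i)" using mult[OF c cl(1) s(3,2)] by blast
      obtain v where v: "v \<in> I k" "(s \<otimes> d) \<otimes> y \<ominus> v \<in> rad_power (Suc i)" using mult[OF d cl(2) refl cl(3)] by blast
      have "(s \<otimes> d) \<otimes> (x \<oplus> y) \<ominus> (u \<oplus> v) = ((s \<otimes> d) \<otimes> x \<ominus> u) \<oplus> ((s \<otimes> d) \<otimes> y \<ominus> v)"
        using cl bc[OF u(1)] bc[OF v(1)] by (simp add: minus_eq minus_add r_distr a_ac)
      then have "(s \<otimes> d) \<otimes> (x \<oplus> y) \<ominus> (u \<oplus> v) \<in> rad_power (Suc i)"
        using left_ideal_add[OF rad_power_left_ideal u(2) v(2)] by simp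
      then show ?thesis
        using XI left_ideal_add[OF rad_power_left_ideal xp] reg_mod_mult[OF s(1) d(1)] left_ideal_add[OF I(1) u(1) v(1)] by blast
    qed
    show "r \<otimes> x \<in> X i k" if r: "r \<in> carrier R" and x: "x \<in> X i k" for r x
    proof -
      obtain c b where c: "c \<in> reg_mod" "b \<in> I k" "c \<otimes> x \<ominus> b \<in> rad_power (Suc i)" using x by (auto simp: X_def)
      have xp: "x \<in> rad_power i" using x by (auto simp: X_def)
      obtain s t where s: "s \<in> reg_mod" "t \<in> carrier R" "s \<otimes> r = t \<otimes> c" using exact_ore[OF c(1) r] by blast
      note cl = rad_power_closed[OF xp] reg_mod_closed[OF s(1)]
      obtain u where u: "u \<in> I k" "(s \<otimes> r) \<otimes> x \<ominus> u \<in> rad_power (Suc i)" using mult[OF c cl(1) s(3,2)] by blast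
      then have "s \<otimes> (r \<otimes> x) \<ominus> u \<in> rad_power (Suc i)" using cl r by (simp add: m_assoc del: ideal_power.simps)
      then show ?thesis using XI[OF left_ideal_mult[OF rad_power_left_ideal r xp] s(1) u(1)] by blast
    qed
  qed
  have "\<exists>n. \<forall>k\<ge>n. X i k = X i n" for i
  proof (rule layer_chain_stable)
    show "left_ideal (X i k) R" "X i k \<subseteq> rad_power i" for k by (rule Xl, auto simp: X_def)
    show "tors i \<subseteq> X i k" for k
    proof
      fix x assume x: "x \<in> tors i"
      then obtain c where c: "c \<in> reg_mod" "c \<otimes> x \<in> rad_power (Suc i)" "x \<in> rad_power i" by (auto simp: tors_def)
      have "c \<otimes> x \<ominus> \<zero> \<in> rad_power (Suc i)"
        using c reg_mod_closed[OF c(1)] rad_power_closed[OF c(3)] by (simp add: minus_eq del: ideal_power.simps)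
      then show "x \<in> X i k" using XI[OF c(3,1) left_ideal_zero[OF I(1)]] by blast
    qed
    show "X i (Suc k) \<subseteq> X i k" for k using I(3)[of k] unfolding X_def by blast
    show "x \<in> X i k" if c: "c \<in> reg_mod" and x: "x \<in> rad_power i" and cx: "c \<otimes> x \<in> X i k" for k c x
    proof -
      obtain d b where d: "d \<in> reg_mod" "b \<in> I k" "d \<otimes> (c \<otimes> x) \<ominus> b \<in> rad_power (Suc i)" using cx by (auto simp: X_def)
      then have "(d \<otimes> c) \<otimes> x \<ominus> b \<in> rad_power (Suc i)"
        using reg_mod_closed[OF c] reg_mod_closed[OF d(1)] rad_power_closed[OF x] by (simp add: m_assoc del: ideal_power.simps)
      then show ?thesis using XI[OF x reg_mod_mult[OF d(1) c] d(2)] by blast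
    qed
  qed
  then obtain f where f: "\<And>i k. f i \<le> k \<Longrightarrow> X i k = X i (f i)" by metis
  obtain K where K: "rad_power K = {\<zero>}" by (rule rad_power_eventually_zero)
  define n where "n = Max (f ` {..K})"
  have fn: "f i \<le> n" if "i \<le> K" for i unfolding n_def using that by (intro Max_ge) auto
  have anti: "I l \<subseteq> I k" if "k \<le> l" for k l
    using that by (induction l rule: dec_induct) (use I(3) in blast)+
  have "I n \<subseteq> I k" if k: "n \<le> k" for k
  proof
    fix x assume x: "x \<in> I n"
    note xc = bc[OF x]
    \<comment> \<open>Equality of the layers of \<open>I n\<close> and \<open>I k\<close> pushes \<open>x \<in> I n\<close> into \<open>I k\<close> modulo higher and higher powers.\<close>
    have "\<exists>c\<in>reg_mod. \<exists>b\<in>I k. c \<otimes> x \<ominus> b \<in> rad_power i" if "i \<le> K" for i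
      using that
    proof (induction i)
      case 0
      show ?case using reg_mod_one left_ideal_zero[OF I(1)[of k]] xc by (intro bexI[of _ \<one>] bexI[of _ \<zero>]) auto
    next
      case (Suc i)
      then obtain c b where c: "c \<in> reg_mod" "b \<in> I k" "c \<otimes> x \<ominus> b \<in> rad_power i" by auto
      define w where "w = c \<otimes> x \<ominus> b"
      have wn: "w \<in> I n" unfolding w_def
        using left_ideal_diff[OF I(1) left_ideal_mult[OF I(1) reg_mod_closed[OF c(1)] x]] anti[OF k] c(2) by blast
      have wp: "w \<in> rad_power i" using c(3) by (simp add: w_def)
      note wc = bc[OF wn]
      have "\<one> \<otimes> w \<ominus> w = \<zero>" using wc by (simp add: minus_eq r_neg)
      then have "w \<in> X i n" using XI[OF wp reg_mod_one wn] left_ideal_zero[OF rad_power_left_ideal, of "Suc i"] by simp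
      moreover have "X i n = X i k" using f[of i n] f[of i k] fn[of i] k Suc.prems by simp
      ultimately have "w \<in> X i k" by blast
      then obtain d b' where d: "d \<in> reg_mod" "b' \<in> I k" "d \<otimes> w \<ominus> b' \<in> rad_power (Suc i)"
        unfolding X_def by blast
      note cl = reg_mod_closed[OF c(1)] reg_mod_closed[OF d(1)] bc[OF c(2)] bc[OF d(2)] xc
      have "d \<otimes> w \<ominus> b' = (d \<otimes> c) \<otimes> x \<ominus> (d \<otimes> b \<oplus> b')"
        unfolding w_def using cl by (simp add: minus_eq r_distr r_minus minus_add m_assoc a_assoc)
      moreover have "d \<otimes> b \<oplus> b' \<in> I k"
        by (rule left_ideal_add[OF I(1) left_ideal_mult[OF I(1) cl(2) c(2)] d(2)])
      ultimately show ?case using d(3) reg_mod_mult[OF d(1) c(1)] by metis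
    qed
    then obtain c b where c: "c \<in> reg_mod" "b \<in> I k" "c \<otimes> x \<ominus> b \<in> rad_power K" by blast
    then have "c \<otimes> x = b" using K diff_zero_iff[of "c \<otimes> x" b] reg_mod_closed[OF c(1)] xc bc[OF c(2)] by simp
    then show "x \<in> I k" using I(2)[of k] c xc unfolding sat_mod_def by blast
  qed
  then show ?thesis using anti by blast
qed

text \<open>Stabilisation of the saturations gives
  \<open>s \<otimes> c [^] n = a \<otimes> c [^] Suc n\<close> with \<open>s\<close> in
  \<open>reg_mod\<close>, and cancelling the power leaves \<open>s = a \<otimes> c\<close>. Right
  multiplication by \<open>a\<close> is injective modulo \<open>rad\<close>, so Goldie's theorem
  puts \<open>a\<close> into \<open>reg_mod\<close>; the other factor \<open>c\<close>
  follows.\<close>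

lemma regular_imp_reg_mod:
  assumes c: "c \<in> regular_elements R"
  shows "c \<in> reg_mod"
proof -
  have cc: "c \<in> carrier R" using regular_closed[OF c] .
  define L where "L k = (\<lambda>r. r \<otimes> c [^] (k::nat)) ` carrier R" for k
  have Ll: "left_ideal (L k) R" for k unfolding L_def
    by (rule left_ideal_right_multiples[OF left_ideal_carrier]) (use cc in simp)
  define I where "I k = {x \<in> carrier R. \<exists>s\<in>reg_mod. s \<otimes> x \<in> L k}" for k
  have Il: "left_ideal (I k) R" for k
  proof (rule left_idealI)
    show "I k \<subseteq> carrier R" by (auto simp: I_def)
    show "\<zero> \<in> I k" using left_ideal_zero[OF Ll] reg_mod_one by (auto simp: I_def intro!: bexI[of _ \<one>])
    show "x \<oplus> y \<in> I k" if xy: "x \<in> I k" "y \<in> I k" for x y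
    proof -
      obtain s where s: "s \<in> reg_mod" "s \<otimes> x \<in> L k" using xy by (auto simp: I_def)
      obtain t where t: "t \<in> reg_mod" "t \<otimes> y \<in> L k" using xy by (auto simp: I_def)
      have xc: "x \<in> carrier R" "y \<in> carrier R" using xy by (auto simp: I_def)
      obtain p q where p: "p \<in> reg_mod" "q \<in> carrier R" "p \<otimes> t = q \<otimes> s" using exact_ore[OF s(1) reg_mod_closed[OF t(1)]] by blast
      note cl = reg_mod_closed[OF s(1)] reg_mod_closed[OF t(1)] reg_mod_closed[OF p(1)]
      have "(p \<otimes> t) \<otimes> x = q \<otimes> (s \<otimes> x)" unfolding p(3) using cl p(2) xc by (simp add: m_assoc)
      moreover have "(p \<otimes> t) \<otimes> y = p \<otimes> (t \<otimes> y)" using cl xc by (simp add: m_assoc)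
      ultimately have "(p \<otimes> t) \<otimes> (x \<oplus> y) \<in> L k"
        using left_ideal_add[OF Ll left_ideal_mult[OF Ll p(2) s(2)] left_ideal_mult[OF Ll cl(3) t(2)]] cl xc
        by (simp add: r_distr)
      then show ?thesis using reg_mod_mult[OF p(1) t(1)] xc by (auto simp: I_def)
    qed
    show "r \<otimes> x \<in> I k" if r: "r \<in> carrier R" and x: "x \<in> I k" for r x
    proof -
      obtain s where s: "s \<in> reg_mod" "s \<otimes> x \<in> L k" and xc: "x \<in> carrier R" using x by (auto simp: I_def)
      obtain p q where p: "p \<in> reg_mod" "q \<in> carrier R" "p \<otimes> r = q \<otimes> s" using exact_ore[OF s(1) r] by blast
      note cl = reg_mod_closed[OF s(1)] reg_mod_closed[OF p(1)]
      have "p \<otimes> (r \<otimes> x) = (p \<otimes> r) \<otimes> x" using cl r xc by (simp add: m_assoc)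
      also have "\<dots> = q \<otimes> (s \<otimes> x)" unfolding p(3) using cl p(2) xc by (simp add: m_assoc)
      finally have "p \<otimes> (r \<otimes> x) \<in> L k" using left_ideal_mult[OF Ll p(2) s(2)] by simp
      then show ?thesis using p(1) r xc by (auto simp: I_def)
    qed
  qed
  have Is: "sat_mod (I k)" for k
    unfolding sat_mod_def
  proof (intro ballI impI)
    fix d x assume d: "d \<in> reg_mod" and x: "x \<in> carrier R" and dx: "d \<otimes> x \<in> I k"
    obtain s where s: "s \<in> reg_mod" "s \<otimes> (d \<otimes> x) \<in> L k" using dx by (auto simp: I_def)
    then have "(s \<otimes> d) \<otimes> x \<in> L k" using reg_mod_closed[OF d] reg_mod_closed[OF s(1)] x by (simp add: m_assoc)
    then show "x \<in> I k" using reg_mod_mult[OF s(1) d] x by (auto simp: I_def)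
  qed
  have "L (Suc k) \<subseteq> L k" for k
  proof
    fix y assume "y \<in> L (Suc k)"
    then obtain r where r: "r \<in> carrier R" "y = r \<otimes> c [^] Suc k" by (auto simp: L_def)
    have "y = (r \<otimes> c) \<otimes> c [^] k" unfolding r(2) nat_pow_Suc2[OF cc] using r(1) cc by (simp add: m_assoc)
    then show "y \<in> L k" using r(1) cc by (auto simp: L_def)
  qed
  then have Id: "I (Suc k) \<subseteq> I k" for k by (auto simp: I_def)
  obtain n where n: "\<And>k. n \<le> k \<Longrightarrow> I k = I n" using sat_mod_chain_stable[of I, OF Il Is Id] by blast
  have cnL: "c [^] n \<in> L n" unfolding L_def by (rule image_eqI[of _ _ \<one>]) (use cc in auto)
  have "\<one> \<otimes> c [^] n \<in> L n" using cnL cc by simp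
  then have "c [^] n \<in> I n" using reg_mod_one cc unfolding I_def by blast
  then have "c [^] n \<in> I (Suc n)" using n[of "Suc n"] by simp
  then obtain s where s: "s \<in> reg_mod" "s \<otimes> c [^] n \<in> L (Suc n)" by (auto simp: I_def)
  then obtain a where a: "a \<in> carrier R" "s \<otimes> c [^] n = a \<otimes> c [^] Suc n" by (auto simp: L_def)
  note sc = reg_mod_closed[OF s(1)]
  have cn: "c [^] k \<in> regular_elements R" for k :: nat
    by (induction k) (use regular_one regular_mult c in auto)
  have "s \<otimes> c [^] n = (a \<otimes> c) \<otimes> c [^] n" unfolding a(2) nat_pow_Suc2[OF cc] using a(1) cc by (simp add: m_assoc)
  then have sac: "s = a \<otimes> c"
    using right_cancel_zero[of "c [^] n" s "a \<otimes> c"] regular_right[OF cn] sc a(1) cc by blast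
  have areg: "a \<in> reg_mod"
  proof (rule goldie_left_cancellable_reg_mod[OF goldie a(1)])
    fix x assume x: "x \<in> carrier R" "x \<otimes> a \<in> rad"
    have "x \<otimes> a \<otimes> c \<in> rad" by (rule ideal_mult_closed(2)[OF prime_radical_ideal x(2) cc])
    then have "x \<otimes> s \<in> rad" unfolding sac using x a cc by (simp add: m_assoc)
    then show "x \<in> rad" by (rule reg_mod_right[OF s(1) x(1)])
  qed
  show ?thesis
    unfolding regular_mod_iff
  proof (intro conjI ballI impI cc)
    fix x assume x: "x \<in> carrier R"
    show "x \<in> rad" if "c \<otimes> x \<in> rad"
    proof -
      have "a \<otimes> (c \<otimes> x) \<in> rad" by (rule ideal_mult_closed(1)[OF prime_radical_ideal that a(1)])
      then have "s \<otimes> x \<in> rad" unfolding sac using x a cc by (simp add: m_assoc)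
      then show ?thesis by (rule reg_mod_left[OF s(1) x])
    qed
    \<comment> \<open>Here \<open>x\<close> stands where \<open>a\<close> should be. An Ore relation
      \<open>t \<otimes> x = y \<otimes> a\<close> turns \<open>t \<otimes> x \<otimes> c\<close>
      into \<open>y \<otimes> s\<close>.\<close>
    show "x \<in> rad" if xc: "x \<otimes> c \<in> rad"
    proof -
      obtain t y where t: "t \<in> reg_mod" "y \<in> carrier R" "t \<otimes> x = y \<otimes> a" using exact_ore[OF areg x] by blast
      note tc = reg_mod_closed[OF t(1)]
      have "t \<otimes> (x \<otimes> c) \<in> rad" by (rule ideal_mult_closed(1)[OF prime_radical_ideal xc tc])
      moreover have "t \<otimes> (x \<otimes> c) = (t \<otimes> x) \<otimes> c" using tc x cc by (simp add: m_assoc)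
      moreover have "(t \<otimes> x) \<otimes> c = y \<otimes> s" unfolding t(3) sac using t(2) a(1) cc by (simp add: m_assoc)
      ultimately have "y \<in> rad" using reg_mod_right[OF s(1) t(2)] by simp
      then have "t \<otimes> x \<in> rad" unfolding t(3) by (rule ideal_mult_closed(2)[OF prime_radical_ideal _ a(1)])
      then show ?thesis by (rule reg_mod_left[OF t(1) x])
    qed
  qed
qed

text \<open>Once the regular elements are identified with \<open>reg_mod\<close>,
  \<open>exact_ore\<close> is the Ore condition of \<open>R\<close> and
  \<open>sat_mod_chain_stable\<close> is the internal form of the left Artinian property.\<close>

theorem has_left_artinian: "has_left_artinian_left_quotient_ring R"
proof -
  have C: "regular_elements R = reg_mod" using reg_mod_regular regular_imp_reg_mod by blast
  interpret O: ore_ring R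
    by unfold_locales (use exact_ore in \<open>simp add: left_ore_def C\<close>)
  interpret Q: left_quotient R O.fraction_ring "O.frac \<one>"
    by unfold_locales (rule O.fraction_ring_left_quotient_ring)
  have "dcc_saturated R"
    unfolding dcc_saturated_def
    using sat_mod_chain_stable by (simp add: saturated_def sat_mod_def C)
  then have "left_artinian O.fraction_ring" using Q.left_artinian_iff by blast
  then show ?thesis unfolding has_left_artinian_left_quotient_ring_def
    using O.fraction_ring_left_quotient_ring by blast
qed

end

section \<open>Consequences of a left Artinian left quotient ring\<close>

locale artinian_quotient = left_quotient R Q \<sigma>
  for R :: "('a, 'm) ring_scheme" (structure) and Q :: "('q, 'n) ring_scheme" and \<sigma> +
  assumes artinian: "left_artinian Q"
begin

abbreviation K :: "'q set" where "K \<equiv> prime_radical Q"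

lemma K_ideal: "ideal K Q" by (rule Q.prime_radical_ideal)

lemma K_left_ideal: "left_ideal K Q" by (rule Q.rad_left_ideal)

lemma K_nilpotent: "nilpotent_ideal K Q"
  by (rule Q.left_artinian_imp_prime_radical_nilpotent[OF artinian])

text \<open>Stated for arbitrary \<open>u\<close> because it has two uses: \<open>ext_ideal\<close>
  applies it to a unit, and \<open>regular_eq_reg_mod\<close> to \<open>\<sigma> c\<close> with
  \<open>c\<close> in \<open>reg_mod\<close>, where regularity of \<open>c\<close> is still to be
  shown.\<close>

lemma right_multiples_stable:
  assumes L: "left_ideal L Q" and u: "u \<in> carrier Q" and Lu: "\<And>p. p \<in> L \<Longrightarrow> p \<otimes>\<^bsub>Q\<^esub> u \<in> L" and p: "p \<in> L"
  shows "\<exists>n::nat. \<exists>p'\<in>L. p \<otimes>\<^bsub>Q\<^esub> u [^]\<^bsub>Q\<^esub> n = (p' \<otimes>\<^bsub>Q\<^esub> u) \<otimes>\<^bsub>Q\<^esub> u [^]\<^bsub>Q\<^esub> n"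
proof -
  define F where "F n = (\<lambda>p. p \<otimes>\<^bsub>Q\<^esub> u [^]\<^bsub>Q\<^esub> (n::nat)) ` L" for n
  have shift: "q \<otimes>\<^bsub>Q\<^esub> u [^]\<^bsub>Q\<^esub> Suc n = (q \<otimes>\<^bsub>Q\<^esub> u) \<otimes>\<^bsub>Q\<^esub> u [^]\<^bsub>Q\<^esub> n" if "q \<in> L" for q n
    unfolding Q.nat_pow_Suc2[OF u] using Q.left_ideal_sub[OF L that] u by (simp add: Q.m_assoc)
  have Fl: "left_ideal (F n) Q" for n unfolding F_def by (rule Q.left_ideal_right_multiples[OF L]) (use u in simp)
  have Fd: "F (Suc n) \<subseteq> F n" for n unfolding F_def using shift Lu by blast
  obtain n where n: "\<And>k. n \<le> k \<Longrightarrow> F k = F n" using Q.left_artinianD[of F, OF artinian Fl Fd] by blast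
  have "F (Suc n) = F n" by (rule n) simp
  moreover have "p \<otimes>\<^bsub>Q\<^esub> u [^]\<^bsub>Q\<^esub> n \<in> F n" using p by (auto simp: F_def)
  ultimately have "p \<otimes>\<^bsub>Q\<^esub> u [^]\<^bsub>Q\<^esub> n \<in> F (Suc n)" by simp
  then show ?thesis using shift unfolding F_def by (metis (no_types, lifting) image_iff)
qed

text \<open>Right multiplication by a unit \<open>u\<close> with \<open>L u \<subseteq> L\<close> gives a descending chain \<open>L \<supseteq> L u \<supseteq> L u\<^sup>2 \<supseteq> \<dots>\<close>,
  which can only stabilise if \<open>L u = L\<close>.\<close>

lemma ext_ideal:
  assumes A: "ideal A R"
  shows "ideal (ext A) Q"
  unfolding Q.ideal_iff
proof (intro conjI ballI)
  note Al = ideal_left_ideal[OF A]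
  show E: "left_ideal (ext A) Q" by (rule ext_left_ideal[OF Al])
  have right: "p \<otimes>\<^bsub>Q\<^esub> \<sigma> r \<in> ext A" if p: "p \<in> ext A" and r: "r \<in> carrier R" for p r
  proof -
    obtain c x where c: "p \<in> carrier Q" "c \<in> C" "x \<in> A" "\<sigma> c \<otimes>\<^bsub>Q\<^esub> p = \<sigma> x" using p by (auto simp: ext_def)
    note cl = regular_closed[OF c(2)] ideal_closed[OF A c(3)]
    have "\<sigma> c \<otimes>\<^bsub>Q\<^esub> (p \<otimes>\<^bsub>Q\<^esub> \<sigma> r) = (\<sigma> c \<otimes>\<^bsub>Q\<^esub> p) \<otimes>\<^bsub>Q\<^esub> \<sigma> r" using cl c(1) r by (simp add: Q.m_assoc)
    also have "\<dots> = \<sigma> (x \<otimes> r)" unfolding c(4) using cl r by simp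
    finally show ?thesis using extI[OF _ c(2) ideal_mult_closed(2)[OF A c(3) r]] c(1) r by simp
  qed
  have inv: "p \<otimes>\<^bsub>Q\<^esub> inv\<^bsub>Q\<^esub> \<sigma> c \<in> ext A" if p: "p \<in> ext A" and c: "c \<in> C" for p c
  proof -
    have u: "\<sigma> c \<in> Units Q" "\<sigma> c \<in> carrier Q" using \<sigma>_unit[OF c] regular_closed[OF c] by auto
    obtain n :: nat and p' where n: "p' \<in> ext A"
      "p \<otimes>\<^bsub>Q\<^esub> \<sigma> c [^]\<^bsub>Q\<^esub> n = (p' \<otimes>\<^bsub>Q\<^esub> \<sigma> c) \<otimes>\<^bsub>Q\<^esub> \<sigma> c [^]\<^bsub>Q\<^esub> n"
      using right_multiples_stable[OF E u(2) right[OF _ regular_closed[OF c]] p] by blast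
    have pc: "p \<in> carrier Q" "p' \<in> carrier Q" using Q.left_ideal_sub[OF E] p n(1) by auto
    have un: "\<sigma> c [^]\<^bsub>Q\<^esub> n \<in> Units Q" by (induction n) (use u(1) in auto)
    have "p = p' \<otimes>\<^bsub>Q\<^esub> \<sigma> c"
    proof -
      have "p \<otimes>\<^bsub>Q\<^esub> (\<sigma> c [^]\<^bsub>Q\<^esub> n \<otimes>\<^bsub>Q\<^esub> inv\<^bsub>Q\<^esub> (\<sigma> c [^]\<^bsub>Q\<^esub> n)) =
          (p' \<otimes>\<^bsub>Q\<^esub> \<sigma> c) \<otimes>\<^bsub>Q\<^esub> (\<sigma> c [^]\<^bsub>Q\<^esub> n \<otimes>\<^bsub>Q\<^esub> inv\<^bsub>Q\<^esub> (\<sigma> c [^]\<^bsub>Q\<^esub> n))"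
        using n(2) un pc u(2) by (metis Q.Units_closed Q.Units_inv_closed Q.m_assoc Q.m_closed)
      then show ?thesis using un pc u(2) by simp
    qed
    then have "p \<otimes>\<^bsub>Q\<^esub> inv\<^bsub>Q\<^esub> \<sigma> c = p'" using pc u by (simp add: Q.m_assoc)
    then show ?thesis using n(1) by simp
  qed
  show "p \<otimes>\<^bsub>Q\<^esub> q \<in> ext A" if p: "p \<in> ext A" and q: "q \<in> carrier Q" for p q
  proof -
    obtain c r where c: "c \<in> C" "r \<in> carrier R" "q = left_fraction Q \<sigma> c r" using fraction_cases[OF q] by metis
    have "p \<otimes>\<^bsub>Q\<^esub> q = p \<otimes>\<^bsub>Q\<^esub> inv\<^bsub>Q\<^esub> \<sigma> c \<otimes>\<^bsub>Q\<^esub> \<sigma> r"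
      unfolding c(3) left_fraction_def using Q.left_ideal_sub[OF E p] \<sigma>_unit[OF c(1)] c(2) by (simp add: Q.m_assoc)
    then show ?thesis using right[OF inv[OF p c(1)] c(2)] by simp
  qed
qed

text \<open>The denominator of \<open>k\<close> is absorbed into \<open>p\<close>, which is possible
  because the extension of \<open>A\<close> is also a right ideal. Products of elements of
  \<open>C^-1 A\<close> and \<open>C^-1 B\<close> thus reduce to products of elements of
  \<open>A\<close> and \<open>B\<close>.\<close>

lemma ext_mult:
  assumes A: "ideal A R" and p: "p \<in> ext A" and k: "k \<in> ext B" and B: "B \<subseteq> carrier R"
  shows "\<exists>c\<in>C. \<exists>x\<in>A. \<exists>y\<in>B. \<sigma> c \<otimes>\<^bsub>Q\<^esub> (p \<otimes>\<^bsub>Q\<^esub> k) = \<sigma> (x \<otimes> y)"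
proof -
  obtain d y where d: "k \<in> carrier Q" "d \<in> C" "y \<in> B" "\<sigma> d \<otimes>\<^bsub>Q\<^esub> k = \<sigma> y" using k by (auto simp: ext_def)
  have u: "\<sigma> d \<in> Units Q" "\<sigma> d \<in> carrier Q" using \<sigma>_unit[OF d(2)] regular_closed[OF d(2)] by auto
  have pc: "p \<in> carrier Q" using p by (simp add: ext_def)
  have "p \<otimes>\<^bsub>Q\<^esub> inv\<^bsub>Q\<^esub> \<sigma> d \<in> ext A" using Q.ideal_mult_closed(2)[OF ext_ideal[OF A] p] u by simp
  then obtain c x where c: "c \<in> C" "x \<in> A" "\<sigma> c \<otimes>\<^bsub>Q\<^esub> (p \<otimes>\<^bsub>Q\<^esub> inv\<^bsub>Q\<^esub> \<sigma> d) = \<sigma> x" by (auto simp: ext_def)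
  have cc: "\<sigma> c \<in> carrier Q" using regular_closed[OF c(1)] by simp
  have "k = inv\<^bsub>Q\<^esub> \<sigma> d \<otimes>\<^bsub>Q\<^esub> (\<sigma> d \<otimes>\<^bsub>Q\<^esub> k)" using u d(1) by (simp add: Q.m_assoc[symmetric])
  then have "\<sigma> c \<otimes>\<^bsub>Q\<^esub> (p \<otimes>\<^bsub>Q\<^esub> k) = \<sigma> c \<otimes>\<^bsub>Q\<^esub> (p \<otimes>\<^bsub>Q\<^esub> (inv\<^bsub>Q\<^esub> \<sigma> d \<otimes>\<^bsub>Q\<^esub> (\<sigma> d \<otimes>\<^bsub>Q\<^esub> k)))" by simp
  also have "\<dots> = \<sigma> c \<otimes>\<^bsub>Q\<^esub> (p \<otimes>\<^bsub>Q\<^esub> inv\<^bsub>Q\<^esub> \<sigma> d) \<otimes>\<^bsub>Q\<^esub> (\<sigma> d \<otimes>\<^bsub>Q\<^esub> k)"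
    using u d(1) pc cc by (simp add: Q.m_assoc)
  also have "\<dots> = \<sigma> (x \<otimes> y)" unfolding c(3) d(4) using ideal_closed[OF A c(2)] d(3) B by auto
  finally show ?thesis using c d by blast
qed

lemma contr_ideal: "ideal (contr K) R"
  unfolding ideal_iff
proof (intro conjI ballI)
  show "left_ideal (contr K) R" by (rule contr_left_ideal[OF K_left_ideal])
  show "x \<otimes> r \<in> contr K" if "x \<in> contr K" "r \<in> carrier R" for x r
    using that Q.ideal_mult_closed(2)[OF K_ideal, of "\<sigma> x" "\<sigma> r"] by (simp add: contr_def)
qed

lemma contr_K: "contr K = rad"
proof
  have pow: "ideal_power R (contr K) j \<subseteq> contr (ideal_power Q K j)" for j
  proof (induction j)
    case 0
    show ?case by (auto simp: contr_def)
  next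
    case (Suc j)
    note L = Q.ideal_left_ideal[OF Q.ideal_power_ideal[OF K_ideal], of "Suc j"]
    have "x \<in> contr (ideal_power Q K (Suc j))" if "x \<in> ideal_power R (contr K) j \<cdot> contr K" for x
      using that
    proof (induction rule: ideal_prod.induct)
      case (prod a b)
      have ab: "a \<in> carrier R" "\<sigma> a \<in> ideal_power Q K j" "b \<in> carrier R" "\<sigma> b \<in> K"
        using prod Suc.IH by (auto simp: contr_def)
      then show ?case using Q.ideal_power_mult_right[OF ab(2,4)] by (simp add: contr_def del: ideal_power.simps)
    next
      case (sum a b)
      then show ?case using left_ideal_add[OF contr_left_ideal[OF L]] by blast
    qed
    then show ?case by auto
  qed
  obtain j where j: "ideal_power Q K j = {\<zero>\<^bsub>Q\<^esub>}" using K_nilpotent by (auto simp: nilpotent_ideal_def)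
  have "contr {\<zero>\<^bsub>Q\<^esub>} = {\<zero>}" using \<sigma>_eq_zero by (auto simp: contr_def)
  then have "ideal_power R (contr K) j = {\<zero>}"
    using pow[of j] j left_ideal_zero[OF ideal_left_ideal[OF ideal_power_ideal[OF contr_ideal]], of j] by auto
  then show "contr K \<subseteq> rad" using nilpotent_ideal_le_prime_radical contr_ideal by (auto simp: nilpotent_ideal_def)
  show "rad \<subseteq> contr K"
  proof (rule prime_radical_least[OF contr_ideal])
    fix a assume a: "a \<in> carrier R" and h: "\<And>r. r \<in> carrier R \<Longrightarrow> a \<otimes> r \<otimes> a \<in> contr K"
    \<comment> \<open>Replacing \<open>a\<close> by a two-sided ideal \<open>A\<close> with all
      products in \<open>contr K\<close> keeps \<open>\<sigma> a\<close> times any \<open>q\<close>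
      inside \<open>ext A\<close>. So the products of \<open>\<sigma> a\<close>, \<open>q\<close>
      and \<open>\<sigma> a\<close> fall into \<open>K\<close>.\<close>
    obtain A where A: "ideal A R" "a \<in> A" "\<And>x y. x \<in> A \<Longrightarrow> y \<in> A \<Longrightarrow> x \<otimes> y \<in> contr K"
      using ideal_square_subset[OF contr_ideal a h] by blast
    have Ac: "A \<subseteq> carrier R" using ideal_closed[OF A(1)] by blast
    have aE: "\<sigma> a \<in> ext A" by (rule \<sigma>_in_ext[OF Ac A(2)])
    have "\<sigma> a \<otimes>\<^bsub>Q\<^esub> q \<otimes>\<^bsub>Q\<^esub> \<sigma> a \<in> K" if q: "q \<in> carrier Q" for q
    proof -
      have "\<sigma> a \<otimes>\<^bsub>Q\<^esub> q \<in> ext A" by (rule Q.ideal_mult_closed(2)[OF ext_ideal[OF A(1)] aE q])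
      then obtain c x y where c: "c \<in> C" "x \<in> A" "y \<in> A" "\<sigma> c \<otimes>\<^bsub>Q\<^esub> (\<sigma> a \<otimes>\<^bsub>Q\<^esub> q \<otimes>\<^bsub>Q\<^esub> \<sigma> a) = \<sigma> (x \<otimes> y)"
        using ext_mult[OF A(1) _ aE Ac] by blast
      have "\<sigma> (x \<otimes> y) \<in> K" using A(3)[OF c(2,3)] by (simp add: contr_def del: h.hom_mult)
      then show ?thesis using unit_mult_mem[OF K_left_ideal c(1)] c(4) a q by simp
    qed
    then have "\<sigma> a \<in> K" using Q.prime_radical_semiprime[of "\<sigma> a"] a by simp
    then show "a \<in> contr K" using a by (simp add: contr_def)
  qed
qed

lemma \<sigma>_in_K: "x \<in> carrier R \<Longrightarrow> \<sigma> x \<in> K \<longleftrightarrow> x \<in> rad"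
  using contr_K by (auto simp: contr_def)

lemma ext_rad: "ext rad = K"
  using ext_contr[OF K_left_ideal] contr_K by simp

text \<open>In the induction step \<open>ext_mult\<close> provides numerators in
  \<open>rad_power (Suc i)\<close>. Conversely, the next power of \<open>K\<close> contains the
  images of the products and absorbs inverse denominators.\<close>

lemma ideal_power_K: "ideal_power Q K i = ext (rad_power i)"
proof (induction i)
  case 0
  have "contr (carrier Q) = carrier R" by (auto simp: contr_def)
  then show ?case using ext_contr[OF Q.left_ideal_carrier] by simp
next
  case (Suc i)
  have rc: "rad_power j \<subseteq> carrier R" for j using rad_power_closed by blast
  show ?case
  proof
    show "ideal_power Q K (Suc i) \<subseteq> ext (rad_power (Suc i))"
    proof
      fix q assume "q \<in> ideal_power Q K (Suc i)"
      then have "q \<in> ext (rad_power i) \<cdot>\<^bsub>Q\<^esub> K" by (simp add: Suc)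
      then show "q \<in> ext (rad_power (Suc i))"
      proof (induction rule: ideal_prod.induct)
        case (prod p k)
        have k: "k \<in> ext rad" using prod ext_rad by simp
        have "rad \<subseteq> carrier R" using left_ideal_sub[OF rad_left_ideal] by blast
        then obtain c x y where c: "c \<in> C" "x \<in> rad_power i" "y \<in> rad" "\<sigma> c \<otimes>\<^bsub>Q\<^esub> (p \<otimes>\<^bsub>Q\<^esub> k) = \<sigma> (x \<otimes> y)"
          using ext_mult[OF ideal_power_ideal[OF prime_radical_ideal] prod(1) k] by blast
        have "p \<otimes>\<^bsub>Q\<^esub> k \<in> carrier Q" using prod(1) k by (simp add: ext_def)
        then show ?case using extI[OF _ c(1) ideal_power_mult_right[OF c(2,3)] c(4)] by blast
      next
        case (sum a b)
        then show ?case using Q.left_ideal_add[OF ext_left_ideal[OF rad_power_left_ideal]] by blast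
      qed
    qed
    note L = Q.ideal_left_ideal[OF Q.ideal_power_ideal[OF K_ideal], of "Suc i"]
    have sub: "\<sigma> x \<in> ideal_power Q K (Suc i)" if "x \<in> rad_power i \<cdot> rad" for x
    proof -
      have "x \<in> carrier R \<and> \<sigma> x \<in> ideal_power Q K (Suc i)"
        using that
      proof (induction rule: ideal_prod.induct)
        case (prod a b)
        have ab: "a \<in> carrier R" "b \<in> carrier R" using rad_power_closed[OF prod(1)] left_ideal_sub[OF rad_left_ideal prod(2)] by auto
        have "\<sigma> a \<in> ideal_power Q K i" unfolding Suc by (rule \<sigma>_in_ext[OF rc prod(1)])
        moreover have "\<sigma> b \<in> K" using \<sigma>_in_K ab prod by blast
        ultimately show ?case using Q.ideal_power_mult_right ab by (simp del: ideal_power.simps)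
      next
        case (sum a b)
        then show ?case using Q.left_ideal_add[OF L] by (simp del: ideal_power.simps)
      qed
      then show ?thesis by blast
    qed
    show "ext (rad_power (Suc i)) \<subseteq> ideal_power Q K (Suc i)"
    proof
      fix q assume "q \<in> ext (rad_power (Suc i))"
      then obtain c x where c: "q \<in> carrier Q" "c \<in> C" "x \<in> rad_power i \<cdot> rad" "\<sigma> c \<otimes>\<^bsub>Q\<^esub> q = \<sigma> x" by (auto simp: ext_def)
      show "q \<in> ideal_power Q K (Suc i)" by (rule unit_mult_mem[OF L c(2,1)]) (use sub[OF c(3)] c(4) in \<open>simp del: ideal_power.simps\<close>)
    qed
  qed
qed

lemma ideal_power_K_zero: "ideal_power Q K i = {\<zero>\<^bsub>Q\<^esub>} \<longleftrightarrow> rad_power i = {\<zero>}"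
proof
  assume "ideal_power Q K i = {\<zero>\<^bsub>Q\<^esub>}"
  then have "\<sigma> x = \<zero>\<^bsub>Q\<^esub>" if "x \<in> rad_power i" for x
    using \<sigma>_in_ext[of "rad_power i" x] rad_power_closed that unfolding ideal_power_K by blast
  then show "rad_power i = {\<zero>}" using \<sigma>_eq_zero rad_power_closed left_ideal_zero[OF rad_power_left_ideal] by blast
next
  assume "rad_power i = {\<zero>}"
  then have "q = \<zero>\<^bsub>Q\<^esub>" if "q \<in> ideal_power Q K i" for q
  proof -
    have "q \<in> ext {\<zero>}" using that unfolding ideal_power_K \<open>rad_power i = {\<zero>}\<close> .
    then obtain c where c: "q \<in> carrier Q" "c \<in> C" "\<sigma> c \<otimes>\<^bsub>Q\<^esub> q = \<sigma> \<zero>"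
      unfolding ext_def by blast
    then show ?thesis using cancel[OF c(2,1), of "\<zero>\<^bsub>Q\<^esub>"] regular_closed[OF c(2)] by simp
  qed
  then show "ideal_power Q K i = {\<zero>\<^bsub>Q\<^esub>}"
    using Q.left_ideal_zero[OF Q.ideal_left_ideal[OF Q.ideal_power_ideal[OF K_ideal]]] by blast
qed

text \<open>The powers vanish for the same exponents, so the predicates under the two
  \<open>THE\<close> operators are the same. The equality therefore covers the zero ring too, where
  the value is arbitrary.\<close>

lemma nilpotency_degree_K: "nilpotency_degree K Q = nilpotency_degree rad R"
  unfolding nilpotency_degree_def ideal_power_K_zero ..

lemma rad_nilpotent: "nilpotent_ideal rad R"
  using K_nilpotent prime_radical_ideal by (simp add: nilpotent_ideal_def ideal_power_K_zero)

text \<open>For \<open>c\<close> in \<open>reg_mod\<close>, right multiplication by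
  \<open>\<sigma> c\<close> is injective modulo \<open>K\<close>. The chain of the left ideals
  generated by its powers then yields a two-sided inverse \<open>p\<close> of
  \<open>\<sigma> c\<close> modulo \<open>K\<close>. The image of an element annihilated by
  \<open>c\<close> is fixed by multiplication with a nilpotent element, hence zero.\<close>

lemma regular_eq_reg_mod: "C = reg_mod"
proof
  show "C \<subseteq> reg_mod"
  proof
    fix c assume c: "c \<in> C"
    have cc: "c \<in> carrier R" and u: "\<sigma> c \<in> Units Q" using regular_closed[OF c] \<sigma>_unit[OF c] by auto
    show "c \<in> reg_mod"
      unfolding regular_mod_iff
    proof (intro conjI ballI impI cc)
      fix x assume x: "x \<in> carrier R"
      show "x \<in> rad" if "c \<otimes> x \<in> rad"
        using that \<sigma>_in_K[of "c \<otimes> x"] \<sigma>_in_K[OF x] unit_mult_mem[OF K_left_ideal c, of "\<sigma> x"] x cc by simp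
      show "x \<in> rad" if "x \<otimes> c \<in> rad"
      proof -
        have "\<sigma> x \<otimes>\<^bsub>Q\<^esub> \<sigma> c \<otimes>\<^bsub>Q\<^esub> inv\<^bsub>Q\<^esub> \<sigma> c \<in> K"
          using that \<sigma>_in_K[of "x \<otimes> c"] Q.ideal_mult_closed(2)[OF K_ideal] x cc u by simp
        then show ?thesis using \<sigma>_in_K[OF x] x cc u by (simp add: Q.m_assoc)
      qed
    qed
  qed
  show "reg_mod \<subseteq> C"
  proof
    fix c assume c: "c \<in> reg_mod"
    note cc = reg_mod_closed[OF c]
    have s: "\<sigma> c \<in> carrier Q" using cc by simp
    have lr: "q \<in> K" if q: "q \<in> carrier Q" "q \<otimes>\<^bsub>Q\<^esub> \<sigma> c \<in> K" for q
    proof -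
      obtain d r where d: "d \<in> C" "r \<in> carrier R" "\<sigma> d \<otimes>\<^bsub>Q\<^esub> q = \<sigma> r" using fraction_cases[OF q(1)] by metis
      have dc: "\<sigma> d \<in> carrier Q" using regular_closed[OF d(1)] by simp
      have "\<sigma> (r \<otimes> c) = \<sigma> d \<otimes>\<^bsub>Q\<^esub> (q \<otimes>\<^bsub>Q\<^esub> \<sigma> c)" using d(2) cc q(1) dc by (simp add: d(3)[symmetric] Q.m_assoc)
      then have "\<sigma> (r \<otimes> c) \<in> K" using Q.left_ideal_mult[OF K_left_ideal dc q(2)] by simp
      then have "r \<otimes> c \<in> rad" using \<sigma>_in_K d(2) cc by blast
      then have "r \<in> rad" by (rule reg_mod_right[OF c d(2)])
      then have "\<sigma> d \<otimes>\<^bsub>Q\<^esub> q \<in> K" using \<sigma>_in_K d by simp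
      then show ?thesis by (rule unit_mult_mem[OF K_left_ideal d(1) q(1)])
    qed
    have lrn: "q \<in> K" if "q \<in> carrier Q" "q \<otimes>\<^bsub>Q\<^esub> \<sigma> c [^]\<^bsub>Q\<^esub> n \<in> K" for q and n :: nat
      using that
    proof (induction n)
      case (Suc n)
      have "(q \<otimes>\<^bsub>Q\<^esub> \<sigma> c [^]\<^bsub>Q\<^esub> n) \<otimes>\<^bsub>Q\<^esub> \<sigma> c \<in> K" using Suc.prems s by (simp add: Q.m_assoc)
      then have "q \<otimes>\<^bsub>Q\<^esub> \<sigma> c [^]\<^bsub>Q\<^esub> n \<in> K" by (rule lr[rotated]) (use Suc.prems s in simp)
      then show ?case by (rule Suc.IH[OF Suc.prems(1)])
    qed simp
    obtain n :: nat and p where p: "p \<in> carrier Q"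
      "\<one>\<^bsub>Q\<^esub> \<otimes>\<^bsub>Q\<^esub> \<sigma> c [^]\<^bsub>Q\<^esub> n = (p \<otimes>\<^bsub>Q\<^esub> \<sigma> c) \<otimes>\<^bsub>Q\<^esub> \<sigma> c [^]\<^bsub>Q\<^esub> n"
      using right_multiples_stable[OF Q.left_ideal_carrier s _ Q.one_closed] s by blast
    define k where "k = \<one>\<^bsub>Q\<^esub> \<ominus>\<^bsub>Q\<^esub> p \<otimes>\<^bsub>Q\<^esub> \<sigma> c"
    define k' where "k' = \<one>\<^bsub>Q\<^esub> \<ominus>\<^bsub>Q\<^esub> \<sigma> c \<otimes>\<^bsub>Q\<^esub> p"
    have kc: "k \<in> carrier Q" "k' \<in> carrier Q" using p s by (auto simp: k_def k'_def)
    have pn: "\<sigma> c [^]\<^bsub>Q\<^esub> n \<in> carrier Q" "p \<otimes>\<^bsub>Q\<^esub> \<sigma> c \<in> carrier Q" using p(1) s by auto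
    have "k \<otimes>\<^bsub>Q\<^esub> \<sigma> c [^]\<^bsub>Q\<^esub> n = \<one>\<^bsub>Q\<^esub> \<otimes>\<^bsub>Q\<^esub> \<sigma> c [^]\<^bsub>Q\<^esub> n \<ominus>\<^bsub>Q\<^esub> (p \<otimes>\<^bsub>Q\<^esub> \<sigma> c) \<otimes>\<^bsub>Q\<^esub> \<sigma> c [^]\<^bsub>Q\<^esub> n"
      unfolding k_def using pn by (simp add: Q.minus_eq Q.l_distr Q.l_minus)
    also have "\<dots> = \<zero>\<^bsub>Q\<^esub>" unfolding p(2)[symmetric] using pn by (simp add: Q.minus_eq Q.r_neg)
    finally have "k \<in> K" using lrn[OF kc(1)] Q.left_ideal_zero[OF K_left_ideal] by metis
    \<comment> \<open>This identity carries membership in \<open>K\<close> from the left defect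
      \<open>k\<close> to the right defect \<open>k'\<close>, once \<open>\<sigma> c\<close> is
      cancelled modulo \<open>K\<close>.\<close>
    have "k' \<otimes>\<^bsub>Q\<^esub> \<sigma> c = \<sigma> c \<otimes>\<^bsub>Q\<^esub> k"
      unfolding k_def k'_def using p(1) s by (simp add: Q.minus_eq Q.l_distr Q.r_distr Q.l_minus Q.r_minus Q.m_assoc)
    then have "k' \<otimes>\<^bsub>Q\<^esub> \<sigma> c \<in> K" using Q.left_ideal_mult[OF K_left_ideal s \<open>k \<in> K\<close>] by simp
    then have "k' \<in> K" by (rule lr[OF kc(2)])
    show "c \<in> C"
    proof (rule regular_elementsI[OF cc])
      fix x assume x: "x \<in> carrier R" "c \<otimes> x = \<zero>"
      have cx: "\<sigma> c \<otimes>\<^bsub>Q\<^esub> \<sigma> x = \<zero>\<^bsub>Q\<^esub>" using h.hom_mult[OF cc x(1)] x(2) by simp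
      have "k \<otimes>\<^bsub>Q\<^esub> \<sigma> x = \<sigma> x \<ominus>\<^bsub>Q\<^esub> p \<otimes>\<^bsub>Q\<^esub> (\<sigma> c \<otimes>\<^bsub>Q\<^esub> \<sigma> x)"
        unfolding k_def using p(1) s x(1) by (simp add: Q.minus_eq Q.l_distr Q.l_minus Q.m_assoc)
      then have e: "\<sigma> x = k \<otimes>\<^bsub>Q\<^esub> \<sigma> x" unfolding cx using p(1) x(1) by (simp add: Q.minus_eq)
      obtain m :: nat where "k [^]\<^bsub>Q\<^esub> m = \<zero>\<^bsub>Q\<^esub>" using Q.prime_radical_nil[OF \<open>k \<in> K\<close>] by blast
      then have "\<sigma> x = \<zero>\<^bsub>Q\<^esub>" using Q.nil_fixed_zero[OF kc(1) _ _ disjI1[OF e]] x(1) by simp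
      then show "x = \<zero>" using \<sigma>_eq_zero x(1) by blast
    next
      fix x assume x: "x \<in> carrier R" "x \<otimes> c = \<zero>"
      have cx: "\<sigma> x \<otimes>\<^bsub>Q\<^esub> \<sigma> c = \<zero>\<^bsub>Q\<^esub>" using h.hom_mult[OF x(1) cc] x(2) by simp
      have "\<sigma> x \<otimes>\<^bsub>Q\<^esub> k' = \<sigma> x \<ominus>\<^bsub>Q\<^esub> (\<sigma> x \<otimes>\<^bsub>Q\<^esub> \<sigma> c) \<otimes>\<^bsub>Q\<^esub> p"
        unfolding k'_def using p(1) s x(1) by (simp add: Q.minus_eq Q.r_distr Q.r_minus Q.m_assoc)
      then have e: "\<sigma> x = \<sigma> x \<otimes>\<^bsub>Q\<^esub> k'" unfolding cx using p(1) x(1) by (simp add: Q.minus_eq)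
      obtain m :: nat where "k' [^]\<^bsub>Q\<^esub> m = \<zero>\<^bsub>Q\<^esub>" using Q.prime_radical_nil[OF \<open>k' \<in> K\<close>] by blast
      then have "\<sigma> x = \<zero>\<^bsub>Q\<^esub>" using Q.nil_fixed_zero[OF kc(2) _ _ disjI2[OF e]] x(1) by simp
      then show "x = \<zero>" using \<sigma>_eq_zero x(1) by blast
    qed
  qed
qed

text \<open>The map from \<open>R/rad\<close> to \<open>Q/K\<close> induced by
  \<open>\<sigma>\<close>, through a chosen representative. Independence of the choice is
  \<open>reduced_map_residue\<close>.\<close>

definition reduced_map :: "'a set \<Rightarrow> 'q set" where
  "reduced_map X = K +>\<^bsub>Q\<^esub> \<sigma> (inv_into (carrier R) (residue_class R) X)"

lemma reduced_map_residue:
  assumes r: "r \<in> carrier R"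
  shows "reduced_map (residue_class R r) = K +>\<^bsub>Q\<^esub> \<sigma> r"
proof -
  define s where "s = inv_into (carrier R) (residue_class R) (residue_class R r)"
  have s: "s \<in> carrier R" "residue_class R s = residue_class R r"
    unfolding s_def by (rule inv_into_into[OF imageI[OF r]], rule f_inv_into_f[OF imageI[OF r]])
  then have "s \<ominus> r \<in> rad" using residue_eq_iff r by blast
  then have "\<sigma> (s \<ominus> r) \<in> K" using \<sigma>_in_K r s by blast
  then have "\<sigma> s \<ominus>\<^bsub>Q\<^esub> \<sigma> r \<in> K" using r s by (simp add: minus_eq Q.minus_eq)
  then show ?thesis using Q.coset_eq_iff[OF K_left_ideal] r s unfolding reduced_map_def s_def[symmetric] by simp
qed

text \<open>Since the regular elements of \<open>R\<close> are exactly \<open>reg_mod\<close>, their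
  classes are exactly the regular elements of \<open>R/rad\<close>, and fractions of
  \<open>Q\<close> reduce to fractions. The second part supplies the formula that the isomorphism of
  the theorem has to satisfy.\<close>

lemma reduced_fractions:
  shows "left_quotient_ring (reduced_ring R) (Q Quot K) reduced_map"
    and "c \<in> C \<Longrightarrow> r \<in> carrier R \<Longrightarrow>
      left_fraction (Q Quot K) reduced_map (residue_class R c) (residue_class R r) = K +>\<^bsub>Q\<^esub> left_fraction Q \<sigma> c r"
proof -
  interpret S: ring "reduced_ring R" by (rule reduced_ring_ring)
  interpret A: ring "Q Quot K" by (rule Q.quot_ring[OF K_ideal])
  interpret k: ring_hom_ring Q "Q Quot K" "(+>\<^bsub>Q\<^esub>) K"
    by (intro ring_hom_ringI2 Q.quot_hom[OF K_ideal] Q.ring_axioms A.ring_axioms)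
  have inv: "K +>\<^bsub>Q\<^esub> \<sigma> c \<in> Units (Q Quot K) \<and> inv\<^bsub>Q Quot K\<^esub> (K +>\<^bsub>Q\<^esub> \<sigma> c) = K +>\<^bsub>Q\<^esub> (inv\<^bsub>Q\<^esub> \<sigma> c)" if c: "c \<in> C" for c
  proof -
    have u: "\<sigma> c \<in> Units Q" "\<sigma> c \<in> carrier Q" "inv\<^bsub>Q\<^esub> \<sigma> c \<in> carrier Q" using \<sigma>_unit[OF c] by auto
    have 1: "(K +>\<^bsub>Q\<^esub> (inv\<^bsub>Q\<^esub> \<sigma> c)) \<otimes>\<^bsub>Q Quot K\<^esub> (K +>\<^bsub>Q\<^esub> \<sigma> c) = \<one>\<^bsub>Q Quot K\<^esub>"
      using k.hom_mult[OF u(3,2)] k.hom_one u by simp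
    have 2: "(K +>\<^bsub>Q\<^esub> \<sigma> c) \<otimes>\<^bsub>Q Quot K\<^esub> (K +>\<^bsub>Q\<^esub> (inv\<^bsub>Q\<^esub> \<sigma> c)) = \<one>\<^bsub>Q Quot K\<^esub>"
      using k.hom_mult[OF u(2,3)] k.hom_one u by simp
    have 3: "K +>\<^bsub>Q\<^esub> \<sigma> c \<in> carrier (Q Quot K)" "K +>\<^bsub>Q\<^esub> (inv\<^bsub>Q\<^esub> \<sigma> c) \<in> carrier (Q Quot K)"
      using k.hom_closed u by auto
    show ?thesis using 1 2 3 A.inv_unique'[OF 3] by (auto simp: Units_def)
  qed
  have lf: "left_fraction (Q Quot K) reduced_map (residue_class R c) (residue_class R r) = K +>\<^bsub>Q\<^esub> left_fraction Q \<sigma> c r"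
    if c: "c \<in> C" and r: "r \<in> carrier R" for c r
    unfolding left_fraction_def reduced_map_residue[OF regular_closed[OF c]] reduced_map_residue[OF r]
    using inv[OF c] k.hom_mult[of "inv\<^bsub>Q\<^esub> \<sigma> c" "\<sigma> r"] \<sigma>_unit[OF c] r by simp
  show "c \<in> C \<Longrightarrow> r \<in> carrier R \<Longrightarrow>
      left_fraction (Q Quot K) reduced_map (residue_class R c) (residue_class R r) = K +>\<^bsub>Q\<^esub> left_fraction Q \<sigma> c r"
    by (rule lf)
  have reg: "regular_elements (reduced_ring R) = residue_class R ` C"
    using regular_reduced regular_eq_reg_mod by simp
  show "left_quotient_ring (reduced_ring R) (Q Quot K) reduced_map"
    unfolding left_quotient_ring_def left_ring_of_fractions_def reg
  proof (intro conjI ballI)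
    show "ring (Q Quot K)" by (rule A.ring_axioms)
    have add: "residue_class R x \<oplus>\<^bsub>reduced_ring R\<^esub> residue_class R y = residue_class R (x \<oplus> y)"
      if "x \<in> carrier R" "y \<in> carrier R" for x y
      using quot_simps(2)[OF prime_radical_ideal that] by (simp add: residue_class_eq reduced_ring_def)
    have one: "\<one>\<^bsub>reduced_ring R\<^esub> = residue_class R \<one>"
      by (simp add: residue_class_eq reduced_ring_def FactRing_def)
    show "reduced_map \<in> ring_hom (reduced_ring R) (Q Quot K)"
    proof (rule ring_hom_memI)
      fix X Y assume "X \<in> carrier (reduced_ring R)" "Y \<in> carrier (reduced_ring R)"
      then obtain x y where xy: "x \<in> carrier R" "X = residue_class R x" "y \<in> carrier R" "Y = residue_class R y"
        unfolding residue_surj[symmetric] by blast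
      show "reduced_map X \<in> carrier (Q Quot K)" using xy reduced_map_residue k.hom_closed by simp
      show "reduced_map (X \<otimes>\<^bsub>reduced_ring R\<^esub> Y) = reduced_map X \<otimes>\<^bsub>Q Quot K\<^esub> reduced_map Y"
        using xy residue_mult reduced_map_residue by simp
      show "reduced_map (X \<oplus>\<^bsub>reduced_ring R\<^esub> Y) = reduced_map X \<oplus>\<^bsub>Q Quot K\<^esub> reduced_map Y"
        using xy add reduced_map_residue by simp
    next
      show "reduced_map \<one>\<^bsub>reduced_ring R\<^esub> = \<one>\<^bsub>Q Quot K\<^esub>"
        unfolding one reduced_map_residue[OF one_closed] using k.hom_one by simp
    qed
    show "reduced_map X \<in> Units (Q Quot K)" if "X \<in> residue_class R ` C" for X
      using that inv reduced_map_residue regular_closed by auto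
    show "\<exists>s\<in>residue_class R ` C. \<exists>r\<in>carrier (reduced_ring R). p = left_fraction (Q Quot K) reduced_map s r"
      if "p \<in> carrier (Q Quot K)" for p
    proof -
      have "p \<in> (+>\<^bsub>Q\<^esub>) K ` carrier Q" unfolding Q.quot_surj[OF K_ideal] by fact
      then obtain q where q: "q \<in> carrier Q" "p = K +>\<^bsub>Q\<^esub> q" by blast
      obtain c r where c: "c \<in> C" "r \<in> carrier R" "q = left_fraction Q \<sigma> c r" using fraction_cases[OF q(1)] by metis
      then show ?thesis using lf[OF c(1,2)] q residue_surj by blast
    qed
    have z: "reduced_map X = \<zero>\<^bsub>Q Quot K\<^esub> \<longleftrightarrow> X = \<zero>\<^bsub>reduced_ring R\<^esub>" if X: "X \<in> carrier (reduced_ring R)" for X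
    proof -
      obtain x where x: "x \<in> carrier R" "X = residue_class R x" using X unfolding residue_surj[symmetric] by blast
      show ?thesis using Q.quot_zero_iff[OF K_ideal, of "\<sigma> x"] \<sigma>_in_K[OF x(1)] residue_zero_iff[OF x(1)]
          reduced_map_residue[OF x(1)] x by simp
    qed
    have "(\<exists>s\<in>residue_class R ` C. s \<otimes>\<^bsub>reduced_ring R\<^esub> X = \<zero>\<^bsub>reduced_ring R\<^esub>) \<longleftrightarrow> X = \<zero>\<^bsub>reduced_ring R\<^esub>"
      if X: "X \<in> carrier (reduced_ring R)" for X
      using S.regular_one S.regular_left X unfolding reg[symmetric] by (metis S.l_one)
    then show "a_kernel (reduced_ring R) (Q Quot K) reduced_map =
        {r \<in> carrier (reduced_ring R). \<exists>s\<in>residue_class R ` C. s \<otimes>\<^bsub>reduced_ring R\<^esub> r = \<zero>\<^bsub>reduced_ring R\<^esub>}"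
      using z unfolding a_kernel_def' by blast
  qed
qed

text \<open>\<open>Q/K\<close> is semiprime and left Artinian, hence left Goldie, and this descends
  to the ring of which it is a left quotient ring.\<close>

lemma reduced_left_goldie: "left_goldie (reduced_ring R)"
proof -
  interpret S: ring "reduced_ring R" by (rule reduced_ring_ring)
  interpret A: ring "Q Quot K" by (rule Q.quot_ring[OF K_ideal])
  interpret L: left_quotient "reduced_ring R" "Q Quot K" reduced_map
    by unfold_locales (rule reduced_fractions(1))
  have "left_goldie (Q Quot K)"
    by (rule A.semiprime_left_artinian_imp_left_goldie[OF Q.semiprime_quotient[OF K_ideal Q.prime_radical_semiprime]
          Q.left_artinian_quotient[OF K_ideal artinian]])
  then show ?thesis by (rule L.left_goldie_descends)
qed

text \<open>The saturations of the \<open>D k\<close> stabilise, so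
  \<open>c \<otimes> x n \<in> D (Suc n)\<close> for some regular \<open>c\<close>. The flag
  condition makes this product torsion, and \<open>tors i\<close> is saturated.\<close>

lemma layer_no_flag: "\<not> descending_flag R (rad_power i) (tors i) D x"
proof
  interpret om: ore_mod R by (rule goldie_imp_ore_mod[OF reduced_left_goldie])
  assume f: "descending_flag R (rad_power i) (tors i) D x"
  then have D: "left_ideal (D k) R" "D k \<subseteq> rad_power i" "D (Suc k) \<subseteq> D k" "x k \<in> D k" "x k \<notin> tors i"
    and xT: "r \<in> carrier R \<Longrightarrow> r \<otimes> x k \<in> D (Suc k) \<Longrightarrow> r \<otimes> x k \<in> tors i" for k r
    by (auto simp: descending_flag_def)
  have "left_ideal (contr (ext (D k))) R \<and> saturated R (contr (ext (D k)))" for k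
    using contr_left_ideal contr_saturated ext_left_ideal[OF D(1)] by blast
  moreover have "contr (ext (D (Suc k))) \<subseteq> contr (ext (D k))" for k using D(3) by (auto simp: contr_def ext_def)
  moreover have "dcc_saturated R" using left_artinian_iff artinian by blast
  ultimately have "\<exists>n. \<forall>k\<ge>n. contr (ext (D k)) = contr (ext (D n))"
    unfolding dcc_saturated_def by simp
  then obtain n where n: "\<And>k. n \<le> k \<Longrightarrow> contr (ext (D k)) = contr (ext (D n))" by blast
  have xp: "x n \<in> rad_power i" using D by blast
  note xc = rad_power_closed[OF xp]
  have "\<one> \<otimes> x n \<in> D n" using D(4) xc by simp
  then have "x n \<in> contr (ext (D n))" unfolding contr_ext[OF D(1)] using regular_one xc by blast
  moreover have "contr (ext (D (Suc n))) = contr (ext (D n))" by (rule n) simp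
  ultimately have "x n \<in> contr (ext (D (Suc n)))" by simp
  then obtain c where c: "c \<in> C" "c \<otimes> x n \<in> D (Suc n)" unfolding contr_ext[OF D(1)] by blast
  have "c \<otimes> x n \<in> tors i" by (rule xT[OF regular_closed[OF c(1)] c(2)])
  then have "x n \<in> tors i" using om.tors_saturated[OF xp] c(1) regular_eq_reg_mod by blast
  then show False using D(5) by blast
qed

text \<open>A relation \<open>t \<otimes> (y \<otimes> c) \<in> rad_power (Suc i)\<close> passes to
  the corresponding power of \<open>K\<close>, a two-sided ideal of \<open>Q\<close>, where the unit
  \<open>\<sigma> c\<close> can be removed on the right. Returning to \<open>R\<close> costs one
  more regular left factor.\<close>

lemma layer_torsion_right:
  assumes c: "c \<in> reg_mod" and y: "y \<in> rad_power i" "y \<otimes> c \<in> tors i"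
  shows "y \<in> tors i"
proof -
  have cC: "c \<in> C" using c regular_eq_reg_mod by simp
  note cc = regular_closed[OF cC] and u = \<sigma>_unit[OF cC]
  obtain t where t: "t \<in> reg_mod" "t \<otimes> (y \<otimes> c) \<in> rad_power (Suc i)" using y(2) by (auto simp: tors_def)
  note cl = reg_mod_closed[OF t(1)] rad_power_closed[OF y(1)]
  have "\<sigma> (t \<otimes> (y \<otimes> c)) \<in> ideal_power Q K (Suc i)"
    unfolding ideal_power_K by (rule \<sigma>_in_ext[OF _ t(2)]) (use rad_power_closed in blast)
  then have "\<sigma> (t \<otimes> (y \<otimes> c)) \<otimes>\<^bsub>Q\<^esub> inv\<^bsub>Q\<^esub> \<sigma> c \<in> ideal_power Q K (Suc i)"
    by (rule Q.ideal_mult_closed(2)[OF Q.ideal_power_ideal[OF K_ideal]]) (use u in simp)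
  moreover have "\<sigma> (t \<otimes> (y \<otimes> c)) \<otimes>\<^bsub>Q\<^esub> inv\<^bsub>Q\<^esub> \<sigma> c = \<sigma> (t \<otimes> y)"
    using cl cc u by (simp add: Q.m_assoc)
  ultimately have "t \<otimes> y \<in> contr (ext (rad_power (Suc i)))" using cl by (simp only: ideal_power_K contr_def mem_Collect_eq m_closed)
  then obtain d where d: "d \<in> C" "d \<otimes> (t \<otimes> y) \<in> rad_power (Suc i)" unfolding contr_ext[OF rad_power_left_ideal] by blast
  then have "(d \<otimes> t) \<otimes> y \<in> rad_power (Suc i)" using regular_closed[OF d(1)] cl by (simp add: m_assoc del: ideal_power.simps)
  moreover have "d \<otimes> t \<in> reg_mod" using reg_mod_mult d(1) t(1) regular_eq_reg_mod by blast
  ultimately show ?thesis using y(1) unfolding tors_def by blast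
qed

end

section \<open>Assembly of the equivalence and its consequences\<close>

theorem theorem2p2:
  fixes R :: "('a, 'm) ring_scheme"
  assumes "ring R"
  shows
    "(has_left_artinian_left_quotient_ring R \<longleftrightarrow>
        left_goldie (reduced_ring R) \<and>
        nilpotent_ideal (prime_radical R) R \<and>
        regular_mod_radical R \<subseteq> regular_elements R \<and>
        (\<forall>i\<in>{1..nilpotency_degree (prime_radical R) R}.
           no_infinite_direct_sums (reduced_ring R) (torsion_free_layer R i)) \<and>
        (\<forall>i\<in>{1..nilpotency_degree (prime_radical R) R}. right_mult_injective R i))
     \<and>
     (left_goldie (reduced_ring R) \<and> nilpotent_ideal (prime_radical R) R \<longrightarrow>
        (\<forall>i\<in>{1..nilpotency_degree (prime_radical R) R}.
           (right_mult_injective R i \<longleftrightarrow> two_sided_torsion_condition R i) \<and>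
           (right_mult_injective R i \<longleftrightarrow> right_torsion_condition R i)))
     \<and>
     (has_left_artinian_left_quotient_ring R \<longrightarrow>
        regular_elements R = regular_mod_radical R \<and>
        has_left_quotient_ring (reduced_ring R) \<and>
        (\<forall>(Q :: ('q, 'n) ring_scheme) \<sigma>. left_quotient_ring R Q \<sigma> \<longrightarrow>
           localized_ideal R Q \<sigma> (prime_radical R) = prime_radical Q \<and>
           nilpotent_ideal (prime_radical Q) Q \<and>
           nilpotency_degree (prime_radical Q) Q = nilpotency_degree (prime_radical R) R \<and>
           (\<forall>(Qb :: ('p, 'k) ring_scheme) \<sigma>b. left_quotient_ring (reduced_ring R) Qb \<sigma>b \<longrightarrow>
              (let N = localized_ideal R Q \<sigma> (prime_radical R) in
               \<exists>\<phi>\<in>ring_iso (Q Quot N) Qb.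
                 (\<forall>c\<in>regular_elements R. \<forall>r\<in>carrier R.
                    \<phi> (N +>\<^bsub>Q\<^esub> left_fraction Q \<sigma> c r)
                      = left_fraction Qb \<sigma>b (residue_class R c) (residue_class R r)) \<and>
                 (\<forall>c\<in>regular_mod_radical R. \<forall>r\<in>carrier R.
                    the_inv_into (carrier (Q Quot N)) \<phi>
                        (left_fraction Qb \<sigma>b (residue_class R c) (residue_class R r))
                      = N +>\<^bsub>Q\<^esub> left_fraction Q \<sigma> c r)))))"
proof -
  interpret ring R by fact
  let ?N = "prime_radical R"
  let ?\<nu> = "nilpotency_degree ?N R"
  let ?d = "\<forall>i\<in>{1..?\<nu>}. no_infinite_direct_sums (reduced_ring R) (torsion_free_layer R i)"
  let ?e = "\<forall>i\<in>{1..?\<nu>}. right_mult_injective R i"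
  \<comment> \<open>The hypothesis provides one left Artinian left quotient ring, on sets of pairs.
    The internal chain condition carries the property to a left quotient ring on any type.\<close>
  have fwd: "artinian_quotient R Q \<sigma>"
    if R: "has_left_artinian_left_quotient_ring R" and lq: "left_quotient_ring R Q \<sigma>"
    for Q :: "('y, 'z) ring_scheme" and \<sigma>
  proof -
    obtain Q' :: "('a \<times> 'a) set ring" and \<sigma>' where q: "left_quotient_ring R Q' \<sigma>'" "left_artinian Q'"
      using R by (auto simp: has_left_artinian_left_quotient_ring_def)
    interpret q: left_quotient R Q' \<sigma>' by unfold_locales (rule q)
    interpret Q: left_quotient R Q \<sigma> by unfold_locales (rule lq)
    show ?thesis by unfold_locales (use q(2) q.left_artinian_iff Q.left_artinian_iff in blast)
  qed
  have 12: "left_goldie (reduced_ring R) \<and> nilpotent_ideal ?N R \<and>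
      regular_mod_radical R \<subseteq> regular_elements R \<and> ?d \<and> ?e \<and>
      regular_elements R = regular_mod_radical R \<and> has_left_quotient_ring (reduced_ring R)"
    if R: "has_left_artinian_left_quotient_ring R"
  proof -
    obtain Q :: "('a \<times> 'a) set ring" and \<sigma> where q: "left_quotient_ring R Q \<sigma>"
      using R by (auto simp: has_left_artinian_left_quotient_ring_def)
    interpret q: artinian_quotient R Q \<sigma> by (rule fwd[OF R q])
    interpret ore_mod R by (rule goldie_imp_ore_mod[OF q.reduced_left_goldie])
    have ?d using no_infinite_direct_sums_layer_iff q.layer_no_flag by blast
    moreover have ?e using right_mult_injective_iff q.layer_torsion_right by blast
    \<comment> \<open>The left quotient ring at hand is \<open>Q/K\<close>, which lives on another
      type and is moved to sets of pairs of residue classes.\<close>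
    moreover have "has_left_quotient_ring (reduced_ring R)"
      using left_ring_of_fractions_on_pair_sets q.reduced_fractions(1)
      unfolding has_left_quotient_ring_def left_quotient_ring_def by blast
    ultimately show ?thesis using q.reduced_left_goldie q.rad_nilpotent q.regular_eq_reg_mod by simp
  qed
  have 21: "has_left_artinian_left_quotient_ring R"
    if g: "left_goldie (reduced_ring R)" and nil: "nilpotent_ideal ?N R"
      and c: "regular_mod_radical R \<subseteq> regular_elements R" and d: ?d and e: ?e
  proof -
    interpret ore_mod R by (rule goldie_imp_ore_mod[OF g])
    \<comment> \<open>Index 0 lies outside the range of (d) and (e). There the flag condition is
      part of (a), and the torsion condition is the regularity of \<open>c\<close> modulo the
      radical.\<close>
    have t0: "tors 0 = rad"
    proof
      show "tors 0 \<subseteq> rad"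
        using reg_mod_left ideal_power_one[OF prime_radical_ideal] by (auto simp: tors_def)
      show "rad \<subseteq> tors 0" using rad_power_Suc_tors[of 0] ideal_power_one[OF prime_radical_ideal] by simp
    qed
    \<comment> \<open>Beyond the nilpotency degree the layer is zero, so both conditions hold
      trivially.\<close>
    have z: "rad_power i \<subseteq> tors i" if "?\<nu> < i" for i
      using nilpotency_degree_spec[OF nil that] left_ideal_zero[OF tors_left_ideal] by simp
    have "quotient_conditions R"
    proof (unfold_locales, rule g, rule nil, rule c)
      show "\<not> descending_flag R (rad_power i) (tors i) D x" for i D x
      proof -
        consider "i = 0" | "i \<in> {1..?\<nu>}" | "?\<nu> < i" by (cases "i = 0"; cases "i \<le> ?\<nu>") auto
        then show ?thesis
        proof cases
          case 1
          then show ?thesis using goldie_reduced_flag(2)[OF g] t0 by simp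
        next
          case 2
          then show ?thesis using d no_infinite_direct_sums_layer_iff by blast
        next
          case 3
          then show ?thesis using z[OF 3] unfolding descending_flag_def by blast
        qed
      qed
      show "y \<in> tors i" if "c \<in> reg_mod" "y \<in> rad_power i" "y \<otimes>\<^bsub>R\<^esub> c \<in> tors i" for c y i
      proof -
        consider "i = 0" | "i \<in> {1..?\<nu>}" | "?\<nu> < i" by (cases "i = 0"; cases "i \<le> ?\<nu>") auto
        then show ?thesis
        proof cases
          case 1
          then show ?thesis using reg_mod_right that t0 rad_power_closed by metis
        next
          case 2
          then show ?thesis using e that right_mult_injective_iff by blast
        next
          case 3
          then show ?thesis using z[OF 3] that by blast
        qed
      qed
    qed
    then show ?thesis by (rule quotient_conditions.has_left_artinian)
  qed
  have 3: "localized_ideal R Q \<sigma> ?N = prime_radical Q \<and> nilpotent_ideal (prime_radical Q) Q \<and>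
      nilpotency_degree (prime_radical Q) Q = ?\<nu> \<and>
      (\<forall>(Qb :: ('p, 'k) ring_scheme) \<sigma>b. left_quotient_ring (reduced_ring R) Qb \<sigma>b \<longrightarrow>
        (let N = localized_ideal R Q \<sigma> ?N in
         \<exists>\<phi>\<in>ring_iso (Q Quot N) Qb.
           (\<forall>c\<in>regular_elements R. \<forall>r\<in>carrier R.
              \<phi> (N +>\<^bsub>Q\<^esub> left_fraction Q \<sigma> c r)
                = left_fraction Qb \<sigma>b (residue_class R c) (residue_class R r)) \<and>
           (\<forall>c\<in>regular_mod_radical R. \<forall>r\<in>carrier R.
              the_inv_into (carrier (Q Quot N)) \<phi>
                  (left_fraction Qb \<sigma>b (residue_class R c) (residue_class R r))
                = N +>\<^bsub>Q\<^esub> left_fraction Q \<sigma> c r)))"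
    if R: "has_left_artinian_left_quotient_ring R" and lq: "left_quotient_ring R Q \<sigma>"
    for Q :: "('q, 'n) ring_scheme" and \<sigma>
  proof -
    interpret q: artinian_quotient R Q \<sigma> by (rule fwd[OF R lq])
    have N: "localized_ideal R Q \<sigma> ?N = prime_radical Q"
      using q.localized_ideal_eq_ext left_ideal_sub[OF rad_left_ideal] q.ext_rad by (simp add: subsetI)
    have "\<exists>\<phi>\<in>ring_iso (Q Quot prime_radical Q) Qb.
        (\<forall>c\<in>regular_elements R. \<forall>r\<in>carrier R.
           \<phi> (prime_radical Q +>\<^bsub>Q\<^esub> left_fraction Q \<sigma> c r)
             = left_fraction Qb \<sigma>b (residue_class R c) (residue_class R r)) \<and>
        (\<forall>c\<in>regular_mod_radical R. \<forall>r\<in>carrier R.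
           the_inv_into (carrier (Q Quot prime_radical Q)) \<phi>
               (left_fraction Qb \<sigma>b (residue_class R c) (residue_class R r))
             = prime_radical Q +>\<^bsub>Q\<^esub> left_fraction Q \<sigma> c r)"
      if Qb: "left_quotient_ring (reduced_ring R) Qb \<sigma>b" for Qb :: "('p, 'k) ring_scheme" and \<sigma>b
    proof -
      obtain \<phi> where \<phi>: "\<phi> \<in> ring_iso (Q Quot prime_radical Q) Qb"
        "\<And>c r. c \<in> regular_elements (reduced_ring R) \<Longrightarrow> r \<in> carrier (reduced_ring R) \<Longrightarrow>
           \<phi> (left_fraction (Q Quot prime_radical Q) q.reduced_map c r) = left_fraction Qb \<sigma>b c r"
        using left_quotient_ring_unique[OF reduced_ring_ring q.reduced_fractions(1) Qb] by blast
      have inj: "inj_on \<phi> (carrier (Q Quot prime_radical Q))"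
        using \<phi>(1) by (auto simp: ring_iso_def bij_betw_def)
      have val: "\<phi> (prime_radical Q +>\<^bsub>Q\<^esub> left_fraction Q \<sigma> c r)
          = left_fraction Qb \<sigma>b (residue_class R c) (residue_class R r)"
        if cr: "c \<in> regular_elements R" "r \<in> carrier R" for c r
      proof -
        have "residue_class R c \<in> regular_elements (reduced_ring R)"
          using cr(1) q.regular_eq_reg_mod unfolding regular_reduced by blast
        moreover have "residue_class R r \<in> carrier (reduced_ring R)" using cr(2) residue_surj by blast
        ultimately show ?thesis using \<phi>(2) q.reduced_fractions(2)[OF cr] by metis
      qed
      have "the_inv_into (carrier (Q Quot prime_radical Q)) \<phi>
           (left_fraction Qb \<sigma>b (residue_class R c) (residue_class R r))
          = prime_radical Q +>\<^bsub>Q\<^esub> left_fraction Q \<sigma> c r"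
        if c: "c \<in> regular_mod_radical R" and r: "r \<in> carrier R" for c r
      proof -
        have cC: "c \<in> regular_elements R" using c q.regular_eq_reg_mod by simp
        have "prime_radical Q +>\<^bsub>Q\<^esub> left_fraction Q \<sigma> c r \<in> carrier (Q Quot prime_radical Q)"
          using q.fraction_closed[OF cC r] q.Q.quot_surj[OF q.K_ideal] by blast
        then show ?thesis unfolding val[OF cC r, symmetric] by (rule the_inv_into_f_f[OF inj])
      qed
      then show ?thesis using \<phi>(1) val by blast
    qed
    then show ?thesis using N q.K_nilpotent q.nilpotency_degree_K by (simp add: Let_def)
  qed
  have eqv: "left_goldie (reduced_ring R) \<Longrightarrow>
      (right_mult_injective R i \<longleftrightarrow> two_sided_torsion_condition R i) \<and>
      (right_mult_injective R i \<longleftrightarrow> right_torsion_condition R i)" for i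
    using ore_mod.right_mult_injective_iff_two_sided ore_mod.right_mult_injective_iff_right goldie_imp_ore_mod
    by blast
  show ?thesis
  proof (intro conjI impI allI)
    show "has_left_artinian_left_quotient_ring R \<longleftrightarrow>
        left_goldie (reduced_ring R) \<and> nilpotent_ideal ?N R \<and>
        regular_mod_radical R \<subseteq> regular_elements R \<and> ?d \<and> ?e"
      using 12 21 by blast
  qed (use 12 3 eqv in blast)+
qed

end
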